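(* Let $k$ be a number field of degree $d>1$ with ring of integers $\mathfrak{o}$. Let $\mathfrak{n}\subset\mathfrak{o}$ be a nonzero ideal, and let $m\in\{2,\dotsc,d\}$. For any $m$-element subset $X\subset\mathfrak{n}$, the rational integer $$\prod_{\substack{S\subset\Sigma\\|S|=m}}{\det}^2(\sigma(x))^{\sigma\in S}_{x\in X}$$ is divisible by $$\Delta_{\mathrm{tame}}^{\binom{d-2}{m-2}}\,[\mathfrak{o}:\mathfrak{n}]^{2\binom{d-1}{m-1}}.$$
   Context: $\Sigma=\mathrm{Hom}(k,\overline{\mathbb{Q}})$ is the set of $d$ embeddings of $k$ into $\overline{\mathbb{Q}}$. For finite sets $S\subset\Sigma$ and $X\subset k$ of equal size, $(\sigma(x))^{\sigma\in S}_{x\in X}$ is the square matrix with rows indexed by $\sigma\in S$ and columns indexed by $x\in X$; its determinant is defined only up to sign (no ordering of $S$ and $X$ is specified), but its square ${\det}^2(\sigma(x))^{\sigma\in S}_{x\in X}$ is well defined. For a nonzero prime ideal $\mathfrak{p}\subset\mathfrak{o}$ dividing a rational prime $p$, let $f_{\mathfrak{p}}$ be the inertia degree of $k_{\mathfrak{p}}/\mathbb{Q}_p$. The tame discriminant is the positive integer $$\Delta_{\mathrm{tame}}:=\prod_p p^{d-f_p}\quad\text{with}\quad f_p:=\sum_{\mathfrak{p}\mid p}f_{\mathfrak{p}},$$ where $p$ runs over the rational primes (only ramified primes contribute nontrivially). Divisibility is in $\mathbb{Z}$ (zero is divisible by every integer). *)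

theory Defs
  imports
    "HOL-Algebra.Algebraic_Closure_Type"
    "HOL-Combinatorics.List_Permutation"
    "Jordan_Normal_Form.Determinant"
begin

text \<open>A number field is a type \<open>'k\<close> of characteristic 0 that is finite-dimensional over
  \<^typ>\<open>rat\<close>; the algebraic closure of the rationals is \<^typ>\<open>rat alg_closure\<close>.\<close>

global_interpretation rat_vs: Vector_Spaces.vector_space "\<lambda>(q::rat) (x::'k::field_char_0). of_rat q * x"
  defines rat_span = "rat_vs.span :: 'k set \<Rightarrow> 'k set"
    and rat_dim = "rat_vs.dim :: 'k set \<Rightarrow> nat"
  by standard (simp_all add: algebra_simps of_rat_add of_rat_mult)

definition number_field :: "'k::field_char_0 itself \<Rightarrow> bool" where
  "number_field _ \<longleftrightarrow> (\<exists>B::'k set. finite B \<and> rat_span B = UNIV)"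

definition nf_degree :: "'k::field_char_0 itself \<Rightarrow> nat" where
  "nf_degree _ = rat_dim (UNIV :: 'k set)"

definition embeddings :: "('k::field_char_0 \<Rightarrow> rat alg_closure) set" where
  "embeddings = {\<sigma>. field_hom \<sigma>}"


definition embedding_mat :: "('k \<Rightarrow> 'l) list \<Rightarrow> 'k list \<Rightarrow> 'l mat" where
  "embedding_mat ss xs = mat (length ss) (length xs) (\<lambda>(i, j). (ss ! i) (xs ! j))"

text \<open>The enumerations of \<open>S\<close> and \<open>T\<close> are arbitrary; by \<open>det_sq_set\<close> below they do not matter.\<close>

definition det_sq :: "('k \<Rightarrow> 'l::comm_ring_1) set \<Rightarrow> 'k set \<Rightarrow> 'l" where
  "det_sq S T = (det (embedding_mat (SOME ss. distinct ss \<and> set ss = S)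
                                    (SOME xs. distinct xs \<and> set xs = T)))\<^sup>2"

lemma det_embedding_mat_row_perm:
  fixes ss ss' :: "('k \<Rightarrow> 'l::comm_ring_1) list"
  assumes "distinct ss" "distinct ss'" "set ss = set ss'" "length ss = length xs"
  shows "(det (embedding_mat ss' xs))\<^sup>2 = (det (embedding_mat ss xs))\<^sup>2"
proof -
  let ?n = "length ss"
  have "mset ss' = mset ss"
    using assms by (simp add: set_eq_iff_mset_eq_distinct)
  then obtain p where p: "p permutes {..<?n}" "permute_list p ss = ss'"
    by (rule mset_eq_permutation)
  have len: "length ss' = ?n" using p by auto
  have bound: "p i < ?n" if "i < ?n" for i
    using permutes_in_image[OF p(1), of i] that by simp
  have "embedding_mat ss' xs = mat ?n ?n (\<lambda>(i, j). embedding_mat ss xs $$ (p i, j))"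
    using p assms len
    by (intro eq_matI)
      (auto simp: embedding_mat_def permute_list_nth[of p] bound[unfolded assms(4)])
  also have "det \<dots> = signof p * det (embedding_mat ss xs)"
    using p assms by (intro det_permute_rows) (auto simp: embedding_mat_def lessThan_atLeast0)
  finally show ?thesis
    by (simp add: power_mult_distrib sign_def)
qed

lemma det_embedding_mat_col_perm:
  fixes ss :: "('k \<Rightarrow> 'l::comm_ring_1) list"
  assumes "distinct xs" "distinct xs'" "set xs = set xs'" "length ss = length xs"
  shows "(det (embedding_mat ss xs'))\<^sup>2 = (det (embedding_mat ss xs))\<^sup>2"
proof -
  have col: "det (embedding_mat ss ys) = det (mat (length ys) (length ss) (\<lambda>(i, j). (ss ! j) (ys ! i)))"
    if "length ys = length ss" for ys
  proof -
    have "embedding_mat ss ys \<in> carrier_mat (length ss) (length ss)"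
      using that by (simp add: embedding_mat_def)
    from det_transpose[OF this]
    have "det (embedding_mat ss ys) = det (transpose_mat (embedding_mat ss ys))" ..
    also have "transpose_mat (embedding_mat ss ys) =
        mat (length ys) (length ss) (\<lambda>(i, j). (ss ! j) (ys ! i))"
      by (intro eq_matI) (auto simp: embedding_mat_def)
    finally show ?thesis .
  qed
  let ?n = "length xs"
  have "mset xs' = mset xs"
    using assms by (simp add: set_eq_iff_mset_eq_distinct)
  then obtain p where p: "p permutes {..<?n}" "permute_list p xs = xs'"
    by (rule mset_eq_permutation)
  have len: "length xs' = ?n" using p by auto
  have bound: "p i < ?n" if "i < ?n" for i
    using permutes_in_image[OF p(1), of i] that by simp
  let ?A = "\<lambda>ys. mat ?n ?n (\<lambda>(i, j). (ss ! j) (ys ! i)) :: 'l mat"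
  have "?A xs' = mat ?n ?n (\<lambda>(i, j). ?A xs $$ (p i, j))"
    using p assms len
    by (intro eq_matI)
      (auto simp: permute_list_nth[of p] bound)
  also have "det \<dots> = signof p * det (?A xs)"
    using p assms by (intro det_permute_rows) (auto simp: lessThan_atLeast0)
  finally have "(det (?A xs'))\<^sup>2 = (det (?A xs))\<^sup>2"
    by (simp add: power_mult_distrib sign_def)
  thus ?thesis
    using col[of xs'] col[of xs] len assms by simp
qed

lemma det_sq_set:
  fixes ss :: "('k \<Rightarrow> 'l::comm_ring_1) list"
  assumes "distinct ss" "distinct xs" "length ss = length xs"
  shows "det_sq (set ss) (set xs) = (det (embedding_mat ss xs))\<^sup>2"
proof -
  define ss' where "ss' = (SOME zs. distinct zs \<and> set zs = set ss)"
  define xs' where "xs' = (SOME zs. distinct zs \<and> set zs = set xs)"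
  have ss': "distinct ss' \<and> set ss' = set ss"
    unfolding ss'_def by (rule someI[of _ ss]) (use assms in simp)
  have xs': "distinct xs' \<and> set xs' = set xs"
    unfolding xs'_def by (rule someI[of _ xs]) (use assms in simp)
  have len: "length ss' = length ss"
    using ss' assms by (metis distinct_card)
  have "det_sq (set ss) (set xs) = (det (embedding_mat ss' xs'))\<^sup>2"
    unfolding det_sq_def ss'_def xs'_def ..
  also have "\<dots> = (det (embedding_mat ss' xs))\<^sup>2"
    using ss' xs' assms len by (intro det_embedding_mat_col_perm) auto
  also have "\<dots> = (det (embedding_mat ss xs))\<^sup>2"
    using ss' assms by (intro det_embedding_mat_row_perm) auto
  finally show ?thesis .
qed


definition ring_of_integers :: "'k::field_char_0 ring" where
  "ring_of_integers =
     \<lparr>carrier = {x. algebraic_int x}, monoid.mult = (*), one = 1, zero = 0, add = (+)\<rparr>"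

definition ideal_index :: "'k::field_char_0 set \<Rightarrow> nat" where
  "ideal_index I = card (a_rcosets\<^bsub>ring_of_integers\<^esub> I)"

text \<open>The residue field of the completion of \<open>'k\<close> at \<open>P\<close> is the quotient of the ring of integers
  by \<open>P\<close>. The image of the rational integers in it is its prime field, so the dimension below is
  the degree of the residue field extension.\<close>

definition inertia_degree :: "'k::field_char_0 set \<Rightarrow> nat" where
  "inertia_degree P =
     ring.dim (ring_of_integers Quot P)
       (range (\<lambda>i::int. P +>\<^bsub>ring_of_integers\<^esub> of_int i))
       (carrier (ring_of_integers Quot P))"

definition primes_above :: "nat \<Rightarrow> 'k::field_char_0 set set" where
  "primes_above p = {P. primeideal P ring_of_integers \<and> of_nat p \<in> P}"

definition inertia_degree_sum :: "'k::field_char_0 itself \<Rightarrow> nat \<Rightarrow> nat" where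
  "inertia_degree_sum _ p = (\<Sum>P\<in>(primes_above p :: 'k set set). inertia_degree P)"

text \<open>The index set is restricted to the primes with exponent \<open>d - f\<^sub>p \<noteq> 0\<close>, i.e.\ the
  ramified ones, since a product over an infinite set is 1 by convention. The
  subtraction on \<^typ>\<open>nat\<close> is harmless because \<open>f\<^sub>p \<le> d\<close> always holds.\<close>

definition tame_discriminant :: "'k::field_char_0 itself \<Rightarrow> nat" where
  "tame_discriminant K =
     (\<Prod>p | Factorial_Ring.prime p \<and> inertia_degree_sum K p \<noteq> nf_degree K.
        p ^ (nf_degree K - inertia_degree_sum K p))"

end

theory Submission
  imports Defs
begin

text \<open>Since the product is an algebraic integer fixed by the Galois action, it is a rational integer,
  and it suffices to bound its \<open>p\<close>-adic valuation from below for every prime \<open>p\<close>. Instead of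
  completing, choose a valuation ring \<open>V\<close> of the algebraic closure of the rationals in which \<open>p\<close> is
  not invertible; every embedding \<open>\<sigma>\<close> pulls \<open>V\<close> back to a discrete valuation ring of the number field.
  Group the embeddings into classes: \<open>\<sigma>\<close> and \<open>\<tau>\<close> are equivalent if they agree on algebraic integers
  modulo the maximal ideal of \<open>V\<close>. There are at most \<open>f\<^sub>p\<close> classes, and their ramification indices
  have sum at most \<open>d\<close>.

  Within a class with uniformizer \<open>\<pi>\<close>, all embeddings \<open>\<tau>\<close> expand an integral \<open>x\<close> as the sum of
  \<open>c\<^sub>t * \<tau>(\<pi>)^t\<close> with the same coefficients \<open>c\<^sub>t\<close>. By multilinearity the determinant for \<open>S\<close> is thus
  divisible by \<open>\<pi>^(0 + 1 + \<dots> + (s - 1))\<close> for every class meeting \<open>S\<close> in \<open>s\<close> embeddings, so that its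
  square contributes \<open>s * (s - 1)\<close>, the number of ordered pairs in that class. Summing over \<open>S\<close>, every
  pair is counted \<open>(d - 2) choose (m - 2)\<close> times. A class with \<open>n\<close> elements and ramification index
  \<open>e\<close> then yields at least \<open>2 * n - e - 1\<close> factors \<open>p\<close>, because \<open>n * (n - 1) - e * (2 * n - e - 1) =
  (n - e) * (n - e - 1) \<ge> 0\<close>, and the sum of \<open>2 * n - e - 1\<close> over the classes is at least \<open>d - f\<^sub>p\<close>.
  The ideal is locally principal, and dividing \<open>T\<close> by a local generator \<open>y\<close> turns each determinant into one
  with integral entries at the cost of the factor \<open>\<Prod>\<sigma>\<in>S. \<sigma> y\<close>, where the norm of \<open>y\<close> is divisible by
  the index of the ideal.\<close>

section \<open>Valuation rings and algebraic integers\<close>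

text \<open>What must be produced without a completion are the coefficients shared by a class. They
  are iterated p-th powers: congruent elements become arbitrarily close under repeated p-th powers,
  so \<open>\<sigma> x ^ (p ^ k)\<close> depends on the member of the class only up to a high power
  of the uniformizer; and since the residue field is finite, \<open>k\<close> can be chosen large
  with \<open>x ^ (p ^ k)\<close> still congruent to \<open>x\<close>. \<open>V\<close> itself need
  not be discrete. Valuations are expressed as membership of quotients in \<open>V\<close>, and
  uniformizers exist only for the pullbacks to the number field. In the sum of 2 n - e - 1 both e
  and the number of classes enter negatively, so upper bounds suffice. Above a prime with invariants
  e and f there are at most f classes, because distinct residue maps are linearly independent; hence
  the sum of e over the classes is at most the sum of e f over the primes, which is at most d.
  Rationality of the product is obtained without a Galois group, from the rationality of traces and
  sums over all orderings of the embeddings.\<close>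

definition is_subring :: "'a::field set \<Rightarrow> bool" where
  "is_subring A \<longleftrightarrow> 1 \<in> A \<and> (\<forall>x\<in>A. \<forall>y\<in>A. x - y \<in> A \<and> x * y \<in> A)"

lemma
  assumes "is_subring A"
  shows is_subring_1: "1 \<in> A"
    and is_subring_0: "0 \<in> A"
    and is_subring_diff: "\<lbrakk>x \<in> A; y \<in> A\<rbrakk> \<Longrightarrow> x - y \<in> A"
    and is_subring_mult: "\<lbrakk>x \<in> A; y \<in> A\<rbrakk> \<Longrightarrow> x * y \<in> A"
    and is_subring_uminus: "x \<in> A \<Longrightarrow> - x \<in> A"
    and is_subring_add: "\<lbrakk>x \<in> A; y \<in> A\<rbrakk> \<Longrightarrow> x + y \<in> A"
proof -
  show 1: "1 \<in> A" and d: "\<And>x y. \<lbrakk>x \<in> A; y \<in> A\<rbrakk> \<Longrightarrow> x - y \<in> A" "\<And>x y. \<lbrakk>x \<in> A; y \<in> A\<rbrakk> \<Longrightarrow> x * y \<in> A"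
    using assms by (auto simp: is_subring_def)
  show 0: "0 \<in> A" using d(1)[OF 1 1] by simp
  show m: "- x \<in> A" if "x \<in> A" for x using d(1)[OF 0 that] by simp
  show "x + y \<in> A" if "x \<in> A" "y \<in> A" for x y using d(1)[OF that(1) m[OF that(2)]] by simp
qed

lemma is_subring_power: "is_subring A \<Longrightarrow> x \<in> A \<Longrightarrow> x ^ n \<in> A"
  by (induction n) (auto intro: is_subring_1 is_subring_mult)

lemma is_subring_sum: "is_subring A \<Longrightarrow> (\<And>i. i \<in> I \<Longrightarrow> f i \<in> A) \<Longrightarrow> sum f I \<in> A"
  by (induction I rule: infinite_finite_induct) (auto intro: is_subring_0 is_subring_add)

lemma is_subring_prod: "is_subring A \<Longrightarrow> (\<And>i. i \<in> I \<Longrightarrow> f i \<in> A) \<Longrightarrow> prod f I \<in> A"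
  by (induction I rule: infinite_finite_induct) (auto intro: is_subring_1 is_subring_mult)

lemma is_subring_of_nat: "is_subring A \<Longrightarrow> of_nat n \<in> A"
  by (induction n) (auto intro: is_subring_0 is_subring_1 is_subring_add)

lemma is_subring_of_int: "is_subring A \<Longrightarrow> of_int n \<in> A"
  by (cases n rule: int_diff_cases) (auto intro: is_subring_of_nat is_subring_diff)

lemma is_subring_Ints: "is_subring \<int>"
  by (auto simp: is_subring_def)

lemma is_subring_poly: "is_subring A \<Longrightarrow> x \<in> A \<Longrightarrow> (\<And>i. poly.coeff q i \<in> A) \<Longrightarrow> poly q x \<in> A"
  by (auto simp: poly_altdef intro!: is_subring_sum is_subring_mult is_subring_power)

definition adjoin :: "'a::field set \<Rightarrow> 'a \<Rightarrow> 'a set" where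
  "adjoin A x = {poly q x |q. \<forall>i. poly.coeff q i \<in> A}"

lemma is_subring_adjoin:
  assumes "is_subring A"
  shows "is_subring (adjoin A x)"
proof -
  have 1: "1 \<in> adjoin A x"
    unfolding adjoin_def
    by (intro CollectI exI[of _ 1]) (use assms in \<open>auto simp: coeff_1 intro: is_subring_1 is_subring_0\<close>)
  have "poly p x - poly q x \<in> adjoin A x" "poly p x * poly q x \<in> adjoin A x"
    if "\<forall>i. poly.coeff p i \<in> A" "\<forall>i. poly.coeff q i \<in> A" for p q
  proof -
    show "poly p x - poly q x \<in> adjoin A x" unfolding adjoin_def
      by (intro CollectI exI[of _ "p - q"]) (use assms that in \<open>auto intro: is_subring_diff\<close>)
    show "poly p x * poly q x \<in> adjoin A x" unfolding adjoin_def
      by (intro CollectI exI[of _ "p * q"])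
        (use assms that in \<open>auto simp: coeff_mult intro!: is_subring_sum is_subring_mult\<close>)
  qed
  thus ?thesis using 1 by (force simp: is_subring_def adjoin_def)
qed

lemma adjoin_superset: "is_subring A \<Longrightarrow> A \<subseteq> adjoin A x"
  unfolding adjoin_def
  by (intro subsetI CollectI, rule_tac x = "[:xa:]" in exI)
    (auto simp: coeff_pCons split: nat.splits intro: is_subring_0)

lemma adjoin_self: "is_subring A \<Longrightarrow> x \<in> adjoin A x"
  unfolding adjoin_def
  by (intro CollectI exI[of _ "[:0, 1:]"])
    (auto simp: coeff_pCons split: nat.splits intro: is_subring_0 is_subring_1)

definition val_ring :: "'a::field set \<Rightarrow> bool" where
  "val_ring V \<longleftrightarrow> is_subring V \<and> (\<forall>x. x \<in> V \<or> inverse x \<in> V)"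

lemma val_ring_subring: "val_ring V \<Longrightarrow> is_subring V"
  by (simp add: val_ring_def)

text \<open>The leading term of \<open>q\<close> is traded for lower ones through the relation for
  \<open>x ^ n\<close>. This is the degree descent that contradicts minimality in
  \<open>exists_val_ring\<close>.\<close>

lemma poly_over_low_degree:
  assumes A: "is_subring A" and q: "\<forall>i. poly.coeff q i \<in> A" and n: "degree q = n" "n > 0"
    and s: "\<forall>i. poly.coeff s i \<in> A" "degree s < n" "x ^ n = poly s x"
  shows "\<exists>q'. (\<forall>i. poly.coeff q' i \<in> A) \<and> degree q' < n \<and> poly q' x = poly q x"
proof -
  define q' where "q' = q - Polynomial.monom (poly.coeff q n) n + Polynomial.smult (poly.coeff q n) s"
  have "poly q' x = poly q x"
    using s(3) by (simp add: q'_def poly_monom)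
  moreover have "poly.coeff q' i \<in> A" for i
    using A q s(1) by (auto simp: q'_def intro!: is_subring_add is_subring_mult is_subring_diff is_subring_0)
  moreover have "degree q' < n"
  proof -
    have "poly.coeff q' i = 0" if "i \<ge> n" for i
      using that n s(2) by (auto simp: q'_def coeff_eq_0)
    thus ?thesis using n(2) by (metis leading_coeff_0_iff degree_0 not_le)
  qed
  ultimately show ?thesis by blast
qed

text \<open>A form of Chevalley's extension theorem: \<open>V\<close> is maximal among the subrings
  that contain \<open>A0\<close> and omit \<open>inverse \<pi>\<close>. Maximality puts
  \<open>inverse \<pi>\<close> into \<open>adjoin V x\<close> for every missing \<open>x\<close>; if
  \<open>x\<close> and \<open>inverse x\<close> were both missing, two such expressions of least
  degree would allow one of them to be shortened.\<close>

theorem exists_val_ring: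
  assumes A0: "is_subring A0" and pi: "\<pi> \<in> A0" "inverse \<pi> \<notin> A0"
  obtains V where "val_ring V" "A0 \<subseteq> V" "inverse \<pi> \<notin> V"
proof -
  define \<A> where "\<A> = {A. is_subring A \<and> A0 \<subseteq> A \<and> inverse \<pi> \<notin> A}"
  have "\<exists>V\<in>\<A>. \<forall>Q\<in>\<A>. V \<subseteq> Q \<longrightarrow> Q = V"
  proof (rule subset_Zorn_nonempty)
    show "\<A> \<noteq> {}" using assms by (auto simp: \<A>_def)
    fix C assume C: "C \<noteq> {}" "subset.chain \<A> C"
    have sub: "is_subring (\<Union>C)"
    proof -
      have 1: "1 \<in> \<Union>C"
        using C by (force simp: subset.chain_def \<A>_def is_subring_def)
      have "x - y \<in> \<Union>C \<and> x * y \<in> \<Union>C" if "x \<in> \<Union>C" "y \<in> \<Union>C" for x y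
      proof -
        from that obtain Q Y where QQ: "Q \<in> C" "x \<in> Q" "Y \<in> C" "y \<in> Y" by blast
        then consider "Q \<subseteq> Y" | "Y \<subseteq> Q" using C(2) by (meson subset.chain_def subset_chain_def)
        then obtain Z where Z: "Z \<in> C" "x \<in> Z" "y \<in> Z" using QQ by cases blast+
        hence "is_subring Z" using C(2) by (auto simp: subset.chain_def \<A>_def)
        thus ?thesis using Z by (auto simp: is_subring_def)
      qed
      thus ?thesis using 1 by (auto simp: is_subring_def)
    qed
    moreover have "A0 \<subseteq> \<Union>C"
      using C by (force simp: subset.chain_def \<A>_def)
    moreover have "inverse \<pi> \<notin> \<Union>C"
      using C by (force simp: subset.chain_def \<A>_def)
    ultimately show "\<Union>C \<in> \<A>" by (auto simp: \<A>_def)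
  qed
  then obtain V where "V \<in> \<A>" and max: "\<And>Q. Q \<in> \<A> \<Longrightarrow> V \<subseteq> Q \<Longrightarrow> Q = V" by blast
  hence V: "is_subring V" "A0 \<subseteq> V" "inverse \<pi> \<notin> V" by (auto simp: \<A>_def)
  have pi0: "\<pi> \<noteq> 0" using V is_subring_0 by force
  have piV: "\<pi> \<in> V" using pi V by auto
  have adj: "inverse \<pi> \<in> adjoin V x" if "x \<notin> V" for x
  proof (rule ccontr)
    assume "inverse \<pi> \<notin> adjoin V x"
    hence "adjoin V x \<in> \<A>"
      using V adjoin_superset[OF V(1), of x] is_subring_adjoin[OF V(1)] by (auto simp: \<A>_def)
    from max[OF this adjoin_superset[OF V(1)]] adjoin_self[OF V(1), of x] that show False by auto
  qed
  \<comment> \<open>\<open>\<pi>\<close> behaves like an element of the Jacobson radical. If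
    \<open>inverse u\<close> were missing, \<open>inverse \<pi>\<close> would be a polynomial in
    \<open>inverse u\<close>; multiplying by a power \<open>u ^ k\<close>, which is 1 modulo
    \<open>\<pi>\<close>, clears the denominators and puts \<open>inverse \<pi>\<close> into
    \<open>V\<close>.\<close>
  have unit: "1 - \<pi> * b \<noteq> 0 \<and> inverse (1 - \<pi> * b) \<in> V" if b: "b \<in> V" for b
  proof -
    define u where "u = 1 - \<pi> * b"
    have nz: "1 - \<pi> * c \<noteq> 0" if "c \<in> V" for c
    proof
      assume "1 - \<pi> * c = 0"
      hence "inverse \<pi> = c" using pi0 by (simp add: field_simps)
      thus False using that V by simp
    qed
    have u: "u \<in> V" using V piV b by (auto simp: u_def intro: is_subring_diff is_subring_1 is_subring_mult)
    have "\<exists>c\<in>V. u ^ k = 1 - \<pi> * c" for k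
    proof (induction k)
      case 0
      show ?case using V(1) is_subring_0 by (intro bexI[of _ 0]) auto
    next
      case (Suc k)
      then obtain c where c: "c \<in> V" "u ^ k = 1 - \<pi> * c" by blast
      have "u ^ Suc k = 1 - \<pi> * (c + b - \<pi> * b * c)"
        by (simp add: c(2)) (simp add: u_def algebra_simps)
      thus ?case using b V piV c
        by (intro bexI[of _ "c + b - \<pi> * b * c"])
          (auto intro!: is_subring_diff is_subring_add is_subring_mult)
    qed
    note pow = this
    have "inverse u \<in> V"
    proof (rule ccontr)
      assume "inverse u \<notin> V"
      from adj[OF this] obtain q where q: "\<forall>i. poly.coeff q i \<in> V" "inverse \<pi> = poly q (inverse u)"
        by (auto simp: adjoin_def)
      define k where "k = degree q"
      have "u ^ k * inverse \<pi> = (\<Sum>i\<le>k. poly.coeff q i * (u ^ k * inverse u ^ i))"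
        unfolding q(2) poly_altdef k_def by (simp add: sum_distrib_left mult_ac)
      also have "\<dots> = (\<Sum>i\<le>k. poly.coeff q i * u ^ (k - i))"
        using nz[OF b] by (intro sum.cong) (auto simp: u_def power_diff field_simps)
      also have "\<dots> \<in> V"
        using V q u by (intro is_subring_sum is_subring_mult is_subring_power) auto
      finally have 1: "u ^ k * inverse \<pi> \<in> V" .
      from pow obtain c where c: "c \<in> V" "u ^ k = 1 - \<pi> * c" by blast
      have "inverse \<pi> = u ^ k * inverse \<pi> + c" using pi0 c by (simp add: field_simps)
      thus False using 1 c V is_subring_add by metis
    qed
    thus ?thesis using nz[OF b] by (simp add: u_def)
  qed
  \<comment> \<open>Moving the constant term of \<open>r\<close> to the left leaves the unit
    \<open>u\<close> times \<open>inverse \<pi>\<close>. Multiplying by \<open>x ^ n\<close> then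
    expresses \<open>x ^ n\<close> by lower powers of \<open>x\<close>, so \<open>q\<close> was not
    of least degree.\<close>
  have key: False
    if x: "x \<noteq> 0" and q: "\<forall>i. poly.coeff q i \<in> V" "inverse \<pi> = poly q x"
      and qmin: "\<And>q'. \<lbrakk>\<forall>i. poly.coeff q' i \<in> V; inverse \<pi> = poly q' x\<rbrakk> \<Longrightarrow> degree q \<le> degree q'"
      and r: "\<forall>i. poly.coeff r i \<in> V" "inverse \<pi> = poly r (inverse x)"
      and le: "degree r \<le> degree q" for x q r
  proof -
    define n where "n = degree q"
    have n0: "n > 0"
    proof (rule ccontr)
      assume "\<not> n > 0"
      then obtain c where "q = [:c:]" by (auto simp: n_def elim: degree_eq_zeroE)
      thus False using q V(3) by (auto simp: coeff_pCons split: nat.splits)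
    qed
    define u where "u = 1 - \<pi> * poly.coeff r 0"
    have u: "u \<noteq> 0" "inverse u \<in> V" using unit[of "poly.coeff r 0"] r(1) by (auto simp: u_def)
    have "inverse \<pi> = (\<Sum>i\<le>degree r. poly.coeff r i * inverse x ^ i)"
      by (subst r(2)) (simp add: poly_altdef)
    also have "\<dots> = (\<Sum>i\<le>n. poly.coeff r i * inverse x ^ i)"
      using le by (intro sum.mono_neutral_left) (auto simp: n_def coeff_eq_0)
    also have "\<dots> = poly.coeff r 0 + (\<Sum>i=1..n. poly.coeff r i * inverse x ^ i)"
      by (simp add: atMost_atLeast0 sum.atLeast_Suc_atMost)
    finally have "inverse \<pi> - poly.coeff r 0 = (\<Sum>i=1..n. poly.coeff r i * inverse x ^ i)"
      by simp
    moreover have "u * inverse \<pi> = inverse \<pi> - poly.coeff r 0"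
      using pi0 by (simp add: u_def algebra_simps)
    ultimately have "u * inverse \<pi> = (\<Sum>i=1..n. poly.coeff r i * inverse x ^ i)"
      by simp
    hence "x ^ n * (u * inverse \<pi>) = (\<Sum>i=1..n. poly.coeff r i * (x ^ n * inverse x ^ i))"
      by (simp add: sum_distrib_left mult_ac)
    also have "\<dots> = (\<Sum>i=1..n. poly.coeff r i * x ^ (n - i))"
      using x by (intro sum.cong) (auto simp: power_diff field_simps)
    finally have "x ^ n = \<pi> * inverse u * (\<Sum>i=1..n. poly.coeff r i * x ^ (n - i))"
      using pi0 u by (simp add: field_simps)
    also have "\<dots> = (\<Sum>i=1..n. \<pi> * inverse u * poly.coeff r i * x ^ (n - i))"
      by (simp add: sum_distrib_left mult_ac)
    finally have xn: "x ^ n = (\<Sum>i=1..n. \<pi> * inverse u * poly.coeff r i * x ^ (n - i))" .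
    define s where "s = (\<Sum>i=1..n. Polynomial.monom (\<pi> * inverse u * poly.coeff r i) (n - i))"
    have "poly s x = x ^ n" unfolding xn s_def by (simp add: poly_sum poly_monom)
    moreover have "\<forall>i. poly.coeff s i \<in> V"
      unfolding s_def coeff_sum using V piV u r
      by (auto intro!: is_subring_sum is_subring_mult is_subring_0)
    moreover have "degree s < n"
      unfolding s_def using n0
      by (intro degree_sum_less) (auto intro: le_less_trans[OF degree_monom_le])
    ultimately obtain q' where "\<forall>i. poly.coeff q' i \<in> V" "degree q' < n" "poly q' x = poly q x"
      using poly_over_low_degree[OF V(1) q(1) n_def[symmetric] n0, of s x] by auto
    with qmin[of q'] q(2) show False by (simp add: n_def)
  qed
  have "x \<in> V \<or> inverse x \<in> V" for x
  proof (rule ccontr)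
    assume neg: "\<not> (x \<in> V \<or> inverse x \<in> V)"
    have ex: "\<exists>q. (\<forall>i. poly.coeff q i \<in> V) \<and> inverse \<pi> = poly q y \<and>
        (\<forall>q'. (\<forall>i. poly.coeff q' i \<in> V) \<and> inverse \<pi> = poly q' y \<longrightarrow> degree q \<le> degree q')"
      if "y \<notin> V" for y
      using adj[OF that]
        ex_has_least_nat[of "\<lambda>q. (\<forall>i. poly.coeff q i \<in> V) \<and> inverse \<pi> = poly q y" _ degree]
      by (auto simp: adjoin_def)
    from ex[of x] neg obtain q where q: "\<forall>i. poly.coeff q i \<in> V" "inverse \<pi> = poly q x"
      "\<And>q'. (\<forall>i. poly.coeff q' i \<in> V) \<and> inverse \<pi> = poly q' x \<longrightarrow> degree q \<le> degree q'" by blast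
    from ex[of "inverse x"] neg obtain r where r: "\<forall>i. poly.coeff r i \<in> V" "inverse \<pi> = poly r (inverse x)"
      "\<And>q'. (\<forall>i. poly.coeff q' i \<in> V) \<and> inverse \<pi> = poly q' (inverse x) \<longrightarrow> degree r \<le> degree q'" by blast
    have x0: "x \<noteq> 0" using neg is_subring_0[OF V(1)] by auto
    show False
    proof (cases "degree r \<le> degree q")
      case True
      thus False using key[of x q r] x0 q r by blast
    next
      case False
      thus False using key[of "inverse x" r q] x0 q r by auto
    qed
  qed
  with V that show ?thesis by (auto simp: val_ring_def)
qed


text \<open>An element outside \<open>V\<close> has its inverse \<open>y\<close> in
  \<open>V\<close>; multiplying a monic equation of degree \<open>n\<close> by
  \<open>y ^ (n - 1)\<close> isolates \<open>x\<close> as a polynomial in \<open>y\<close>.\<close>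

lemma algebraic_int_in_val_ring:
  fixes x :: "'a::field_char_0"
  assumes "algebraic_int x" and V: "val_ring V"
  shows "x \<in> V"
proof (rule ccontr)
  assume x: "x \<notin> V"
  define y where "y = inverse x"
  have A: "is_subring V" and y: "y \<in> V"
    using V x by (auto simp: val_ring_def y_def)
  have x0: "x \<noteq> 0" using x is_subring_0[OF A] by auto
  from assms(1) obtain p where p: "lead_coeff p = 1" "\<forall>i. poly.coeff p i \<in> \<int>" "poly p x = 0"
    by (auto elim: algebraic_int.cases)
  define n where "n = degree p"
  have n: "n > 0"
    using p by (intro Nat.gr0I) (auto simp: n_def elim!: degree_eq_zeroE)
  have "0 = x ^ n + (\<Sum>i<n. poly.coeff p i * x ^ i)"
    using p(1,3) by (simp add: poly_altdef n_def lessThan_Suc_atMost[symmetric] add.commute)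
  hence "0 = y ^ (n - 1) * (x ^ n + (\<Sum>i<n. poly.coeff p i * x ^ i))" by simp
  also have "\<dots> = y ^ (n - 1) * x ^ n + (\<Sum>i<n. poly.coeff p i * (y ^ (n - 1) * x ^ i))"
    by (simp add: sum_distrib_left algebra_simps)
  also have "y ^ (n - 1) * x ^ n = x"
    using n x0 by (cases n) (auto simp: y_def field_simps)
  also have "(\<Sum>i<n. poly.coeff p i * (y ^ (n - 1) * x ^ i)) = (\<Sum>i<n. poly.coeff p i * y ^ (n - 1 - i))"
    using x0 by (intro sum.cong) (auto simp: y_def power_diff field_simps)
  finally have "x = - (\<Sum>i<n. poly.coeff p i * y ^ (n - 1 - i))"
    by (simp add: eq_neg_iff_add_eq_0)
  also have "\<dots> \<in> V"
  proof (intro is_subring_uminus is_subring_sum is_subring_mult is_subring_power A y)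
    fix i
    obtain k where "poly.coeff p i = of_int k" using p(2) by (meson Ints_cases)
    thus "poly.coeff p i \<in> V" using is_subring_of_int[OF A] by simp
  qed
  finally show False using x by simp
qed

text \<open>For the converse, an \<open>x\<close> outside the ring generated by
  \<open>inverse x\<close> is omitted by some valuation ring, whereas membership in that ring yields
  a monic equation for \<open>x\<close>. Closure of the algebraic integers under the ring operations
  is then inherited from the valuation rings.\<close>

theorem algebraic_int_iff_val_rings:
  fixes x :: "'a::field_char_0"
  shows "algebraic_int x \<longleftrightarrow> (\<forall>V. val_ring V \<longrightarrow> x \<in> V)"
proof
  assume *: "\<forall>V. val_ring V \<longrightarrow> x \<in> V"
  show "algebraic_int x"
  proof (cases "x = 0")
    case False
    define y where "y = inverse x"
    have y: "y \<noteq> 0" "x = inverse y" using False by (auto simp: y_def)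
    define A where "A = adjoin \<int> y"
    have A: "is_subring A" "y \<in> A"
      unfolding A_def by (simp_all add: is_subring_adjoin is_subring_Ints adjoin_self)
    have "x \<in> A"
    proof (rule ccontr)
      assume "x \<notin> A"
      then obtain V where "val_ring V" "inverse y \<notin> V"
        using exists_val_ring[OF A] y by metis
      thus False using * y by auto
    qed
    then obtain q where q: "\<forall>i. poly.coeff q i \<in> \<int>" "x = poly q y"
      by (auto simp: A_def adjoin_def)
    define N where "N = degree q"
    define r where "r = Polynomial.monom 1 (Suc N) - (\<Sum>i\<le>N. Polynomial.monom (poly.coeff q i) (N - i))"
    have "x ^ Suc N = x ^ N * poly q y" using q(2) by simp
    also have "\<dots> = (\<Sum>i\<le>N. poly.coeff q i * (x ^ N * y ^ i))"
      by (simp add: poly_altdef N_def sum_distrib_left mult_ac)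
    also have "\<dots> = (\<Sum>i\<le>N. poly.coeff q i * x ^ (N - i))"
      using False by (intro sum.cong) (auto simp: y_def power_diff field_simps)
    finally have "poly r x = 0"
      by (simp add: r_def poly_sum poly_monom)
    moreover have "\<forall>i. poly.coeff r i \<in> \<int>"
      using q(1) by (auto simp: r_def coeff_sum intro!: Ints_diff Ints_sum)
    moreover have "lead_coeff r = 1"
    proof -
      have "poly.coeff r (Suc N) = 1" by (auto simp: r_def coeff_sum intro!: sum.neutral)
      moreover have "poly.coeff r i = 0" if "i > Suc N" for i
        using that by (auto simp: r_def coeff_sum intro!: sum.neutral)
      ultimately have "degree r = Suc N"
        by (intro antisym degree_le le_degree) auto
      thus ?thesis using \<open>poly.coeff r (Suc N) = 1\<close> by simp
    qed
    ultimately show ?thesis by (intro algebraic_int.intros[of r])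
  qed auto
qed (auto intro: algebraic_int_in_val_ring)

lemma
  fixes x y :: "'a::field_char_0"
  assumes "algebraic_int x" "algebraic_int y"
  shows algebraic_int_add: "algebraic_int (x + y)"
    and algebraic_int_diff: "algebraic_int (x - y)"
    and algebraic_int_mult: "algebraic_int (x * y)"
  using assms by (auto simp: algebraic_int_iff_val_rings
      intro: is_subring_add is_subring_diff is_subring_mult val_ring_subring)

lemma is_subring_algebraic_int: "is_subring {x :: 'a::field_char_0. algebraic_int x}"
  by (auto simp: is_subring_def intro: algebraic_int_diff algebraic_int_mult)

lemma algebraic_int_power: "algebraic_int (x::'a::field_char_0) \<Longrightarrow> algebraic_int (x ^ n)"
  using is_subring_power[OF is_subring_algebraic_int, of x n] by simp

lemma algebraic_int_sum:
  "(\<And>i. i \<in> I \<Longrightarrow> algebraic_int (f i :: 'a::field_char_0)) \<Longrightarrow> algebraic_int (sum f I)"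
  using is_subring_sum[OF is_subring_algebraic_int, of I f] by simp

lemma algebraic_int_prod:
  "(\<And>i. i \<in> I \<Longrightarrow> algebraic_int (f i :: 'a::field_char_0)) \<Longrightarrow> algebraic_int (prod f I)"
  using is_subring_prod[OF is_subring_algebraic_int, of I f] by simp

text \<open>The sums are the intermediate values of Horner's scheme for \<open>q\<close> at
  \<open>x\<close>. In a valuation ring containing only \<open>inverse x\<close>, the equation q(x)
  = 0 turns such a head into minus the tail divided by a power of \<open>x\<close>. They serve as
  denominators: \<open>j = 1\<close> in \<open>algebraic_scale_to_int\<close>, general
  \<open>j\<close> in \<open>W_fraction\<close>.\<close>

lemma int_poly_scaled_prefix:
  fixes x :: "'a::field_char_0"
  assumes q: "poly (map_poly of_int q) x = 0" and j: "j \<le> degree q"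
  shows "algebraic_int (\<Sum>i\<le>j. of_int (poly.coeff q (degree q - i)) * x ^ (j - i))"
  unfolding algebraic_int_iff_val_rings
proof (intro allI impI)
  fix V :: "'a set" assume V: "val_ring V"
  have A: "is_subring V" using V by (rule val_ring_subring)
  define n where "n = degree q"
  define c where "c = (\<lambda>i. of_int (poly.coeff q i) :: 'a)"
  have c: "c i \<in> V" for i using A by (auto simp: c_def is_subring_of_int)
  have "(\<Sum>i\<le>j. c (n - i) * x ^ (j - i)) \<in> V"
  proof (cases "x \<in> V")
    case True
    thus ?thesis using A c by (intro is_subring_sum is_subring_mult is_subring_power)
  next
    case False
    hence y: "inverse x \<in> V" and x0: "x \<noteq> 0"
      using V is_subring_0[OF A] by (auto simp: val_ring_def)
    have "0 = (\<Sum>i\<le>n. c i * x ^ i)"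
      using q by (simp add: poly_altdef n_def c_def degree_map_poly coeff_map_poly)
    also have "\<dots> = (\<Sum>i\<le>n. c (n - i) * x ^ (n - i))"
      by (rule sum.nat_diff_reindex[symmetric, of "\<lambda>i. c i * x ^ i" "Suc n", unfolded lessThan_Suc_atMost, simplified])
    also have "{..n} = {..j} \<union> {j<..n}" using j by (auto simp: n_def)
    also have "(\<Sum>i\<in>\<dots>. c (n - i) * x ^ (n - i)) =
        (\<Sum>i\<le>j. c (n - i) * x ^ (n - i)) + (\<Sum>i\<in>{j<..n}. c (n - i) * x ^ (n - i))"
      by (rule sum.union_disjoint) auto
    also have "(\<Sum>i\<le>j. c (n - i) * x ^ (n - i)) = x ^ (n - j) * (\<Sum>i\<le>j. c (n - i) * x ^ (j - i))"
      using j by (auto simp: sum_distrib_left mult_ac n_def simp flip: power_add intro!: sum.cong)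
    finally have "x ^ (n - j) * (\<Sum>i\<le>j. c (n - i) * x ^ (j - i)) =
        - (\<Sum>i\<in>{j<..n}. c (n - i) * x ^ (n - i))"
      by (simp add: eq_neg_iff_add_eq_0)
    hence "inverse x ^ (n - j) * (x ^ (n - j) * (\<Sum>i\<le>j. c (n - i) * x ^ (j - i))) =
        inverse x ^ (n - j) * - (\<Sum>i\<in>{j<..n}. c (n - i) * x ^ (n - i))"
      by (rule arg_cong)
    hence "(\<Sum>i\<le>j. c (n - i) * x ^ (j - i)) = inverse x ^ (n - j) * - (\<Sum>i\<in>{j<..n}. c (n - i) * x ^ (n - i))"
      using x0 by (simp add: field_simps)
    also have "\<dots> = - (\<Sum>i\<in>{j<..n}. c (n - i) * (inverse x ^ (n - j) * x ^ (n - i)))"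
      by (simp add: sum_distrib_left mult_ac)
    also have "(\<Sum>i\<in>{j<..n}. c (n - i) * (inverse x ^ (n - j) * x ^ (n - i))) =
        (\<Sum>i\<in>{j<..n}. c (n - i) * inverse x ^ (i - j))"
    proof (intro sum.cong refl)
      fix i assume i: "i \<in> {j<..n}"
      have "inverse x ^ (n - j) = inverse x ^ (i - j) * inverse x ^ (n - i)"
        using i by (simp flip: power_add)
      thus "c (n - i) * (inverse x ^ (n - j) * x ^ (n - i)) = c (n - i) * inverse x ^ (i - j)"
        using x0 by (simp add: field_simps)
    qed
    finally show ?thesis
      using A c y by (auto intro!: is_subring_uminus is_subring_sum is_subring_mult is_subring_power)
  qed
  thus "(\<Sum>i\<le>j. of_int (poly.coeff q (degree q - i)) * x ^ (j - i)) \<in> V"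
    by (simp add: c_def n_def)
qed

text \<open>The polynomial minimises the degree plus the absolute value of the leading coefficient:
  a common factor \<open>p\<close> of all coefficients or, for \<open>x \<noteq> 0\<close>, a factor
  X could be cancelled to make this smaller.\<close>

lemma algebraic_primitive:
  fixes x :: "'a::field_char_0"
  assumes "algebraic x" and p: "Factorial_Ring.prime (p::nat)"
  obtains q i where "poly (map_poly of_int q) x = 0" "\<not> int p dvd poly.coeff q i" "poly.coeff q 0 \<noteq> 0 \<or> x = 0"
proof (cases "x = 0")
  case True
  show ?thesis
    by (rule that[of "[:0, 1:]" 1]) (use True p in \<open>auto simp: map_poly_pCons\<close>)
next
  case x0: False
  from assms(1) obtain q where q: "q \<noteq> 0" "poly (map_poly of_int q) x = 0" by (auto elim: algebraicE')
  have ex: "\<exists>n. \<exists>q. q \<noteq> 0 \<and> poly (map_poly of_int q) x = 0 \<and> degree q + nat \<bar>lead_coeff q\<bar> = n"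
    using q by blast
  define n where "n = (LEAST n. \<exists>q. q \<noteq> 0 \<and> poly (map_poly of_int q) x = 0 \<and> degree q + nat \<bar>lead_coeff q\<bar> = n)"
  obtain r where r: "r \<noteq> 0" "poly (map_poly of_int r) x = 0" "degree r + nat \<bar>lead_coeff r\<bar> = n"
    using LeastI_ex[OF ex] by (auto simp: n_def)
  have min: "n \<le> degree s + nat \<bar>lead_coeff s\<bar>" if "s \<noteq> 0" "poly (map_poly of_int s) x = 0" for s
    unfolding n_def using that by (intro Least_le) auto
  have "\<exists>i. \<not> int p dvd poly.coeff r i"
  proof (rule ccontr)
    assume "\<nexists>i. \<not> int p dvd poly.coeff r i"
    hence "[:int p:] dvd r" by (simp add: const_poly_dvd_iff)
    then obtain s where s: "r = Polynomial.smult (int p) s" by (auto elim!: dvdE)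
    have p1: "p > 1" using p prime_gt_1_nat by blast
    have "map_poly of_int r = Polynomial.smult (of_nat p :: 'a) (map_poly of_int s)"
      by (rule poly_eqI) (simp add: s coeff_map_poly)
    hence "poly (map_poly of_int s) x = 0" "s \<noteq> 0" using r s p1 by auto
    from min[OF this(2,1)] r(3) s have "nat \<bar>lead_coeff r\<bar> \<le> nat \<bar>lead_coeff s\<bar>" using p1 by simp
    moreover have "\<bar>lead_coeff r\<bar> = int p * \<bar>lead_coeff s\<bar>" using s by (simp add: abs_mult)
    moreover have "\<bar>lead_coeff s\<bar> > 0" using \<open>s \<noteq> 0\<close> by simp
    ultimately show False using p1 by (simp add: nat_le_iff)
  qed
  moreover have "poly.coeff r 0 \<noteq> 0"
  proof
    assume "poly.coeff r 0 = 0"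
    then obtain s where s: "r = pCons 0 s" by (cases r) auto
    have "s \<noteq> 0" using s r by auto
    moreover have "poly (map_poly of_int s) x = 0"
      using r(2) x0 by (simp add: s map_poly_pCons)
    ultimately show False using min[of s] r(3) s by simp
  qed
  ultimately show ?thesis using that r by blast
qed

section \<open>Primitive elements and algebraicity\<close>

lemma is_subring_Rats: "is_subring (\<rat> :: 'a::field_char_0 set)"
  by (auto simp: is_subring_def)

lemma field_hom_embedding: "\<sigma> \<in> embeddings \<Longrightarrow> field_hom \<sigma>"
  by (simp add: embeddings_def)

lemma field_hom_of_rat:
  fixes \<sigma> :: "'a::field_char_0 \<Rightarrow> 'b::field_char_0"
  assumes "field_hom \<sigma>"
  shows "\<sigma> (of_rat r) = of_rat r"
proof -
  interpret field_hom \<sigma> by fact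
  obtain a b where r: "r = of_int a / of_int b"
    using quotient_of_div by (metis surj_pair)
  show ?thesis by (simp add: r of_rat_divide hom_div hom_of_int)
qed

lemma field_hom_eq_0_iff: "field_hom \<sigma> \<Longrightarrow> \<sigma> x = 0 \<longleftrightarrow> x = 0"
proof -
  assume "field_hom \<sigma>"
  then interpret field_hom \<sigma> .
  show ?thesis
    by (metis hom_mult hom_one hom_zero mult_zero_left right_inverse zero_neq_one)
qed

lemma field_hom_poly:
  assumes "field_hom \<sigma>"
  shows "\<sigma> (poly p x) = poly (map_poly \<sigma> p) (\<sigma> x)"
proof -
  interpret field_hom \<sigma> by fact
  show ?thesis by (induction p) (simp_all add: map_poly_pCons hom_add hom_mult)
qed

lemma field_hom_map_poly_mult:
  assumes "field_hom \<sigma>"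
  shows "map_poly \<sigma> (p * q) = map_poly \<sigma> p * map_poly \<sigma> q"
proof -
  interpret field_hom \<sigma> by fact
  show ?thesis
    by (rule poly_eqI) (simp add: coeff_map_poly coeff_mult hom_sum hom_mult)
qed

lemma field_hom_map_poly_add:
  assumes "field_hom \<sigma>"
  shows "map_poly \<sigma> (p + q) = map_poly \<sigma> p + map_poly \<sigma> q"
proof -
  interpret field_hom \<sigma> by fact
  show ?thesis
    by (rule poly_eqI) (simp add: coeff_map_poly hom_add)
qed

lemma field_hom_pcompose:
  assumes "field_hom \<sigma>"
  shows "poly (map_poly \<sigma> (pcompose p q)) y = poly (map_poly \<sigma> p) (poly (map_poly \<sigma> q) y)"
proof -
  interpret field_hom \<sigma> by fact
  show ?thesis
    by (induction p) (simp_all add: pcompose_pCons map_poly_pCons field_hom_map_poly_add[OF assms]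
        field_hom_map_poly_mult[OF assms])
qed

lemma field_hom_of_rat_hom: "field_hom (of_rat :: rat \<Rightarrow> 'a::field_char_0)"
  by unfold_locales (simp_all add: of_rat_add of_rat_mult)

lemma field_hom_to_ac: "field_hom (to_ac :: 'a::field \<Rightarrow> 'a alg_closure)"
  by unfold_locales simp_all

lemma field_hom_algebraic_int:
  assumes "field_hom \<sigma>" "algebraic_int x"
  shows "algebraic_int (\<sigma> x)"
proof -
  interpret field_hom \<sigma> by fact
  from assms(2) obtain p where p: "lead_coeff p = 1" "\<forall>i. poly.coeff p i \<in> \<int>" "poly p x = 0"
    by (auto elim: algebraic_int.cases)
  have "degree (map_poly \<sigma> p) = degree p"
    using field_hom_eq_0_iff[OF assms(1)] by (intro degree_map_poly) auto
  hence "lead_coeff (map_poly \<sigma> p) = 1" using p(1) by (simp add: coeff_map_poly)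
  moreover have "\<forall>i. poly.coeff (map_poly \<sigma> p) i \<in> \<int>"
  proof
    fix i
    obtain n where "poly.coeff p i = of_int n" using p(2) by (auto elim: Ints_cases)
    thus "poly.coeff (map_poly \<sigma> p) i \<in> \<int>" by (simp add: coeff_map_poly hom_of_int)
  qed
  moreover have "poly (map_poly \<sigma> p) (\<sigma> x) = 0"
    using field_hom_poly[OF assms(1), of p x] p(3) by simp
  ultimately show ?thesis by (rule algebraic_int.intros)
qed

text \<open>An integral relation c + y r(y) = 0 with c nonzero exhibits \<open>inverse y\<close> as
  a rational multiple of r(y).\<close>

lemma inverse_in_subring:
  fixes y :: "'a::field_char_0"
  assumes A: "is_subring A" "\<rat> \<subseteq> A" and y: "y \<in> A" "algebraic y"
  shows "inverse y \<in> A"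
proof (cases "y = 0")
  case False
  \<comment> \<open>Any prime would do here; what matters is the nonzero constant
    coefficient.\<close>
  from algebraic_primitive[OF y(2) two_is_prime_nat] False
  obtain q where q: "poly (map_poly of_int q) y = 0" "poly.coeff q 0 \<noteq> 0" by metis
  obtain c r where cr: "q = pCons c r" by (cases q) auto
  hence c: "c \<noteq> 0" using q by simp
  have "0 = of_int c + y * poly (map_poly of_int r) y"
    using q(1) by (simp add: cr map_poly_pCons)
  hence "y * poly (map_poly of_int r) y = - of_int c"
    by (simp add: eq_neg_iff_add_eq_0 add.commute)
  hence "- (y * poly (map_poly of_int r) y) * inverse (of_int c) = 1"
    using c by simp
  hence "y * (- poly (map_poly of_int r) y * inverse (of_int c)) = 1"
    by (simp add: mult.assoc)
  hence "inverse y = - poly (map_poly of_int r) y * inverse (of_int c)"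
    using inverse_unique by blast
  also have "\<dots> \<in> A"
  proof (intro is_subring_mult is_subring_uminus is_subring_poly)
    show "inverse (of_int c) \<in> A" using A(2) by auto
    show "poly.coeff (map_poly of_int r) i \<in> A" for i
      using is_subring_of_int[OF A(1)] by (simp add: coeff_map_poly)
  qed (use A y in auto)
  finally show ?thesis .
qed (use A is_subring_0 in auto)

lemma poly_over_div:
  assumes A: "is_subring A" and h: "\<forall>i. poly.coeff h i \<in> A" "lead_coeff h = 1"
  shows "\<forall>i. poly.coeff p i \<in> A \<Longrightarrow>
    \<exists>q r. (\<forall>i. poly.coeff r i \<in> A) \<and> p = q * h + r \<and> (r = 0 \<or> degree r < degree h)"
proof (induction "degree p" arbitrary: p rule: less_induct)
  case less
  show ?case
  proof (cases "p = 0 \<or> degree p < degree h")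
    case True
    thus ?thesis using less.prems by (intro exI[of _ 0] exI[of _ p]) auto
  next
    case False
    hence p: "p \<noteq> 0" "degree p \<ge> degree h" by auto
    define s where "s = Polynomial.monom (lead_coeff p) (degree p - degree h)"
    have h0: "h \<noteq> 0" using h(2) by auto
    have s0: "s \<noteq> 0" using p by (simp add: s_def)
    have dsh: "degree (s * h) = degree p"
      using p h0 s0 by (subst degree_mult_eq) (auto simp: s_def degree_monom_eq)
    have lsh: "lead_coeff (s * h) = lead_coeff p"
      using h(2) p by (simp add: lead_coeff_mult s_def degree_monom_eq)
    have sA: "\<forall>i. poly.coeff (p - s * h) i \<in> A"
      using A less.prems h(1)
      by (auto simp: s_def coeff_mult intro!: is_subring_diff is_subring_sum is_subring_mult is_subring_0)
    show ?thesis
    proof (cases "p - s * h = 0")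
      case True
      thus ?thesis using A by (intro exI[of _ s] exI[of _ 0]) (auto intro: is_subring_0)
    next
      case False
      have "degree (p - s * h) < degree p"
      proof (rule ccontr)
        assume *: "\<not> degree (p - s * h) < degree p"
        have "degree (p - s * h) \<le> degree p" using dsh degree_diff_le by (metis order_refl)
        hence "degree (p - s * h) = degree p" using * by simp
        moreover have "poly.coeff (p - s * h) (degree p) = 0" using lsh dsh by simp
        ultimately have "lead_coeff (p - s * h) = 0" by (simp only:)
        thus False using False by (simp only: leading_coeff_0_iff)
      qed
      from less.hyps[OF this sA] obtain q r where
        "\<forall>i. poly.coeff r i \<in> A" "p - s * h = q * h + r" "r = 0 \<or> degree r < degree h" by blast
      thus ?thesis
        by (intro exI[of _ "q + s"] exI[of _ r]) (auto simp: algebra_simps)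
    qed
  qed
qed

lemma poly_over_pcompose:
  assumes A: "is_subring A" and g: "\<forall>i. poly.coeff g i \<in> A"
  shows "\<forall>i. poly.coeff p i \<in> A \<Longrightarrow> \<forall>i. poly.coeff (pcompose p g) i \<in> A"
proof (induction p)
  case (pCons a p)
  have "a \<in> A" using pCons.prems[rule_format, of 0] by simp
  moreover have "\<forall>i. poly.coeff p i \<in> A"
  proof
    fix i show "poly.coeff p i \<in> A" using pCons.prems[rule_format, of "Suc i"] by simp
  qed
  ultimately have "poly.coeff (g * pcompose p g) i \<in> A" for i
    unfolding coeff_mult using A g pCons.IH by (intro is_subring_sum is_subring_mult) blast+
  moreover have "poly.coeff [:a:] i \<in> A" for i
    using \<open>a \<in> A\<close> A by (cases i) (auto intro: is_subring_0)
  ultimately show ?case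
    unfolding pcompose_pCons coeff_add using A by (blast intro: is_subring_add)
qed auto

lemma monic_minimal_poly:
  fixes b :: "'k::field_char_0"
  assumes K: "is_subring K" "\<rat> \<subseteq> K" "\<And>x. x \<in> K \<Longrightarrow> inverse x \<in> K" and b: "algebraic b"
  obtains h where "\<forall>i. poly.coeff h i \<in> K" "lead_coeff h = 1" "poly h b = 0"
    "\<And>p. \<lbrakk>\<forall>i. poly.coeff p i \<in> K; poly p b = 0; degree p < degree h\<rbrakk> \<Longrightarrow> p = 0"
proof -
  define M where "M = (\<lambda>h. h \<noteq> 0 \<and> (\<forall>i. poly.coeff h i \<in> K) \<and> poly h b = 0)"
  from b obtain p where "\<forall>i. poly.coeff p i \<in> \<int>" "p \<noteq> 0" "poly p b = 0" by (auto elim: algebraicE)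
  hence "M p" using K(2) Ints_subset_Rats by (force simp: M_def)
  then obtain h where h: "M h" "\<And>q. M q \<Longrightarrow> degree h \<le> degree q"
    using ex_has_least_nat[of M p degree] by blast
  show ?thesis
  proof (rule that[of "Polynomial.smult (inverse (lead_coeff h)) h"])
    show "\<forall>i. poly.coeff (Polynomial.smult (inverse (lead_coeff h)) h) i \<in> K"
      using h(1) K by (auto simp: M_def intro!: is_subring_mult)
    fix p assume "\<forall>i. poly.coeff p i \<in> K" "poly p b = 0"
      "degree p < degree (Polynomial.smult (inverse (lead_coeff h)) h)"
    thus "p = 0" using h(2)[of p] h(1) by (auto simp: M_def)
  qed (use h(1) in \<open>auto simp: M_def\<close>)
qed

text \<open>The classical choice \<open>c = a + t * b\<close>. Over the field generated by
  \<open>c\<close>, the minimal polynomial \<open>h\<close> of \<open>b\<close> divides both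
  \<open>g\<close> and f(c - t X). Avoiding finitely many \<open>t\<close> makes \<open>b\<close>
  their only common root in the algebraic closure, and in characteristic 0 this root of
  \<open>h\<close> is simple, so \<open>h\<close> is linear.\<close>

lemma primitive_element_two:
  fixes a b :: "'k::field_char_0"
  assumes alg: "\<And>x::'k. algebraic x"
  shows "\<exists>c. a \<in> adjoin \<rat> c \<and> b \<in> adjoin \<rat> c"
proof -
  from alg[of a] obtain f where f: "\<forall>i. poly.coeff f i \<in> \<int>" "f \<noteq> 0" "poly f a = 0" by (auto elim: algebraicE)
  from alg[of b] obtain g where g: "\<forall>i. poly.coeff g i \<in> \<int>" "g \<noteq> 0" "poly g b = 0" by (auto elim: algebraicE)
  let ?e = "to_ac :: 'k \<Rightarrow> 'k alg_closure"
  note hom = field_hom_to_ac[where 'a = 'k]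
  have nz: "map_poly ?e f \<noteq> 0" "map_poly ?e g \<noteq> 0"
    using f(2) g(2) by (simp_all add: map_poly_eq_0_iff)
  \<comment> \<open>A value \<open>t\<close> is bad if a + t b = a' + t b' for a root a' of
    \<open>f\<close> and a root b' of \<open>g\<close> other than b. Pairs with b' = b contribute
    the quotient 0 by the convention for division, which only excludes t = 0.\<close>
  define bad where "bad = (\<lambda>(a', b'). (a' - ?e a) / (?e b - b')) `
    ({x. poly (map_poly ?e f) x = 0} \<times> {x. poly (map_poly ?e g) x = 0})"
  have "finite bad" unfolding bad_def using nz by (intro finite_imageI finite_cartesian_product poly_roots_finite)
  moreover have "infinite (range (of_nat :: nat \<Rightarrow> 'k alg_closure))"
    by (intro range_inj_infinite) (auto simp: inj_def)
  ultimately obtain t :: nat where t: "of_nat t \<notin> bad"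
    by (meson finite_subset image_subsetI)
  define c where "c = a + of_nat t * b"
  define K where "K = adjoin \<rat> c"
  have K: "is_subring K" "\<rat> \<subseteq> K" "c \<in> K"
    unfolding K_def by (simp_all add: is_subring_adjoin is_subring_Rats adjoin_superset adjoin_self)
  have Kinv: "inverse x \<in> K" if "x \<in> K" for x
    using inverse_in_subring[OF K(1,2) that] alg by simp
  obtain h where h: "\<forall>i. poly.coeff h i \<in> K" "lead_coeff h = 1" "poly h b = 0"
    and hmin: "\<And>p. \<lbrakk>\<forall>i. poly.coeff p i \<in> K; poly p b = 0; degree p < degree h\<rbrakk> \<Longrightarrow> p = 0"
    using monic_minimal_poly[OF K(1,2) Kinv alg] by blast
  have dvd: "poly (map_poly ?e p) b' = 0"
    if p: "\<forall>i. poly.coeff p i \<in> K" "poly p b = 0" and b': "poly (map_poly ?e h) b' = 0" for p b'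
  proof -
    obtain q r where qr: "\<forall>i. poly.coeff r i \<in> K" "p = q * h + r" "r = 0 \<or> degree r < degree h"
      using poly_over_div[OF K(1) h(1,2) p(1)] by blast
    have "poly r b = 0" using qr(2) p(2) h(3) by simp
    hence "r = 0" using hmin[of r] qr by blast
    thus ?thesis using b' qr(2) by (simp add: field_hom_map_poly_mult[OF hom])
  qed
  have only: "b' = ?e b" if b': "poly (map_poly ?e h) b' = 0" for b'
  proof (rule ccontr)
    assume ne: "b' \<noteq> ?e b"
    have ZK: "\<int> \<subseteq> K" using K(2) Ints_subset_Rats by blast
    have 1: "poly (map_poly ?e g) b' = 0"
      by (rule dvd[OF _ _ b']) (use g ZK in auto)
    define f' where "f' = pcompose f [:c, - of_nat t:]"
    have "poly (map_poly ?e f') b' = 0"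
    proof (rule dvd)
      show "\<forall>i. poly.coeff f' i \<in> K" unfolding f'_def
        using K f ZK
        by (intro poly_over_pcompose)
          (auto simp: coeff_pCons split: nat.splits intro!: is_subring_uminus is_subring_of_nat is_subring_0)
      show "poly f' b = 0" using f by (simp add: f'_def poly_pcompose c_def mult.commute)
    qed (rule b')
    moreover have "poly (map_poly ?e f') b' = poly (map_poly ?e f) (?e c - of_nat t * b')"
      by (simp add: f'_def field_hom_pcompose[OF hom] map_poly_pCons mult.commute)
    ultimately have 2: "poly (map_poly ?e f) (?e c - of_nat t * b') = 0" by simp
    have "of_nat t = (?e c - of_nat t * b' - ?e a) / (?e b - b')"
      using ne by (simp add: c_def field_simps)
    hence "of_nat t \<in> bad" using 1 2 unfolding bad_def by (intro image_eqI[of _ _ "(?e c - of_nat t * b', b')"]) auto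
    thus False using t by simp
  qed
  have degh: "degree (map_poly ?e h) = degree h" by (intro degree_map_poly) auto
  have "degree h > 0"
    using h(2,3) by (intro Nat.gr0I) (auto elim!: degree_eq_zeroE)
  \<comment> \<open>With a single root, degree at least 2 would make that root a zero of
    \<open>pderiv h\<close> too, a nonzero polynomial over \<open>K\<close> of smaller
    degree.\<close>
  have "degree h = 1"
  proof (rule ccontr)
    assume "degree h \<noteq> 1"
    hence d2: "degree h \<ge> 2" using \<open>degree h > 0\<close> by simp
    have "map_poly ?e h \<noteq> 0" using degh d2 by auto
    from alg_closed_imp_factorization[OF this] obtain A where
      A: "size A = degree h" "map_poly ?e h = Polynomial.smult (lead_coeff (map_poly ?e h)) (\<Prod>x\<in>#A. [:-x, 1:])"
      using degh by auto
    have lc: "lead_coeff (map_poly ?e h) = 1" using h(2) degh by (simp add: coeff_map_poly)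
    have root: "poly (map_poly ?e h) x = 0" if "x \<in># A" for x
      using that by (subst A(2)) (auto simp: poly_prod_mset prod_mset_zero_iff)
    have "\<forall>x\<in>#A. x = ?e b" using root only by blast
    hence "A = replicate_mset (degree h) (?e b)" using A(1) by (metis set_mset_subset_singletonD singletonI subsetI)
    define L where "L = [:- ?e b, 1:]"
    have L: "poly L (?e b) = 0" by (simp add: L_def)
    have "map_poly ?e h = L ^ degree h"
      using A(2) lc \<open>A = _\<close> by (simp add: L_def)
    also obtain j where "degree h = Suc (Suc j)" using d2 by (metis add_2_eq_Suc le_Suc_ex)
    hence "L ^ degree h = L * (L * L ^ j)" by simp
    finally have "map_poly ?e h = L * (L * L ^ j)" .
    hence "poly (pderiv (map_poly ?e h)) (?e b) = 0"
      using L by (simp add: pderiv_mult)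
    moreover have "pderiv (map_poly ?e h) = map_poly ?e (pderiv h)"
      by (rule poly_eqI) (simp add: coeff_pderiv coeff_map_poly)
    ultimately have "?e (poly (pderiv h) b) = 0" using field_hom_poly[OF hom, of "pderiv h" b] by simp
    hence "poly (pderiv h) b = 0" by simp
    moreover have "\<forall>i. poly.coeff (pderiv h) i \<in> K"
      using K h(1) is_subring_of_nat[OF K(1), of "Suc _"] by (auto simp: coeff_pderiv intro!: is_subring_mult)
    moreover have "degree (pderiv h) < degree h" using d2 by (simp add: degree_pderiv)
    ultimately have "pderiv h = 0" using hmin by blast
    thus False using d2 by (simp add: pderiv_eq_0_iff)
  qed
  then obtain u v where uv: "h = [:u, v:]" by (metis degree1_coeffs One_nat_def)
  have "v = 1" using h(2) uv \<open>degree h = 1\<close> by (auto split: if_splits)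
  hence "b = - u" using h(3) uv by (simp add: eq_neg_iff_add_eq_0 add.commute)
  moreover have "u \<in> K" using h(1)[rule_format, of 0] uv by simp
  ultimately have bK: "b \<in> K" using is_subring_uminus[OF K(1)] by simp
  have "a = c - of_nat t * b" by (simp add: c_def)
  also have "\<dots> \<in> K" using K(1,3) bK by (intro is_subring_diff is_subring_mult is_subring_of_nat)
  finally show ?thesis using bK by (auto simp: K_def)
qed


lemma primitive_element_finite:
  fixes B :: "'k::field_char_0 set"
  assumes alg: "\<And>x::'k. algebraic x" and "finite B"
  shows "\<exists>c. B \<subseteq> adjoin \<rat> c"
  using assms(2)
proof (induction B rule: finite_induct)
  case (insert b B)
  then obtain c where c: "B \<subseteq> adjoin \<rat> c" by blast
  from primitive_element_two[OF alg, of c b] obtain e where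
    e: "c \<in> adjoin \<rat> e" "b \<in> adjoin \<rat> e" by blast
  have sub: "is_subring (adjoin \<rat> e)" by (simp add: is_subring_adjoin is_subring_Rats)
  have "\<rat> \<subseteq> adjoin \<rat> e" by (simp add: adjoin_superset is_subring_Rats)
  hence "adjoin \<rat> c \<subseteq> adjoin \<rat> e"
    using e(1) sub by (auto simp: adjoin_def[of _ c] intro!: is_subring_poly)
  thus ?case using c e by blast
qed auto

text \<open>After denominators are cleared, a nontrivial relation with the least sum of absolute
  values is taken; dividing it by \<open>p\<close> would give a smaller one.\<close>

lemma int_relation_of_rat_relation:
  fixes x :: "'i \<Rightarrow> 'k::field_char_0"
  assumes I: "finite I" and p: "Factorial_Ring.prime (p::nat)"
    and q: "(\<Sum>i\<in>I. of_rat (q i) * x i) = 0" "\<exists>i\<in>I. q i \<noteq> 0"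
  obtains c where "(\<Sum>i\<in>I. of_int (c i) * x i) = 0" "\<exists>i\<in>I. \<not> int p dvd c i"
proof -
  define M where "M = (\<lambda>c. (\<Sum>i\<in>I. of_int (c i) * x i) = 0 \<and> (\<exists>i\<in>I. c i \<noteq> (0::int)))"
  define D where "D = (\<Prod>i\<in>I. snd (quotient_of (q i)))"
  have D: "D \<noteq> 0" using quotient_of_denom_pos' I by (auto simp: D_def prod_zero_iff) (metis less_irrefl)
  define c where "c = (\<lambda>i. fst (quotient_of (q i)) * (\<Prod>j\<in>I - {i}. snd (quotient_of (q j))))"
  have c: "of_int (c i) = (of_int D * of_rat (q i) :: 'k)" if "i \<in> I" for i
  proof -
    have d0: "snd (quotient_of (q i)) > 0" by (rule quotient_of_denom_pos')
    have "q i = of_int (fst (quotient_of (q i))) / of_int (snd (quotient_of (q i)))"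
      by (rule quotient_of_div) simp
    hence "(of_rat (q i) :: 'k) = of_int (fst (quotient_of (q i))) / of_int (snd (quotient_of (q i)))"
      by (metis of_rat_divide of_rat_of_int_eq)
    moreover have "D = snd (quotient_of (q i)) * (\<Prod>j\<in>I - {i}. snd (quotient_of (q j)))"
      unfolding D_def using I that by (rule prod.remove)
    ultimately show ?thesis using d0 by (simp add: c_def)
  qed
  have "M c"
  proof -
    have "(\<Sum>i\<in>I. of_int (c i) * x i) = of_int D * (\<Sum>i\<in>I. of_rat (q i) * x i)"
      by (simp add: c sum_distrib_left mult_ac)
    moreover obtain i where i: "i \<in> I" "q i \<noteq> 0" using q(2) by blast
    hence "(of_int (c i) :: 'k) \<noteq> 0" using c[OF i(1)] D by simp
    hence "c i \<noteq> 0" by (metis of_int_0)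
    ultimately show ?thesis using q(1) i(1) by (auto simp: M_def)
  qed
  define s where "s = (\<lambda>b. \<Sum>i\<in>I. nat \<bar>b i :: int\<bar>)"
  obtain b where b: "M b" "\<And>b'. M b' \<Longrightarrow> s b \<le> s b'"
    using ex_has_least_nat[of M c s] \<open>M c\<close> by blast
  have "\<exists>i\<in>I. \<not> int p dvd b i"
  proof (rule ccontr)
    assume "\<not> (\<exists>i\<in>I. \<not> int p dvd b i)"
    hence "\<forall>i\<in>I. \<exists>k. b i = int p * k" by (auto simp: dvd_def)
    from bchoice[OF this] obtain b' where b': "\<And>i. i \<in> I \<Longrightarrow> b i = int p * b' i" by blast
    have p1: "p > 1" using p by (rule prime_gt_1_nat)
    have "(\<Sum>i\<in>I. of_int (b i) * x i) = of_nat p * (\<Sum>i\<in>I. of_int (b' i) * x i)"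
      by (simp add: b' sum_distrib_left mult_ac)
    hence "M b'" using b(1) p1 b' by (auto simp: M_def)
    moreover have "s b' < s b"
      unfolding s_def
    proof (rule sum_strict_mono_ex1[OF I])
      have *: "nat \<bar>b i\<bar> = p * nat \<bar>b' i\<bar>" if "i \<in> I" for i
        using b'[OF that] by (simp add: abs_mult nat_mult_distrib)
      show "\<forall>i\<in>I. nat \<bar>b' i\<bar> \<le> nat \<bar>b i\<bar>" using * p1 by simp
      obtain i where "i \<in> I" "b' i \<noteq> 0" using \<open>M b'\<close> by (auto simp: M_def)
      thus "\<exists>i\<in>I. nat \<bar>b' i\<bar> < nat \<bar>b i\<bar>" using * p1 by (intro bexI[of _ i]) auto
    qed
    ultimately show False using b(2)[of b'] by simp
  qed
  thus ?thesis using that b(1) by (auto simp: M_def)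
qed

text \<open>This is how the degree enters the later dimension counts: an integer prime to
  \<open>p\<close> is a unit in a valuation ring above \<open>p\<close>, so the relation stays
  nontrivial modulo the maximal ideal.\<close>

lemma int_relation:
  fixes x :: "'i \<Rightarrow> 'k::field_char_0"
  assumes nf: "number_field TYPE('k)" and I: "finite I" "card I > nf_degree TYPE('k)"
    and p: "Factorial_Ring.prime (p::nat)"
  obtains c where "(\<Sum>i\<in>I. of_int (c i) * x i) = 0" "\<exists>i\<in>I. \<not> int p dvd c i"
proof -
  have "\<exists>q. (\<Sum>i\<in>I. of_rat (q i) * x i) = 0 \<and> (\<exists>i\<in>I. q i \<noteq> 0)"
  proof (cases "inj_on x I")
    case True
    obtain B :: "'k set" where B: "finite B" "rat_span B = UNIV" using nf by (auto simp: number_field_def)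
    obtain b :: "'k set" where b: "rat_vs.independent b" "rat_span b = UNIV" "card b = nf_degree TYPE('k)"
      using rat_vs.basis_exists[of "UNIV :: 'k set"]
      by (metis nf_degree_def rat_dim_def rat_span_def top.extremum_uniqueI)
    have "finite b" using rat_vs.independent_span_bound[OF B(1) b(1)] B(2) by (simp add: rat_span_def)
    have "rat_vs.dependent (x ` I)"
    proof (rule ccontr)
      assume "rat_vs.independent (x ` I)"
      from rat_vs.independent_span_bound[OF \<open>finite b\<close> this] b(2)
      have "card (x ` I) \<le> card b" by (simp add: rat_span_def)
      thus False using I b(3) True by (simp add: card_image)
    qed
    then obtain u where u: "\<exists>v\<in>x ` I. u v \<noteq> 0" "(\<Sum>v\<in>x ` I. of_rat (u v) * v) = 0"
      using rat_vs.dependent_finite[of "x ` I"] I(1) by auto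
    thus ?thesis using True by (intro exI[of _ "\<lambda>i. u (x i)"]) (auto simp: sum.reindex)
  next
    case False
    then obtain i j where ij: "i \<in> I" "j \<in> I" "i \<noteq> j" "x i = x j" by (auto simp: inj_on_def)
    let ?q = "\<lambda>k. if k = i then 1 else if k = j then - 1 else (0::rat)"
    have "(\<Sum>k\<in>I. of_rat (?q k) * x k) = (\<Sum>k\<in>{i, j}. of_rat (?q k) * x k)"
      using ij I by (intro sum.mono_neutral_right) auto
    also have "\<dots> = 0" using ij by simp
    finally show ?thesis using ij by (intro exI[of _ ?q]) auto
  qed
  then obtain q where q: "(\<Sum>i\<in>I. of_rat (q i) * x i) = 0" "\<exists>i\<in>I. q i \<noteq> 0" by blast
  show ?thesis by (rule int_relation_of_rat_relation[OF I(1) p q]) (rule that)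
qed

lemma number_field_algebraic:
  fixes x :: "'k::field_char_0"
  assumes nf: "number_field TYPE('k)"
  shows "algebraic x"
proof -
  obtain c where c: "(\<Sum>i\<in>{..nf_degree TYPE('k)}. of_int (c i) * x ^ i) = 0"
    "\<exists>i\<in>{..nf_degree TYPE('k)}. \<not> int 2 dvd c i"
    by (rule int_relation[OF nf, of "{..nf_degree TYPE('k)}" 2 "\<lambda>i. x ^ i"]) auto
  define q where "q = (\<Sum>i\<in>{..nf_degree TYPE('k)}. Polynomial.monom (of_int (c i) :: 'k) i)"
  have co: "poly.coeff q i = (if i \<le> nf_degree TYPE('k) then of_int (c i) else 0)" for i
    by (simp add: q_def coeff_sum)
  show ?thesis
  proof (rule algebraicI)
    show "poly.coeff q i \<in> \<int>" for i by (simp add: co)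
    show "poly q x = 0" using c(1) by (simp add: q_def poly_sum poly_monom)
    obtain i where "i \<le> nf_degree TYPE('k)" "c i \<noteq> 0" using c(2) by force
    hence "poly.coeff q i \<noteq> 0" by (simp add: co)
    thus "q \<noteq> 0" by auto
  qed
qed

section \<open>Rational polynomials evaluated in fields of characteristic 0, and primitive elements
  of number fields\<close>

definition rpoly :: "rat poly \<Rightarrow> 'a::field_char_0 \<Rightarrow> 'a" where
  "rpoly q x = poly (map_poly of_rat q) x"

lemma
  shows rpoly_0 [simp]: "rpoly 0 x = 0"
    and rpoly_1 [simp]: "rpoly 1 x = 1"
    and rpoly_add: "rpoly (q + r) x = rpoly q x + rpoly r x"
    and rpoly_diff: "rpoly (q - r) x = rpoly q x - rpoly r x"
    and rpoly_mult: "rpoly (q * r) x = rpoly q x * rpoly r x"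
    and rpoly_X: "rpoly [:0, 1:] x = x"
    and rpoly_monom: "rpoly (Polynomial.monom c n) x = of_rat c * x ^ n"
proof -
  show add: "rpoly (q + r) x = rpoly q x + rpoly r x" for q r
    by (simp add: rpoly_def field_hom_map_poly_add[OF field_hom_of_rat_hom])
  show "rpoly (q - r) x = rpoly q x - rpoly r x"
    using add[of "q - r" r] by simp
qed (simp_all add: rpoly_def field_hom_map_poly_mult[OF field_hom_of_rat_hom] map_poly_pCons
      map_poly_monom poly_monom)

lemma rpoly_altdef: "rpoly q x = (\<Sum>i\<le>degree q. of_rat (poly.coeff q i) * x ^ i)"
  by (simp add: rpoly_def poly_altdef degree_map_poly coeff_map_poly)

lemma field_hom_rpoly:
  assumes "field_hom \<sigma>"
  shows "\<sigma> (rpoly q x) = rpoly q (\<sigma> x)"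
proof -
  interpret field_hom \<sigma> by fact
  show ?thesis by (simp add: rpoly_altdef hom_sum hom_mult hom_power field_hom_of_rat[OF assms])
qed

text \<open>\<open>algebraic\<close> asks for integer coefficients, while the closure supplies
  rational ones embedded by \<open>to_ac\<close>. That map is identified with \<open>of_rat\<close>
  before denominators are cleared.\<close>

lemma alg_closure_rat_algebraic: "algebraic (x :: rat alg_closure)"
proof -
  obtain p :: "rat poly" where p: "p \<noteq> 0" "poly (map_poly to_ac p) x = 0"
    using alg_closure_algebraic[of x] by blast
  have "(to_ac :: rat \<Rightarrow> rat alg_closure) = of_rat"
  proof
    fix r :: rat
    obtain a b where r: "r = of_int a / of_int b"
      using quotient_of_div by (metis surj_pair)
    show "(to_ac r :: rat alg_closure) = of_rat r"
      unfolding r to_ac_divide to_ac_of_int of_rat_divide of_rat_of_int_eq ..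
  qed
  hence "rpoly p x = 0" using p(2) by (simp only: rpoly_def)
  hence "(\<Sum>i\<in>{..degree p}. of_rat (poly.coeff p i) * x ^ i) = 0"
    by (simp only: rpoly_altdef)
  moreover have "\<exists>i\<in>{..degree p}. poly.coeff p i \<noteq> 0"
    using p(1) by (intro bexI[of _ "degree p"]) auto
  ultimately obtain c where c: "(\<Sum>i\<in>{..degree p}. of_int (c i) * x ^ i) = 0"
    "\<exists>i\<in>{..degree p}. \<not> int 2 dvd c i"
    by (rule int_relation_of_rat_relation[OF finite_atMost two_is_prime_nat]) auto
  define q where "q = (\<Sum>i\<in>{..degree p}. Polynomial.monom (of_int (c i) :: rat alg_closure) i)"
  have co: "poly.coeff q i = (if i \<le> degree p then of_int (c i) else 0)" for i
    by (simp add: q_def coeff_sum)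
  show ?thesis
  proof (rule algebraicI)
    show "poly.coeff q i \<in> \<int>" for i by (simp add: co)
    show "poly q x = 0" using c(1) by (simp add: q_def poly_sum poly_monom)
    obtain i where "i \<le> degree p" "c i \<noteq> 0" using c(2) by force
    hence "poly.coeff q i \<noteq> 0" by (simp add: co)
    thus "q \<noteq> 0" by auto
  qed
qed


lemma rpoly_sum: "rpoly (sum f I) x = (\<Sum>i\<in>I. rpoly (f i) x)"
  by (induction I rule: infinite_finite_induct) (auto simp: rpoly_add)

lemma number_field_primitive_element:
  assumes nf: "number_field TYPE('k::field_char_0)"
  obtains \<theta> :: "'k::field_char_0" where "\<And>x. \<exists>q. x = rpoly q \<theta>"
proof -
  obtain B :: "'k set" where B: "finite B" "rat_span B = UNIV" using nf by (auto simp: number_field_def)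
  from primitive_element_finite[OF number_field_algebraic[OF nf] B(1)]
  obtain \<theta> where \<theta>: "B \<subseteq> adjoin \<rat> \<theta>" by blast
  have sub: "is_subring (adjoin \<rat> \<theta>)" by (simp add: is_subring_adjoin is_subring_Rats)
  have rats: "\<rat> \<subseteq> adjoin \<rat> \<theta>" by (simp add: adjoin_superset is_subring_Rats)
  have "rat_vs.subspace (adjoin \<rat> \<theta>)"
    unfolding rat_vs.subspace_def
    using is_subring_0[OF sub] is_subring_add[OF sub] is_subring_mult[OF sub] rats by (blast intro: Rats_of_rat)
  from rat_vs.span_minimal[OF \<theta> this] B(2) have all: "adjoin \<rat> \<theta> = UNIV"
    by (auto simp: rat_span_def)
  show ?thesis
  proof (rule that)
    fix x
    from all obtain q where q: "\<forall>i. poly.coeff q i \<in> \<rat>" "x = poly q \<theta>" by (auto simp: adjoin_def)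
    hence "\<forall>i. \<exists>r. poly.coeff q i = of_rat r" by (auto elim: Rats_cases)
    then obtain r where r: "\<And>i. poly.coeff q i = of_rat (r i)" by metis
    have "x = rpoly (\<Sum>i\<le>degree q. Polynomial.monom (r i) i) \<theta>"
      by (simp add: q(2) poly_altdef r rpoly_sum rpoly_monom)
    thus "\<exists>q. x = rpoly q \<theta>" by blast
  qed
qed

section \<open>Embeddings as roots of a minimal polynomial\<close>

lemma number_field_minimal_poly:
  assumes nf: "number_field TYPE('k::field_char_0)"
  obtains \<theta> :: "'k::field_char_0" and f :: "rat poly"
  where "\<And>x. \<exists>q. x = rpoly q \<theta>" "lead_coeff f = 1" "degree f = nf_degree TYPE('k)"
    "\<And>q. rpoly q \<theta> = 0 \<longleftrightarrow> f dvd q"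
proof -
  obtain \<theta> :: 'k where \<theta>: "\<And>x. \<exists>q. x = rpoly q \<theta>" using number_field_primitive_element[OF nf] by blast
  define M where "M = (\<lambda>q :: rat poly. q \<noteq> 0 \<and> rpoly q \<theta> = 0)"
  from number_field_algebraic[OF nf, of \<theta>]
  obtain p where p: "p \<noteq> 0" "poly (map_poly of_int p) \<theta> = 0"
    by (rule algebraicE')
  have "rpoly (map_poly of_int p) \<theta> = poly (map_poly of_int p) \<theta>"
    unfolding rpoly_def by (rule arg_cong[where f = "\<lambda>q. poly q \<theta>"], rule poly_eqI) (simp add: coeff_map_poly)
  hence "M (map_poly of_int p)" using p by (simp add: M_def map_poly_eq_0_iff)
  then obtain g where g: "M g" "\<And>q. M q \<Longrightarrow> degree g \<le> degree q"
    using ex_has_least_nat[of M _ degree] by blast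
  define f where "f = Polynomial.smult (inverse (lead_coeff g)) g"
  have g0: "g \<noteq> 0" using g(1) by (simp add: M_def)
  have f0: "f \<noteq> 0" and lf: "lead_coeff f = 1" and df: "degree f = degree g"
    using g0 by (auto simp: f_def)
  have "f = [:inverse (lead_coeff g):] * g" by (simp add: f_def)
  hence f\<theta>: "rpoly f \<theta> = 0" using g(1) by (metis M_def mult_zero_right rpoly_mult)
  have min: "q = 0" if "rpoly q \<theta> = 0" "degree q < degree f" for q
    using g(2)[of q] that df by (auto simp: M_def)
  have iff: "rpoly q \<theta> = 0 \<longleftrightarrow> f dvd q" for q
  proof
    assume "rpoly q \<theta> = 0"
    moreover have "q mod f = q - (q div f) * f" by (simp add: minus_div_mult_eq_mod)
    ultimately have "rpoly (q mod f) \<theta> = 0" by (simp add: rpoly_diff rpoly_mult f\<theta>)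
    moreover have "q mod f = 0 \<or> degree (q mod f) < degree f" using degree_mod_less[OF f0] by blast
    ultimately have "q mod f = 0" using min by blast
    thus "f dvd q" by (simp add: mod_eq_0_iff_dvd)
  qed (auto simp: dvd_def rpoly_mult f\<theta>)
  \<comment> \<open>The powers of \<open>\<theta>\<close> below \<open>n\<close> form a rational
    basis, which identifies the degree of \<open>f\<close> with \<open>nf_degree\<close>.\<close>
  define n where "n = degree f"
  define B where "B = (\<lambda>i. \<theta> ^ i) ` {..<n}"
  have rel: "c i = 0" if c: "(\<Sum>i<n. of_rat (c i) * \<theta> ^ i) = 0" and i: "i < n" for c i
  proof -
    define q where "q = (\<Sum>i<n. Polynomial.monom (c i) i)"
    have co: "poly.coeff q i = (if i < n then c i else 0)" for i by (simp add: q_def coeff_sum)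
    have "rpoly q \<theta> = 0" using c by (simp add: q_def rpoly_sum rpoly_monom)
    moreover have "degree q < degree f"
      using i unfolding q_def n_def by (intro degree_sum_less) (auto intro: le_less_trans[OF degree_monom_le])
    ultimately have "q = 0" by (rule min)
    thus ?thesis using co[of i] i by simp
  qed
  have inj: "inj_on (\<lambda>i. \<theta> ^ i) {..<n}"
  proof (rule inj_onI, rule ccontr)
    fix i j assume ij: "i \<in> {..<n}" "j \<in> {..<n}" "\<theta> ^ i = \<theta> ^ j" "i \<noteq> j"
    let ?c = "\<lambda>k. if k = i then 1 else if k = j then - 1 else (0::rat)"
    have "(\<Sum>k<n. of_rat (?c k) * \<theta> ^ k) = (\<Sum>k\<in>{i, j}. of_rat (?c k) * \<theta> ^ k)"
      using ij by (intro sum.mono_neutral_right) auto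
    also have "\<dots> = 0" using ij by simp
    finally show False using rel[of ?c i] ij by simp
  qed
  have "rat_vs.independent B"
  proof
    assume "rat_vs.dependent B"
    then obtain u where u: "\<exists>v\<in>B. u v \<noteq> 0" "(\<Sum>v\<in>B. of_rat (u v) * v) = 0"
      using rat_vs.dependent_finite[of B] by (auto simp: B_def)
    from u(2) have "(\<Sum>i<n. of_rat (u (\<theta> ^ i)) * \<theta> ^ i) = 0"
      using inj by (simp add: B_def sum.reindex)
    thus False using rel[of "\<lambda>i. u (\<theta> ^ i)"] u(1) by (auto simp: B_def)
  qed
  moreover have "x \<in> rat_vs.span B" for x
  proof -
    obtain q where q: "x = rpoly q \<theta>" using \<theta> by blast
    have "q = q div f * f + q mod f" by simp
    hence "x = rpoly (q mod f) \<theta>" using q by (metis f\<theta> rpoly_add rpoly_mult mult_zero_right add_0)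
    also have "\<dots> = (\<Sum>i\<le>degree (q mod f). of_rat (poly.coeff (q mod f) i) * \<theta> ^ i)"
      by (rule rpoly_altdef)
    also have "\<dots> \<in> rat_vs.span B"
    proof (intro rat_vs.span_sum)
      fix i assume i: "i \<in> {..degree (q mod f)}"
      show "of_rat (poly.coeff (q mod f) i) * \<theta> ^ i \<in> rat_vs.span B"
      proof (cases "q mod f = 0")
        case True
        thus ?thesis by (simp add: rat_vs.span_zero)
      next
        case False
        hence "degree (q mod f) < n" using degree_mod_less[OF f0, of q] by (auto simp: n_def)
        hence "\<theta> ^ i \<in> B" using i by (auto simp: B_def)
        thus ?thesis by (intro rat_vs.span_scale rat_vs.span_base)
      qed
    qed
    finally show ?thesis .
  qed
  moreover have "card B = n" using inj by (simp add: B_def card_image)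
  ultimately have "rat_dim (UNIV :: 'k set) = n"
    by (intro rat_vs.dim_unique[of B]) auto
  hence "n = nf_degree TYPE('k)" by (simp only: nf_degree_def)
  with \<theta> lf iff that show ?thesis unfolding n_def by blast
qed

text \<open>Separability in characteristic 0. The gcd \<open>g\<close> of \<open>f\<close> and its
  derivative has smaller degree and so does not vanish at \<open>\<theta>\<close>; then its cofactor
  does, hence is divisible by \<open>f\<close>, and \<open>g\<close> is constant. The hypothesis on
  divisibility stands in for irreducibility.\<close>

lemma card_roots_minimal_poly:
  fixes \<theta> :: "'k::field_char_0"
  assumes f: "lead_coeff f = 1" "degree f > 0" "\<And>q. rpoly q \<theta> = 0 \<longleftrightarrow> f dvd q"
  shows "card {\<rho> :: rat alg_closure. rpoly f \<rho> = 0} = degree f"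
proof -
  have f0: "f \<noteq> 0" using f(1) by auto
  have hom: "field_hom (of_rat :: rat \<Rightarrow> rat alg_closure)" by (rule field_hom_of_rat_hom)
  define g where "g = gcd f (pderiv f)"
  have "g dvd f" by (simp add: g_def)
  then obtain h where h: "f = g * h" by (rule dvdE)
  have gh0: "g \<noteq> 0" "h \<noteq> 0" using h f0 by auto
  have pd0: "pderiv f \<noteq> 0" using f(2) by (simp add: pderiv_eq_0_iff)
  have "degree g \<le> degree (pderiv f)"
    using pd0 by (intro dvd_imp_degree_le) (auto simp: g_def)
  hence dg: "degree g < degree f" using f(2) by (simp add: degree_pderiv)
  have "\<not> f dvd g" using dg gh0(1) dvd_imp_degree_le[of f g] by auto
  hence "rpoly g \<theta> \<noteq> 0" using f(3) by blast
  moreover have "rpoly g \<theta> * rpoly h \<theta> = 0" using f(3)[of f] h by (simp add: rpoly_mult)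
  ultimately have "f dvd h" using f(3) by simp
  hence "degree f \<le> degree h" using gh0 by (intro dvd_imp_degree_le) auto
  hence "degree g = 0" using h gh0 by (simp add: degree_mult_eq)
  then obtain c where c: "g = [:c:]" by (auto elim: degree_eq_zeroE)
  have c0: "c \<noteq> 0" using c gh0 by auto
  obtain a b where ab: "a * f + b * pderiv f = g"
    unfolding g_def by (metis bezout_coefficients_fst_snd)
  have simple: "rpoly (pderiv f) \<rho> \<noteq> 0" if "rpoly f \<rho> = 0" for \<rho> :: "rat alg_closure"
  proof
    assume "rpoly (pderiv f) \<rho> = 0"
    hence "rpoly g \<rho> = 0" using that by (simp add: ab[symmetric] rpoly_add rpoly_mult)
    thus False using c c0 by (simp add: rpoly_def map_poly_pCons)
  qed
  define F where "F = (map_poly of_rat f :: rat alg_closure poly)"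
  have F: "degree F = degree f" "lead_coeff F = 1" "F \<noteq> 0"
    using f(1) f0 by (auto simp: F_def degree_map_poly coeff_map_poly map_poly_eq_0_iff)
  from alg_closed_imp_factorization[OF F(3)] F obtain A where
    A: "size A = degree f" "F = (\<Prod>x\<in>#A. [:-x, 1:])" by auto
  have root: "rpoly f \<rho> = 0 \<longleftrightarrow> \<rho> \<in># A" for \<rho>
  proof -
    have "rpoly f \<rho> = poly F \<rho>" by (simp add: rpoly_def F_def)
    also have "\<dots> = 0 \<longleftrightarrow> \<rho> \<in># A"
      by (simp add: A(2) poly_prod_mset prod_mset_zero_iff image_iff)
    finally show ?thesis .
  qed
  have "count A \<rho> \<le> 1" for \<rho>
  proof (rule ccontr)
    assume "\<not> count A \<rho> \<le> 1"
    hence "replicate_mset 2 \<rho> \<subseteq># A" by (simp add: count_le_replicate_mset_subset_eq[symmetric])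
    then obtain A' where A': "A = replicate_mset 2 \<rho> + A'" using mset_subset_eq_exists_conv by blast
    define L where "L = [:-\<rho>, 1:]"
    have L: "poly L \<rho> = 0" by (simp add: L_def)
    have "F = L * (L * (\<Prod>x\<in>#A'. [:-x, 1:]))"
      by (simp add: A(2) A' L_def numeral_2_eq_2 del: mult_pCons_left mult_pCons_right)
    hence "poly (pderiv F) \<rho> = 0" using L by (simp add: pderiv_mult)
    moreover have "pderiv F = map_poly of_rat (pderiv f)"
      by (rule poly_eqI) (simp add: F_def coeff_pderiv coeff_map_poly of_rat_mult of_rat_add)
    ultimately have "rpoly (pderiv f) \<rho> = 0" by (simp add: rpoly_def)
    moreover have "\<rho> \<in># A" by (simp add: A')
    ultimately show False using simple root by blast
  qed
  note le1 = this
  have "A = mset_set (set_mset A)"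
  proof (rule multiset_eqI)
    fix \<rho>
    show "count A \<rho> = count (mset_set (set_mset A)) \<rho>"
      using le1[of \<rho>] by (cases "\<rho> \<in># A") (auto simp: count_mset_set' not_in_iff simp flip: count_greater_zero_iff)
  qed
  hence "size A = card (set_mset A)" by (metis size_mset_set)
  moreover have "{\<rho>. rpoly f \<rho> = 0} = set_mset A" using root by auto
  ultimately show ?thesis using A(1) by simp
qed

text \<open>Evaluation at \<open>\<rho>\<close> is independent of the polynomial chosen to represent
  an element, because two such polynomials differ by a multiple of \<open>f\<close>.\<close>

lemma embedding_of_root:
  fixes \<theta> :: "'k::field_char_0" and \<rho> :: "rat alg_closure"
  assumes \<theta>: "\<And>x. \<exists>q. x = rpoly q \<theta>" and f: "\<And>q. rpoly q \<theta> = 0 \<longleftrightarrow> f dvd q"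
    and \<rho>: "rpoly f \<rho> = 0"
  obtains \<sigma> where "\<sigma> \<in> embeddings" "\<sigma> \<theta> = \<rho>"
proof -
  define r where "r = (\<lambda>x. SOME q. x = rpoly q \<theta>)"
  have r: "rpoly (r x) \<theta> = x" for x
    unfolding r_def using someI_ex[OF \<theta>[of x]] by simp
  have wd: "rpoly q \<rho> = rpoly q' \<rho>" if "rpoly q \<theta> = rpoly q' \<theta>" for q q'
  proof -
    have "f dvd q - q'" using f[of "q - q'"] that by (simp add: rpoly_diff)
    then obtain s where "q - q' = f * s" by (auto elim: dvdE)
    hence "rpoly (q - q') \<rho> = 0" using \<rho> by (simp add: rpoly_mult)
    thus ?thesis by (simp add: rpoly_diff)
  qed
  define \<sigma> where "\<sigma> = (\<lambda>x. rpoly (r x) \<rho>)"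
  have \<sigma>: "\<sigma> (rpoly q \<theta>) = rpoly q \<rho>" for q
    unfolding \<sigma>_def by (rule wd) (rule r)
  have "field_hom \<sigma>"
  proof unfold_locales
    fix x y :: 'k
    obtain q q' where x: "x = rpoly q \<theta>" and y: "y = rpoly q' \<theta>" using \<theta> by meson
    show "\<sigma> (x * y) = \<sigma> x * \<sigma> y" using \<sigma>[of "q * q'"] by (simp add: x y \<sigma> rpoly_mult)
    show "\<sigma> (x + y) = \<sigma> x + \<sigma> y" using \<sigma>[of "q + q'"] by (simp add: x y \<sigma> rpoly_add)
    show "\<sigma> 1 = 1" using \<sigma>[of 1] by simp
    show "\<sigma> 0 = 0" using \<sigma>[of 0] by simp
  qed
  moreover have "\<sigma> \<theta> = \<rho>" using \<sigma>[of "[:0, 1:]"] unfolding rpoly_X .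
  ultimately show ?thesis using that by (auto simp: embeddings_def)
qed

text \<open>The image of \<open>\<theta>\<close> identifies embeddings with roots of its minimal
  polynomial, which gives the count. Independence comes from testing a relation on powers of
  \<open>\<theta>\<close>, hence on every polynomial in these distinct roots.\<close>

lemma
  assumes nf: "number_field TYPE('k::field_char_0)" and d: "nf_degree TYPE('k) > 0"
  shows finite_embeddings: "finite (embeddings :: ('k \<Rightarrow> _) set)"
    and card_embeddings: "card (embeddings :: ('k \<Rightarrow> _) set) = nf_degree TYPE('k)"
    and embeddings_independent: "\<And>v \<sigma>. (\<And>x :: 'k. (\<Sum>\<sigma>\<in>embeddings. v \<sigma> * \<sigma> x) = 0) \<Longrightarrow> \<sigma> \<in> embeddings \<Longrightarrow> v \<sigma> = 0"
proof -
  obtain \<theta> :: 'k and f :: "rat poly" where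
    \<theta>: "\<And>x. \<exists>q. x = rpoly q \<theta>" and f: "lead_coeff f = 1" "degree f = nf_degree TYPE('k)"
    "\<And>q. rpoly q \<theta> = 0 \<longleftrightarrow> f dvd q"
    using number_field_minimal_poly[OF nf] by blast
  define R where "R = {\<rho> :: rat alg_closure. rpoly f \<rho> = 0}"
  have cR: "card R = nf_degree TYPE('k)"
    using card_roots_minimal_poly[OF f(1) _ f(3)] f(2) d by (simp add: R_def)
  have inj: "inj_on (\<lambda>\<sigma>. \<sigma> \<theta>) (embeddings :: ('k \<Rightarrow> _) set)"
  proof (rule inj_onI, rule ext)
    fix \<sigma> \<tau> :: "'k \<Rightarrow> rat alg_closure" and x
    assume *: "\<sigma> \<in> embeddings" "\<tau> \<in> embeddings" "\<sigma> \<theta> = \<tau> \<theta>"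
    obtain q where "x = rpoly q \<theta>" using \<theta> by blast
    thus "\<sigma> x = \<tau> x" using * by (simp add: field_hom_rpoly field_hom_embedding)
  qed
  have im: "(\<lambda>\<sigma>. \<sigma> \<theta>) ` (embeddings :: ('k \<Rightarrow> _) set) = R"
  proof (intro equalityI subsetI)
    fix \<rho> assume "\<rho> \<in> (\<lambda>\<sigma>. \<sigma> \<theta>) ` (embeddings :: ('k \<Rightarrow> _) set)"
    then obtain \<sigma> :: "'k \<Rightarrow> _" where \<sigma>: "\<rho> = \<sigma> \<theta>" "field_hom \<sigma>" by (auto simp: embeddings_def)
    hence "rpoly f \<rho> = \<sigma> (rpoly f \<theta>)" by (simp add: field_hom_rpoly)
    also have "\<dots> = 0" using f(3)[of f] field_hom_eq_0_iff[OF \<sigma>(2)] by simp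
    finally show "\<rho> \<in> R" by (simp add: R_def)
  next
    fix \<rho> assume "\<rho> \<in> R"
    thus "\<rho> \<in> (\<lambda>\<sigma>. \<sigma> \<theta>) ` embeddings"
      using embedding_of_root[OF \<theta> f(3), of \<rho>] unfolding R_def by blast
  qed
  have "finite R" using cR d card_ge_0_finite by metis
  thus fin: "finite (embeddings :: ('k \<Rightarrow> _) set)" using im inj finite_image_iff by metis
  show "card (embeddings :: ('k \<Rightarrow> _) set) = nf_degree TYPE('k)"
    using im inj cR card_image by metis
  fix v :: "('k \<Rightarrow> rat alg_closure) \<Rightarrow> rat alg_closure" and \<sigma>0 :: "'k \<Rightarrow> rat alg_closure"
  assume v: "\<And>x. (\<Sum>\<sigma>\<in>embeddings. v \<sigma> * \<sigma> x) = 0" and \<sigma>0: "\<sigma>0 \<in> embeddings"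
  have poly0: "(\<Sum>\<sigma>\<in>embeddings. v \<sigma> * poly g (\<sigma> \<theta>)) = 0" for g
  proof -
    have z: "(\<Sum>\<sigma>\<in>embeddings. v \<sigma> * (\<sigma> \<theta>) ^ i) = 0" for i
    proof -
      have "(\<Sum>\<sigma>\<in>embeddings. v \<sigma> * (\<sigma> \<theta>) ^ i) = (\<Sum>\<sigma>\<in>embeddings. v \<sigma> * \<sigma> (\<theta> ^ i))"
      proof (intro sum.cong refl)
        fix \<sigma> :: "'k \<Rightarrow> rat alg_closure" assume "\<sigma> \<in> embeddings"
        then interpret field_hom \<sigma> by (rule field_hom_embedding)
        show "v \<sigma> * (\<sigma> \<theta>) ^ i = v \<sigma> * \<sigma> (\<theta> ^ i)" by (simp add: hom_power)
      qed
      thus ?thesis using v by simp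
    qed
    have "(\<Sum>\<sigma>\<in>embeddings. v \<sigma> * poly g (\<sigma> \<theta>)) =
        (\<Sum>\<sigma>\<in>embeddings. \<Sum>i\<le>degree g. poly.coeff g i * (v \<sigma> * (\<sigma> \<theta>) ^ i))"
      by (simp add: poly_altdef sum_distrib_left mult_ac)
    also have "\<dots> = (\<Sum>i\<le>degree g. poly.coeff g i * (\<Sum>\<sigma>\<in>embeddings. v \<sigma> * (\<sigma> \<theta>) ^ i))"
      by (subst sum.swap) (simp add: sum_distrib_left)
    finally show ?thesis by (simp add: z)
  qed
  \<comment> \<open>A Lagrange polynomial: it vanishes at the images of \<open>\<theta>\<close>
    under all embeddings except \<open>\<sigma>0\<close> and so isolates
    \<open>v \<sigma>0\<close>.\<close>
  define g where "g = (\<Prod>\<tau>\<in>embeddings - {\<sigma>0}. [:- \<tau> \<theta>, 1:])"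
  have "0 = (\<Sum>\<sigma>\<in>embeddings. v \<sigma> * poly g (\<sigma> \<theta>))" by (simp only: poly0)
  also have "\<dots> = (\<Sum>\<sigma>\<in>{\<sigma>0}. v \<sigma> * poly g (\<sigma> \<theta>))"
    using fin \<sigma>0 by (intro sum.mono_neutral_right) (auto simp: g_def poly_prod prod_zero_iff)
  finally have "v \<sigma>0 * poly g (\<sigma>0 \<theta>) = 0" by simp
  moreover have "poly g (\<sigma>0 \<theta>) \<noteq> 0"
    using fin \<sigma>0 inj by (auto simp: g_def poly_prod prod_zero_iff inj_on_def)
  ultimately show "v \<sigma>0 = 0" by simp
qed

section \<open>The index of a lattice\<close>

definition zcomb :: "nat \<Rightarrow> (nat \<Rightarrow> 'k::field_char_0) \<Rightarrow> (nat \<Rightarrow> int) \<Rightarrow> 'k" where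
  "zcomb n w c = (\<Sum>i<n. of_int (c i) * w i)"

lemma zcomb_diff: "zcomb n w c - zcomb n w c' = zcomb n w (\<lambda>i. c i - c' i)"
  by (simp add: zcomb_def algebra_simps sum_subtractf)

lemma zcomb_mult: "of_int b * zcomb n w c = zcomb n w (\<lambda>i. b * c i)"
  by (simp add: zcomb_def sum_distrib_left mult.assoc)

lemma zcomb_Suc: "zcomb (Suc n) w c = zcomb n w c + of_int (c n) * w n"
  by (simp add: zcomb_def)

lemma zcomb_cong: "(\<And>i. i < n \<Longrightarrow> c i = c' i) \<Longrightarrow> zcomb n w c = zcomb n w c'"
  by (simp add: zcomb_def)

definition zindep :: "nat \<Rightarrow> (nat \<Rightarrow> 'k::field_char_0) \<Rightarrow> bool" where
  "zindep n w \<longleftrightarrow> (\<forall>c. zcomb n w c = 0 \<longrightarrow> (\<forall>i<n. c i = 0))"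

lemma zindep_unique:
  assumes "zindep n w" "zcomb n w c = zcomb n w c'" "i < n"
  shows "c i = c' i"
proof -
  have "zcomb n w (\<lambda>i. c i - c' i) = 0" by (simp add: zcomb_diff[symmetric] assms(2))
  hence "c i - c' i = 0" using assms(1,3) unfolding zindep_def by blast
  thus ?thesis by simp
qed

lemma zindep_mono:
  assumes "zindep n w" "k \<le> n"
  shows "zindep k w"
  unfolding zindep_def
proof (intro allI impI)
  fix c i assume c: "zcomb k w c = 0" and i: "i < k"
  have "zcomb n w (\<lambda>i. if i < k then c i else 0) = (\<Sum>i<k. of_int (c i) * w i)"
    unfolding zcomb_def using assms(2) by (intro sum.mono_neutral_cong_right) auto
  hence "zcomb n w (\<lambda>i. if i < k then c i else 0) = 0" using c by (simp add: zcomb_def)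
  from assms(1)[unfolded zindep_def, rule_format, OF this, of i] show "c i = 0"
    using i assms(2) by simp
qed

text \<open>\<open>M\<close> lies between \<open>N\<close> times the lattice spanned by
  \<open>w\<close> and that lattice itself, so it has full rank; \<open>N\<close> supplies a
  positive pivot in every position.\<close>

locale sublattice =
  fixes d :: nat and w :: "nat \<Rightarrow> 'k::field_char_0" and M :: "'k set" and N :: int
  assumes indep: "zindep d w"
    and M0: "0 \<in> M" and Mdiff: "\<And>x y. x \<in> M \<Longrightarrow> y \<in> M \<Longrightarrow> x - y \<in> M"
    and Msub: "M \<subseteq> range (zcomb d w)"
    and N: "N > 0" "\<And>c. of_int N * zcomb d w c \<in> M"
begin

lemma Mneg: "x \<in> M \<Longrightarrow> - x \<in> M"
  using Mdiff[OF M0] by fastforce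

lemma Madd: "x \<in> M \<Longrightarrow> y \<in> M \<Longrightarrow> x + y \<in> M"
  using Mdiff[OF _ Mneg] by fastforce

lemma Mmult: "x \<in> M \<Longrightarrow> of_int n * x \<in> M"
proof (induction n rule: int_induct[where k = 0])
  case (step1 i) thus ?case using Madd by (simp add: algebra_simps)
next
  case (step2 i) thus ?case using Mdiff by (simp add: algebra_simps)
qed (simp add: M0)

text \<open>The rows of a Hermite normal form of \<open>M\<close> in the basis \<open>w\<close>, with the minimal positive pivot in
  position \<open>k\<close>; the index is the product of the pivots.\<close>

definition good :: "nat \<Rightarrow> (nat \<Rightarrow> int) \<Rightarrow> bool" where
  "good k c \<longleftrightarrow> zcomb (Suc k) w c \<in> M \<and> c k > 0 \<and>
     (\<forall>b. zcomb (Suc k) w b \<in> M \<longrightarrow> c k dvd b k) \<and> (\<forall>i>k. c i = 0)"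

text \<open>The least positive value of the last coefficient divides all the others, since a nonzero
  remainder would be a smaller positive value.\<close>

lemma exists_good:
  assumes k: "k < d"
  shows "\<exists>c. good k c"
proof -
  define P where "P = (\<lambda>t :: nat. t > 0 \<and> (\<exists>c. zcomb (Suc k) w c \<in> M \<and> c k = int t))"
  have "zcomb (Suc k) w (\<lambda>i. if i = k then N else 0) = of_int N * w k"
    by (simp add: zcomb_Suc) (simp add: zcomb_def)
  also have "\<dots> = of_int N * zcomb d w (\<lambda>i. if i = k then 1 else 0)"
  proof -
    have "zcomb d w (\<lambda>i. if i = k then 1 else 0) = (\<Sum>i<d. if i = k then w i else 0)"
      unfolding zcomb_def by (intro sum.cong) auto
    thus ?thesis using k by simp
  qed
  finally have "zcomb (Suc k) w (\<lambda>i. if i = k then N else 0) \<in> M" using N(2) by simp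
  hence "P (nat N)" unfolding P_def using N(1) by (intro conjI exI[of _ "\<lambda>i. if i = k then N else 0"]) auto
  hence Pt: "P (LEAST t. P t)" by (rule LeastI)
  define t where "t = (LEAST t. P t)"
  obtain c where c: "zcomb (Suc k) w c \<in> M" "c k = int t" "t > 0" using Pt by (auto simp: P_def t_def)
  have dvd: "c k dvd b k" if b: "zcomb (Suc k) w b \<in> M" for b
  proof -
    define q where "q = b k div c k"
    have "zcomb (Suc k) w (\<lambda>i. b i - q * c i) \<in> M"
      using Mdiff[OF b Mmult[OF c(1), of q]] by (simp add: zcomb_mult zcomb_diff)
    moreover have "b k - q * c k = b k mod c k" by (simp add: q_def minus_div_mult_eq_mod)
    ultimately have "nat (b k mod c k) > 0 \<Longrightarrow> P (nat (b k mod c k))"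
      unfolding P_def by (intro conjI exI[of _ "\<lambda>i. b i - q * c i"]) auto
    moreover have "nat (b k mod c k) < t" using c by (simp add: nat_less_iff)
    hence "\<not> P (nat (b k mod c k))" unfolding t_def by (rule not_less_Least)
    ultimately have "nat (b k mod c k) = 0" by (cases "nat (b k mod c k) > 0") auto
    moreover have "b k mod c k \<ge> 0" using c by simp
    ultimately have "b k mod c k = 0" by simp
    thus ?thesis by (simp add: mod_eq_0_iff_dvd)
  qed
  \<comment> \<open>Coefficients beyond \<open>k\<close> do not affect the combination; setting them
    to 0 is what makes the chosen rows triangular.\<close>
  have eq: "zcomb (Suc k) w (\<lambda>i. if i \<le> k then c i else 0) = zcomb (Suc k) w c"
    by (rule zcomb_cong) auto
  show ?thesis
    unfolding good_def using c dvd by (intro exI[of _ "\<lambda>i. if i \<le> k then c i else 0"]) (auto simp: eq)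
qed

definition T :: "nat \<Rightarrow> nat \<Rightarrow> int" where "T k = (SOME c. good k c)"

definition mb :: "nat \<Rightarrow> 'k" where "mb k = zcomb (Suc k) w (T k)"

lemma T: assumes "k < d" shows "good k (T k)"
  unfolding T_def using someI_ex[OF exists_good[OF assms]] .

lemma mb_in: "k < d \<Longrightarrow> mb k \<in> M" and T_pos: "k < d \<Longrightarrow> T k k > 0"
  and T_dvd: "k < d \<Longrightarrow> zcomb (Suc k) w b \<in> M \<Longrightarrow> T k k dvd b k"
  and T_triangular: "k < d \<Longrightarrow> i > k \<Longrightarrow> T k i = 0"
  using T[of k] by (auto simp: good_def mb_def)

lemma mb_eq: assumes "k < d" shows "mb k = zcomb d w (T k)"
proof -
  have "zcomb d w (T k) = (\<Sum>i<Suc k. of_int (T k i) * w i)"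
    unfolding zcomb_def using assms T_triangular[OF assms] by (intro sum.mono_neutral_right) auto
  thus ?thesis by (simp add: mb_def zcomb_def)
qed

lemma M_span_aux: "k \<le> d \<Longrightarrow> zcomb k w b \<in> M \<Longrightarrow> \<exists>c. zcomb k w b = zcomb k mb c"
proof (induction k arbitrary: b)
  case (Suc k)
  hence k: "k < d" by simp
  obtain q where q: "b k = T k k * q" using T_dvd[OF k Suc.prems(2)] by (auto elim: dvdE)
  have "zcomb (Suc k) w b - of_int q * mb k = zcomb (Suc k) w (\<lambda>i. b i - q * T k i)"
    by (simp only: mb_def zcomb_mult zcomb_diff)
  also have "\<dots> = zcomb k w (\<lambda>i. b i - q * T k i)" using q by (simp add: zcomb_Suc)
  finally have eq: "zcomb (Suc k) w b - of_int q * mb k = zcomb k w (\<lambda>i. b i - q * T k i)" .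
  have "zcomb k w (\<lambda>i. b i - q * T k i) \<in> M"
    unfolding eq[symmetric] using Suc.prems mb_in[OF k] Mdiff Mmult by blast
  then obtain c where c: "zcomb k w (\<lambda>i. b i - q * T k i) = zcomb k mb c" using Suc.IH k by force
  have "zcomb (Suc k) mb (c(k := q)) = zcomb k mb c + of_int q * mb k"
    by (simp add: zcomb_Suc) (rule zcomb_cong, simp)
  also have "\<dots> = zcomb (Suc k) w b" using eq c by (simp only: diff_eq_eq)
  finally show ?case by metis
qed (simp add: zcomb_def)

lemma M_span: "M = range (zcomb d mb)"
proof
  show "M \<subseteq> range (zcomb d mb)" using Msub M_span_aux[of d] by blast
  have "zcomb k mb c \<in> M" if "k \<le> d" for k c
    using that by (induction k) (auto simp: zcomb_Suc M0 Madd Mmult mb_in zcomb_def[of 0])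
  thus "range (zcomb d mb) \<subseteq> M" by blast
qed

text \<open>Earlier rows involve only \<open>w i\<close> with \<open>i < k\<close>, so the
  coefficient of \<open>w k\<close> in a relation of length \<open>k + 1\<close> is
  \<open>c k * T k k\<close>. Its pivot is positive, and relations are peeled off from the
  top.\<close>

lemma mb_indep: "zindep d mb"
proof -
  have "k \<le> d \<Longrightarrow> zcomb k mb c = 0 \<Longrightarrow> \<forall>i<k. c i = 0" for k c
  proof (induction k)
    case (Suc k)
    hence k: "k < d" by simp
    have "\<exists>b. zcomb j mb c = zcomb k w b" if "j \<le> k" for j
      using that
    proof (induction j)
      case 0
      show ?case by (intro exI[of _ "\<lambda>_. 0"]) (simp add: zcomb_def)
    next
      case (Suc j)
      then obtain b where b: "zcomb j mb c = zcomb k w b" by auto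
      have jd: "j < d" using Suc k by simp
      have "mb j = zcomb k w (T j)"
      proof -
        have "zcomb k w (T j) = (\<Sum>i<Suc j. of_int (T j i) * w i)"
          unfolding zcomb_def using Suc T_triangular[OF jd] by (intro sum.mono_neutral_right) auto
        thus ?thesis by (simp add: mb_def zcomb_def)
      qed
      hence "zcomb (Suc j) mb c = zcomb k w b + of_int (c j) * zcomb k w (T j)" by (simp add: zcomb_Suc b)
      also have "\<dots> = zcomb k w (\<lambda>i. b i + c j * T j i)"
        by (simp add: zcomb_def sum_distrib_left algebra_simps sum.distrib)
      finally show ?case by blast
    qed
    then obtain b where b: "zcomb k mb c = zcomb k w b" by blast
    have "zcomb (Suc k) w (\<lambda>i. (if i < k then b i else 0) + c k * T k i) =
        zcomb (Suc k) w (\<lambda>i. if i < k then b i else 0) + of_int (c k) * zcomb (Suc k) w (T k)"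
      by (simp add: zcomb_def sum_distrib_left algebra_simps sum.distrib)
    also have "zcomb (Suc k) w (\<lambda>i. if i < k then b i else 0) = zcomb k w b"
      by (simp add: zcomb_Suc) (rule zcomb_cong, simp)
    also have "zcomb k w b + of_int (c k) * zcomb (Suc k) w (T k) = zcomb (Suc k) mb c"
      by (simp add: zcomb_Suc[of k mb] b mb_def)
    also have "\<dots> = zcomb (Suc k) w (\<lambda>_. 0)" using Suc.prems by (simp add: zcomb_def)
    finally have "c k * T k k = 0"
      using zindep_unique[OF zindep_mono[OF indep Suc.prems(1)], where i = k and c' = "\<lambda>_. 0"
          and c = "\<lambda>i. (if i < k then b i else 0) + c k * T k i"] by simp
    hence ck: "c k = 0" using T_pos[OF k] by simp
    hence "zcomb k mb c = 0" using Suc.prems by (simp add: zcomb_Suc)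
    thus ?case using Suc.IH Suc.prems ck by (auto simp: less_Suc_eq)
  qed simp
  thus ?thesis by (auto simp: zindep_def)
qed

lemma reduce: "k \<le> d \<Longrightarrow> \<exists>c. (\<forall>i<k. 0 \<le> c i \<and> c i < T i i) \<and> zcomb k w b - zcomb k w c \<in> M"
proof (induction k arbitrary: b)
  case (Suc k)
  hence k: "k < d" by simp
  define q where "q = b k div T k k"
  obtain c where c: "\<forall>i<k. 0 \<le> c i \<and> c i < T i i"
    "zcomb k w (\<lambda>i. b i - q * T k i) - zcomb k w c \<in> M"
    using Suc.IH[of "\<lambda>i. b i - q * T k i"] k by auto
  let ?c = "c(k := b k mod T k k)"
  have ck: "zcomb k w ?c = zcomb k w c" by (rule zcomb_cong) simp
  have "zcomb (Suc k) w b - of_int q * mb k = zcomb (Suc k) w (\<lambda>i. b i - q * T k i)"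
    by (simp only: mb_def zcomb_mult zcomb_diff)
  also have "\<dots> = zcomb k w (\<lambda>i. b i - q * T k i) + of_int (b k mod T k k) * w k"
    by (simp add: zcomb_Suc q_def minus_div_mult_eq_mod flip: of_int_mult of_int_diff)
  finally have "zcomb (Suc k) w b - zcomb (Suc k) w ?c =
      (zcomb k w (\<lambda>i. b i - q * T k i) - zcomb k w c) + of_int q * mb k"
    by (simp add: zcomb_Suc[of k w ?c] ck algebra_simps)
  also have "\<dots> \<in> M" using c(2) mb_in[OF k] Madd Mmult by blast
  finally have "zcomb (Suc k) w b - zcomb (Suc k) w ?c \<in> M" .
  moreover have "\<forall>i<Suc k. 0 \<le> ?c i \<and> ?c i < T i i"
    using c(1) T_pos[OF k] by (auto simp: less_Suc_eq)
  ultimately show ?case by blast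
qed (simp add: zcomb_def M0)

lemma reduced_unique: "k \<le> d \<Longrightarrow> (\<forall>i<k. \<bar>b i\<bar> < T i i) \<Longrightarrow> zcomb k w b \<in> M \<Longrightarrow> \<forall>i<k. b i = 0"
proof (induction k)
  case (Suc k)
  hence k: "k < d" by simp
  have "T k k dvd b k" using T_dvd[OF k Suc.prems(3)] .
  moreover have "\<bar>b k\<bar> < T k k" using Suc.prems(2) by simp
  ultimately have bk: "b k = 0" by (meson dvd_imp_le_int not_le abs_le_iff zdvd_not_zless order_less_le_trans abs_ge_self dvd_abs_iff zero_less_abs_iff)
  hence "zcomb k w b \<in> M" using Suc.prems(3) by (simp add: zcomb_Suc)
  thus ?case using Suc bk by (auto simp: less_Suc_eq)
qed simp

text \<open>The box of coordinates with 0 \<le> c i < T i i is a system of representatives: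
  \<open>reduce\<close> gives existence, and \<open>reduced_unique\<close>, applied to the
  difference of two points of the box, gives uniqueness.\<close>

lemma card_cosets:
  "card {(\<lambda>x. x + a) ` M |a. a \<in> range (zcomb d w)} = nat (\<Prod>i<d. T i i)"
proof -
  define F where "F = (\<lambda>c. (\<lambda>x. x + zcomb d w c) ` M)"
  define R where "R = Pi\<^sub>E {..<d} (\<lambda>i. {0..<T i i})"
  have Fin: "zcomb d w c - zcomb d w c' \<in> M" if eq: "F c = F c'" for c c'
  proof -
    have "zcomb d w c \<in> F c" unfolding F_def using M0 by (intro image_eqI[of _ _ 0]) auto
    hence "zcomb d w c \<in> F c'" using eq by simp
    thus ?thesis by (auto simp: F_def)
  qed
  have Feq: "F c = F c'" if "zcomb d w c - zcomb d w c' \<in> M" for c c'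
  proof -
    have "F a \<subseteq> F b" if "zcomb d w a - zcomb d w b \<in> M" for a b
    proof
      fix z assume "z \<in> F a"
      then obtain x where x: "x \<in> M" "z = x + zcomb d w a" by (auto simp: F_def)
      hence "z = (x + (zcomb d w a - zcomb d w b)) + zcomb d w b" by simp
      thus "z \<in> F b" unfolding F_def using x(1) that Madd by blast
    qed
    thus ?thesis using that Mneg[OF that] by force
  qed
  have "inj_on F R"
  proof (rule inj_onI)
    fix c c' assume cc: "c \<in> R" "c' \<in> R" "F c = F c'"
    have "zcomb d w (\<lambda>i. c i - c' i) \<in> M" using Fin[OF cc(3)] by (simp add: zcomb_diff)
    moreover have "\<forall>i<d. \<bar>c i - c' i\<bar> < T i i"
    proof (intro allI impI)
      fix i assume "i < d"
      hence "c i \<in> {0..<T i i}" "c' i \<in> {0..<T i i}" using cc(1,2) unfolding R_def by (blast intro: PiE_mem)+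
      thus "\<bar>c i - c' i\<bar> < T i i" by auto
    qed
    ultimately have z: "\<forall>i<d. c i - c' i = 0" using reduced_unique[OF order_refl, of "\<lambda>i. c i - c' i"] by blast
    show "c = c'"
    proof
      fix i
      show "c i = c' i"
        using z cc(1,2) unfolding R_def by (cases "i < d") (auto simp: PiE_def extensional_def)
    qed
  qed
  moreover have "F ` R = {(\<lambda>x. x + a) ` M |a. a \<in> range (zcomb d w)}"
  proof (intro equalityI subsetI)
    fix Z assume "Z \<in> {(\<lambda>x. x + a) ` M |a. a \<in> range (zcomb d w)}"
    then obtain b where b: "Z = F b" by (auto simp: F_def)
    from reduce[of d b] obtain c where c: "\<forall>i<d. 0 \<le> c i \<and> c i < T i i" "zcomb d w b - zcomb d w c \<in> M" by auto
    have "zcomb d w (restrict c {..<d}) = zcomb d w c" by (rule zcomb_cong) simp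
    hence "Z = F (restrict c {..<d})" unfolding b using Feq[OF c(2)] by (simp add: F_def)
    moreover have "restrict c {..<d} \<in> R" using c(1) by (auto simp: R_def)
    ultimately show "Z \<in> F ` R" by blast
  qed (auto simp: F_def)
  ultimately have "card {(\<lambda>x. x + a) ` M |a. a \<in> range (zcomb d w)} = card R"
    using card_image by metis
  also have "\<dots> = (\<Prod>i<d. nat (T i i))" by (simp add: R_def card_PiE)
  also have "\<dots> = nat (\<Prod>i<d. T i i)"
  proof -
    have "int (\<Prod>i<d. nat (T i i)) = (\<Prod>i<d. T i i)"
      unfolding of_nat_prod using T_pos by (intro prod.cong) (auto simp: less_imp_le)
    thus ?thesis by (metis nat_int)
  qed
  finally show ?thesis .
qed

end

section \<open>The embedding matrix and rationality of symmetric expressions\<close>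

text \<open>Only as many members as the degree are used, so spanning already amounts to being a
  basis; independence is recovered in \<open>rat_spanning_zindep\<close> from the embedding
  matrix.\<close>

definition rat_spanning :: "(nat \<Rightarrow> 'k::field_char_0) \<Rightarrow> bool" where
  "rat_spanning w \<longleftrightarrow> (\<forall>x. \<exists>c. x = (\<Sum>i<nf_degree TYPE('k). of_rat (c i) * w i))"

lemma field_hom_rat_comb:
  fixes w :: "nat \<Rightarrow> 'k::field_char_0" and \<sigma> :: "'k \<Rightarrow> 'b::field_char_0"
  assumes "field_hom \<sigma>"
  shows "\<sigma> (\<Sum>i<n. of_rat (c i) * w i) = (\<Sum>i<n. of_rat (c i) * \<sigma> (w i))"
proof -
  interpret field_hom \<sigma> by fact
  show ?thesis by (simp add: hom_sum hom_mult field_hom_of_rat[OF assms])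
qed

definition emb_enum :: "(nat \<Rightarrow> 'k::field_char_0 \<Rightarrow> rat alg_closure) \<Rightarrow> bool" where
  "emb_enum e \<longleftrightarrow> bij_betw e {..<nf_degree TYPE('k)} embeddings"

lemma emb_enum_hom: "emb_enum (e :: nat \<Rightarrow> 'k::field_char_0 \<Rightarrow> _) \<Longrightarrow> i < nf_degree TYPE('k) \<Longrightarrow> field_hom (e i)"
  by (auto simp: emb_enum_def bij_betw_def embeddings_def)

lemma sum_emb_enum:
  "emb_enum (e :: nat \<Rightarrow> 'k::field_char_0 \<Rightarrow> _) \<Longrightarrow>
    (\<Sum>\<sigma>\<in>embeddings. F \<sigma>) = (\<Sum>i<nf_degree TYPE('k). F (e i))"
  unfolding emb_enum_def by (rule sum.reindex_bij_betw[symmetric])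

lemma prod_emb_enum:
  "emb_enum (e :: nat \<Rightarrow> 'k::field_char_0 \<Rightarrow> _) \<Longrightarrow>
    (\<Prod>\<sigma>\<in>embeddings. F \<sigma>) = (\<Prod>i<nf_degree TYPE('k). F (e i))"
  unfolding emb_enum_def by (rule prod.reindex_bij_betw[symmetric])

locale nf =
  fixes K :: "'k::field_char_0 itself" and d :: nat
  assumes nf: "number_field TYPE('k)" and d_def: "d = nf_degree TYPE('k)" and d_pos: "d > 0"
begin

abbreviation Emb :: "('k \<Rightarrow> rat alg_closure) set" where "Emb \<equiv> embeddings"

lemma nf_degree_pos: "nf_degree TYPE('k) > 0"
  using d_pos d_def by simp

lemma fin_Emb: "finite Emb"
  by (rule finite_embeddings[OF nf nf_degree_pos])

lemma card_Emb: "card Emb = d"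
  unfolding d_def by (rule card_embeddings[OF nf nf_degree_pos])

lemma Emb_indep: "(\<And>x :: 'k. (\<Sum>\<sigma>\<in>Emb. v \<sigma> * \<sigma> x) = 0) \<Longrightarrow> \<sigma> \<in> Emb \<Longrightarrow> v \<sigma> = 0"
  by (rule embeddings_independent[OF nf nf_degree_pos])

lemma exists_emb_enum: obtains e :: "nat \<Rightarrow> 'k \<Rightarrow> rat alg_closure" where "emb_enum e"
  using ex_bij_betw_nat_finite[OF fin_Emb] card_Emb d_def
  by (auto simp: emb_enum_def lessThan_atLeast0)

definition emat :: "(nat \<Rightarrow> 'k \<Rightarrow> rat alg_closure) \<Rightarrow> (nat \<Rightarrow> 'k) \<Rightarrow> rat alg_closure mat" where
  "emat e w = mat d d (\<lambda>(i, j). e i (w j))"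

text \<open>A kernel vector of the transposed matrix is a linear relation between the embeddings on
  the members of \<open>w\<close>, hence on the whole field, against their independence.\<close>

lemma det_emat_nonzero:
  assumes e: "emb_enum e" and w: "rat_spanning w"
  shows "det (emat e w) \<noteq> 0"
proof
  have C: "emat e w \<in> carrier_mat d d" by (simp add: emat_def)
  assume "det (emat e w) = 0"
  hence "det (transpose_mat (emat e w)) = 0" using det_transpose[OF C] by simp
  then obtain v where v: "v \<in> carrier_vec d" "v \<noteq> 0\<^sub>v d" "transpose_mat (emat e w) *\<^sub>v v = 0\<^sub>v d"
    using det_0_iff_vec_prod_zero_field[of "transpose_mat (emat e w)" d] C by auto
  have z: "(\<Sum>i<d. v $ i * e i (w j)) = 0" if "j < d" for j
  proof -
    have "(transpose_mat (emat e w) *\<^sub>v v) $ j = (\<Sum>i<d. v $ i * e i (w j))"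
      using that v(1) C by (auto simp: scalar_prod_def emat_def lessThan_atLeast0 mult.commute intro!: sum.cong)
    thus ?thesis using v(3) that by simp
  qed
  define v' where "v' = (\<lambda>\<sigma>. v $ (the_inv_into {..<d} e \<sigma>))"
  have inj: "inj_on e {..<d}" using e by (auto simp: emb_enum_def bij_betw_def d_def)
  have v'e: "v' (e i) = v $ i" if "i < d" for i
    using inj that by (simp add: v'_def the_inv_into_f_f)
  have "(\<Sum>\<sigma>\<in>Emb. v' \<sigma> * \<sigma> x) = 0" for x
  proof -
    obtain c where c: "x = (\<Sum>j<d. of_rat (c j) * w j)" using w by (auto simp: rat_spanning_def d_def)
    have "(\<Sum>\<sigma>\<in>Emb. v' \<sigma> * \<sigma> x) = (\<Sum>i<d. v $ i * e i x)"
      unfolding sum_emb_enum[OF e] d_def[symmetric] by (intro sum.cong refl) (simp add: v'e)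
    also have "\<dots> = (\<Sum>i<d. \<Sum>j<d. of_rat (c j) * (v $ i * e i (w j)))"
    proof (intro sum.cong refl)
      fix i assume "i \<in> {..<d}"
      hence h: "field_hom (e i)" using emb_enum_hom[OF e] by (simp add: d_def)
      show "v $ i * e i x = (\<Sum>j<d. of_rat (c j) * (v $ i * e i (w j)))"
        unfolding c field_hom_rat_comb[OF h] by (simp add: sum_distrib_left mult_ac)
    qed
    also have "\<dots> = (\<Sum>j<d. of_rat (c j) * (\<Sum>i<d. v $ i * e i (w j)))"
      by (subst sum.swap) (simp add: sum_distrib_left)
    also have "\<dots> = 0" using z by simp
    finally show ?thesis .
  qed
  hence "v' \<sigma> = 0" if "\<sigma> \<in> Emb" for \<sigma> using Emb_indep that by blast
  hence "v $ i = 0" if "i < d" for i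
    using v'e[OF that] that e by (metis bij_betwE d_def emb_enum_def lessThan_iff)
  hence "v = 0\<^sub>v d" using v(1) by (intro eq_vecI) auto
  thus False using v(2) by simp
qed

lemma exists_basis: obtains w :: "nat \<Rightarrow> 'k" where "rat_spanning w"
proof -
  obtain \<theta> :: 'k and f :: "rat poly" where
    \<theta>: "\<And>x. \<exists>q. x = rpoly q \<theta>" and f: "lead_coeff f = 1" "degree f = nf_degree TYPE('k)"
    "\<And>q. rpoly q \<theta> = 0 \<longleftrightarrow> f dvd q"
    using number_field_minimal_poly[OF nf] by blast
  have "\<exists>c. x = (\<Sum>i<d. of_rat (c i) * \<theta> ^ i)" for x
  proof -
    obtain q where q: "x = rpoly q \<theta>" using \<theta> by blast
    have "rpoly (q div f * f + q mod f) \<theta> = rpoly (q mod f) \<theta>"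
      unfolding rpoly_add rpoly_mult using f(3)[of f] by simp
    hence "x = rpoly (q mod f) \<theta>" using q by simp
    also have "\<dots> = (\<Sum>i\<le>degree (q mod f). of_rat (poly.coeff (q mod f) i) * \<theta> ^ i)"
      by (rule rpoly_altdef)
    also have "\<dots> = (\<Sum>i<d. of_rat (poly.coeff (q mod f) i) * \<theta> ^ i)"
    proof (rule sum.mono_neutral_cong)
      have *: "q mod f = 0 \<or> degree (q mod f) < d"
        using degree_mod_less'[of f q] f d_pos d_def by fastforce
      fix i assume "i \<in> {..degree (q mod f)} - {..<d}"
      thus "of_rat (poly.coeff (q mod f) i) * \<theta> ^ i = 0" using * by (auto simp: coeff_eq_0)
    qed (auto simp: coeff_eq_0)
    finally show ?thesis by blast
  qed
  thus ?thesis using that by (auto simp: rat_spanning_def d_def)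
qed

lemma emat_inverse:
  assumes e: "emb_enum (e :: nat \<Rightarrow> 'k \<Rightarrow> _)" and w: "rat_spanning w"
  obtains W where "\<And>i j. i < d \<Longrightarrow> j < d \<Longrightarrow> (\<Sum>k<d. e i (w k) * W k j) = of_bool (i = j)"
    "\<And>i j. i < d \<Longrightarrow> j < d \<Longrightarrow> (\<Sum>k<d. W i k * e k (w j)) = of_bool (i = j)"
proof -
  let ?M = "emat e w"
  have C: "?M \<in> carrier_mat d d" by (simp add: emat_def)
  note adj = adj_mat[OF C]
  have \<delta>: "det ?M \<noteq> 0" by (rule det_emat_nonzero[OF e w])
  have M: "?M $$ (i, j) = e i (w j)" if "i < d" "j < d" for i j using that by (simp add: emat_def)
  have 1: "(\<Sum>k<d. e i (w k) * (adj_mat ?M $$ (k, j) / det ?M)) = of_bool (i = j)" if "i < d" "j < d" for i j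
  proof -
    have "(\<Sum>k<d. e i (w k) * adj_mat ?M $$ (k, j)) = (?M * adj_mat ?M) $$ (i, j)"
      using that C adj(1) M by (auto simp: scalar_prod_def lessThan_atLeast0 intro!: sum.cong)
    also have "\<dots> = det ?M * of_bool (i = j)" using that by (simp add: adj(2))
    finally show ?thesis using \<delta> by (simp add: sum_divide_distrib[symmetric])
  qed
  have 2: "(\<Sum>k<d. (adj_mat ?M $$ (i, k) / det ?M) * e k (w j)) = of_bool (i = j)" if "i < d" "j < d" for i j
  proof -
    have "(\<Sum>k<d. adj_mat ?M $$ (i, k) * e k (w j)) = (adj_mat ?M * ?M) $$ (i, j)"
      using that C adj(1) M by (auto simp: scalar_prod_def lessThan_atLeast0 intro!: sum.cong)
    also have "\<dots> = det ?M * of_bool (i = j)" using that by (simp add: adj(3))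
    finally show ?thesis using \<delta> by (simp add: sum_divide_distrib[symmetric])
  qed
  show ?thesis by (rule that[of "\<lambda>i j. adj_mat ?M $$ (i, j) / det ?M"]) (use 1 2 in auto)
qed

text \<open>Conjugation by the embedding matrix carries the diagonal matrix of the values
  \<open>e k x\<close> to the rational matrix \<open>A\<close> of multiplication by
  \<open>x\<close>; the sum is the trace of \<open>A\<close>.\<close>

lemma trace_rational: "(\<Sum>\<sigma>\<in>Emb. \<sigma> x) \<in> \<rat>"
proof -
  obtain e :: "nat \<Rightarrow> 'k \<Rightarrow> rat alg_closure" where e: "emb_enum e" by (rule exists_emb_enum)
  obtain w :: "nat \<Rightarrow> 'k" where w: "rat_spanning w" by (rule exists_basis)
  obtain W where W: "\<And>i j. i < d \<Longrightarrow> j < d \<Longrightarrow> (\<Sum>k<d. e i (w k) * W k j) = of_bool (i = j)"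
    "\<And>i j. i < d \<Longrightarrow> j < d \<Longrightarrow> (\<Sum>k<d. W i k * e k (w j)) = of_bool (i = j)"
    using emat_inverse[OF e w] by blast
  have "\<forall>j. \<exists>c. x * w j = (\<Sum>i<d. of_rat (c i) * w i)" using w by (auto simp: rat_spanning_def d_def)
  then obtain A where A: "\<And>j. x * w j = (\<Sum>i<d. of_rat (A j i) * w i)" by metis
  have eA: "e k x * e k (w j) = (\<Sum>i<d. of_rat (A j i) * e k (w i))" if "k < d" for j k
  proof -
    have h: "field_hom (e k)" using emb_enum_hom[OF e] that by (simp add: d_def)
    then interpret field_hom "e k" .
    have "e k x * e k (w j) = e k (x * w j)" by (simp add: hom_mult)
    also have "\<dots> = (\<Sum>i<d. of_rat (A j i) * e k (w i))" by (simp add: A field_hom_rat_comb[OF h])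
    finally show ?thesis .
  qed
  have "(\<Sum>\<sigma>\<in>Emb. \<sigma> x) = (\<Sum>k<d. e k x * (\<Sum>j<d. e k (w j) * W j k))"
    unfolding sum_emb_enum[OF e] d_def[symmetric] by (intro sum.cong refl) (simp add: W(1))
  also have "\<dots> = (\<Sum>k<d. \<Sum>j<d. (e k x * e k (w j)) * W j k)"
    by (simp add: sum_distrib_left mult.assoc)
  also have "\<dots> = (\<Sum>k<d. \<Sum>j<d. \<Sum>i<d. of_rat (A j i) * (W j k * e k (w i)))"
    by (intro sum.cong refl) (simp add: eA sum_distrib_left sum_distrib_right mult_ac)
  also have "\<dots> = (\<Sum>j<d. \<Sum>k<d. \<Sum>i<d. of_rat (A j i) * (W j k * e k (w i)))" by (rule sum.swap)
  also have "\<dots> = (\<Sum>j<d. \<Sum>i<d. \<Sum>k<d. of_rat (A j i) * (W j k * e k (w i)))"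
    by (rule sum.cong[OF refl], rule sum.swap)
  also have "\<dots> = (\<Sum>j<d. \<Sum>i<d. of_rat (A j i) * of_bool (j = i))"
    by (intro sum.cong refl) (simp add: W(2) flip: sum_distrib_left)
  also have "\<dots> \<in> \<rat>" by (intro is_subring_sum[OF is_subring_Rats] Rats_mult) auto
  finally show ?thesis .
qed

section \<open>Symmetric sums over orderings of the embeddings\<close>

definition Inj :: "nat \<Rightarrow> (nat \<Rightarrow> 'k \<Rightarrow> rat alg_closure) set" where
  "Inj n = {g \<in> {..<n} \<rightarrow>\<^sub>E Emb. inj_on g {..<n}}"

lemma finite_Inj: "finite (Inj n)"
  unfolding Inj_def by (rule finite_subset[OF _ finite_PiE[of "{..<n}" "\<lambda>_. Emb"]]) (auto simp: fin_Emb)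

lemma sum_Inj_Suc:
  "(\<Sum>g\<in>Inj (Suc n). F g) = (\<Sum>h\<in>Inj n. \<Sum>\<tau>\<in>Emb - h ` {..<n}. F (h(n := \<tau>)))"
proof -
  have "(\<Sum>h\<in>Inj n. \<Sum>\<tau>\<in>Emb - h ` {..<n}. F (h(n := \<tau>))) =
      (\<Sum>(h, \<tau>)\<in>Sigma (Inj n) (\<lambda>h. Emb - h ` {..<n}). F (h(n := \<tau>)))"
    by (rule sum.Sigma) (auto simp: finite_Inj fin_Emb)
  also have "\<dots> = (\<Sum>g\<in>Inj (Suc n). F g)"
  proof (rule sum.reindex_bij_witness[of _ "\<lambda>g. (restrict g {..<n}, g n)" "\<lambda>(h, \<tau>). h(n := \<tau>)"])
    fix a assume a: "a \<in> Sigma (Inj n) (\<lambda>h. Emb - h ` {..<n})"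
    obtain h \<tau> where ht: "a = (h, \<tau>)" by force
    have h: "h \<in> {..<n} \<rightarrow>\<^sub>E Emb" "inj_on h {..<n}" "\<tau> \<in> Emb" "\<tau> \<notin> h ` {..<n}"
      using a ht by (auto simp: Inj_def)
    have "restrict (h(n := \<tau>)) {..<n} = h"
      using h(1) by (intro ext) (auto simp: PiE_def extensional_def restrict_def)
    thus "(restrict (case a of (h, \<tau>) \<Rightarrow> h(n := \<tau>)) {..<n}, (case a of (h, \<tau>) \<Rightarrow> h(n := \<tau>)) n) = a"
      by (simp add: ht)
    have "h(n := \<tau>) \<in> {..<Suc n} \<rightarrow>\<^sub>E Emb"
      using h(1,3) by (auto simp: PiE_def extensional_def less_Suc_eq)
    moreover have "inj_on (h(n := \<tau>)) {..<Suc n}"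
      using h(2,4) by (auto simp: inj_on_def less_Suc_eq)
    ultimately show "(case a of (h, \<tau>) \<Rightarrow> h(n := \<tau>)) \<in> Inj (Suc n)" by (simp add: ht Inj_def)
    show "F (case a of (h, \<tau>) \<Rightarrow> h(n := \<tau>)) = (case a of (h, \<tau>) \<Rightarrow> F (h(n := \<tau>)))" by (simp add: ht)
  next
    fix g assume "g \<in> Inj (Suc n)"
    hence g: "g \<in> {..<Suc n} \<rightarrow>\<^sub>E Emb" "inj_on g {..<Suc n}" by (auto simp: Inj_def)
    show "(case (restrict g {..<n}, g n) of (h, \<tau>) \<Rightarrow> h(n := \<tau>)) = g"
      using g(1) by (intro ext) (auto simp: PiE_def extensional_def restrict_def)
    show "(restrict g {..<n}, g n) \<in> Sigma (Inj n) (\<lambda>h. Emb - h ` {..<n})"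
      using g by (fastforce simp: Inj_def inj_on_def PiE_def)
  qed
  finally show ?thesis ..
qed

text \<open>The sum of \<open>\<tau> (y n)\<close> over the embeddings not yet chosen is the trace
  minus the chosen values, and h j (y j) times h j (y n) merges into \<open>h j (y j * y n)\<close>.
  Thus n + 1 arguments reduce to n arguments and a trace, as in Newton's identities.\<close>

lemma sum_Inj_rational: "(\<Sum>g\<in>Inj n. \<Prod>i<n. g i (y i)) \<in> \<rat>"
proof (induction n arbitrary: y)
  case 0
  have "Inj 0 = {\<lambda>_. undefined}" by (auto simp: Inj_def)
  thus ?case by simp
next
  case (Suc n)
  define P where "P = (\<lambda>y. \<Sum>h\<in>Inj n. \<Prod>i<n. h i (y i))"
  have eq: "(\<Sum>\<tau>\<in>Emb - h ` {..<n}. \<Prod>i<Suc n. (h(n := \<tau>)) i (y i)) =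
      (\<Prod>i<n. h i (y i)) * (\<Sum>\<tau>\<in>Emb. \<tau> (y n)) - (\<Sum>j<n. \<Prod>i<n. h i ((y(j := y j * y n)) i))"
    if h: "h \<in> Inj n" for h
  proof -
    have sub: "h ` {..<n} \<subseteq> Emb" and inj: "inj_on h {..<n}" using h by (auto simp: Inj_def)
    have "(\<Sum>\<tau>\<in>Emb - h ` {..<n}. \<Prod>i<Suc n. (h(n := \<tau>)) i (y i)) =
        (\<Sum>\<tau>\<in>Emb - h ` {..<n}. (\<Prod>i<n. h i (y i)) * \<tau> (y n))"
      by (intro sum.cong refl) (simp add: lessThan_Suc mult.commute)
    also have "\<dots> = (\<Prod>i<n. h i (y i)) * (\<Sum>\<tau>\<in>Emb - h ` {..<n}. \<tau> (y n))"
      by (simp add: sum_distrib_left)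
    also have "(\<Sum>\<tau>\<in>Emb - h ` {..<n}. \<tau> (y n)) = (\<Sum>\<tau>\<in>Emb. \<tau> (y n)) - (\<Sum>\<tau>\<in>h ` {..<n}. \<tau> (y n))"
      using sub fin_Emb by (rule sum_diff[rotated])
    also have "(\<Sum>\<tau>\<in>h ` {..<n}. \<tau> (y n)) = (\<Sum>j<n. h j (y n))"
      using inj by (simp add: sum.reindex)
    also have "(\<Prod>i<n. h i (y i)) * ((\<Sum>\<tau>\<in>Emb. \<tau> (y n)) - (\<Sum>j<n. h j (y n))) =
        (\<Prod>i<n. h i (y i)) * (\<Sum>\<tau>\<in>Emb. \<tau> (y n)) - (\<Sum>j<n. (\<Prod>i<n. h i (y i)) * h j (y n))"
      by (simp add: right_diff_distrib sum_distrib_left)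
    also have "(\<Sum>j<n. (\<Prod>i<n. h i (y i)) * h j (y n)) = (\<Sum>j<n. \<Prod>i<n. h i ((y(j := y j * y n)) i))"
    proof (intro sum.cong refl)
      fix j assume j: "j \<in> {..<n}"
      then have "field_hom (h j)" using sub by (auto simp: embeddings_def)
      then interpret field_hom "h j" .
      have "(\<Prod>i<n. h i ((y(j := y j * y n)) i)) =
          h j (y j * y n) * (\<Prod>i\<in>{..<n} - {j}. h i ((y(j := y j * y n)) i))"
        using j by (subst prod.remove[of _ j]) auto
      also have "(\<Prod>i\<in>{..<n} - {j}. h i ((y(j := y j * y n)) i)) = (\<Prod>i\<in>{..<n} - {j}. h i (y i))"
        by (intro prod.cong) auto
      also have "h j (y j * y n) * \<dots> = (\<Prod>i<n. h i (y i)) * h j (y n)"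
        using j by (subst (2) prod.remove[of _ j]) (auto simp: hom_mult)
      finally show "(\<Prod>i<n. h i (y i)) * h j (y n) = (\<Prod>i<n. h i ((y(j := y j * y n)) i))" ..
    qed
    finally show ?thesis .
  qed
  have "(\<Sum>g\<in>Inj (Suc n). \<Prod>i<Suc n. g i (y i)) =
      (\<Sum>h\<in>Inj n. (\<Prod>i<n. h i (y i)) * (\<Sum>\<tau>\<in>Emb. \<tau> (y n)) - (\<Sum>j<n. \<Prod>i<n. h i ((y(j := y j * y n)) i)))"
    unfolding sum_Inj_Suc by (intro sum.cong refl eq)
  also have "\<dots> = P y * (\<Sum>\<tau>\<in>Emb. \<tau> (y n)) - (\<Sum>j<n. P (y(j := y j * y n)))"
    by (simp only: sum_subtractf P_def sum_distrib_right) (simp only: sum.swap[of _ "{..<n}"])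
  also have "\<dots> \<in> \<rat>"
  proof -
    have P: "P z \<in> \<rat>" for z unfolding P_def by (rule Suc.IH)
    show ?thesis by (intro Rats_diff Rats_mult[OF P trace_rational] is_subring_sum[OF is_subring_Rats] P)
  qed
  finally show ?case .
qed

text \<open>Quantifying over all \<open>z\<close> makes the property stable under multiplication by
  a value \<open>g j x\<close>: the factor is absorbed into the argument \<open>z j\<close>.\<close>

definition moments_rational :: "((nat \<Rightarrow> 'k \<Rightarrow> rat alg_closure) \<Rightarrow> rat alg_closure) \<Rightarrow> bool" where
  "moments_rational H \<longleftrightarrow> (\<forall>z. (\<Sum>g\<in>Inj d. H g * (\<Prod>i<d. g i (z i))) \<in> \<rat>)"

text \<open>This closure property stands in for being a rational polynomial expression in the values \<open>g i x\<close>, so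
  that no multivariate polynomials are needed.\<close>

definition emb_poly :: "((nat \<Rightarrow> 'k \<Rightarrow> rat alg_closure) \<Rightarrow> rat alg_closure) \<Rightarrow> bool" where
  "emb_poly F \<longleftrightarrow> (\<forall>H. moments_rational H \<longrightarrow> moments_rational (\<lambda>g. F g * H g))"

lemma emb_poly_const: "r \<in> \<rat> \<Longrightarrow> emb_poly (\<lambda>_. r)"
  unfolding emb_poly_def moments_rational_def
  by (auto simp: mult.assoc simp flip: sum_distrib_left)

lemma emb_poly_add: "emb_poly F \<Longrightarrow> emb_poly G \<Longrightarrow> emb_poly (\<lambda>g. F g + G g)"
  unfolding emb_poly_def moments_rational_def by (auto simp: algebra_simps sum.distrib)

lemma emb_poly_mult: "emb_poly F \<Longrightarrow> emb_poly G \<Longrightarrow> emb_poly (\<lambda>g. F g * G g)"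
  unfolding emb_poly_def by (simp add: mult.assoc)

lemma emb_poly_sum: "(\<And>i. i \<in> I \<Longrightarrow> emb_poly (F i)) \<Longrightarrow> emb_poly (\<lambda>g. \<Sum>i\<in>I. F i g)"
  by (induction I rule: infinite_finite_induct) (auto intro: emb_poly_const emb_poly_add)

lemma emb_poly_prod: "(\<And>i. i \<in> I \<Longrightarrow> emb_poly (F i)) \<Longrightarrow> emb_poly (\<lambda>g. \<Prod>i\<in>I. F i g)"
  by (induction I rule: infinite_finite_induct) (auto intro: emb_poly_const emb_poly_mult)

lemma emb_poly_eval:
  assumes j: "j < d"
  shows "emb_poly (\<lambda>g. g j x)"
  unfolding emb_poly_def moments_rational_def
proof (intro allI impI)
  fix H z assume H: "\<forall>z. (\<Sum>g\<in>Inj d. H g * (\<Prod>i<d. g i (z i))) \<in> \<rat>"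
  have "(\<Sum>g\<in>Inj d. g j x * H g * (\<Prod>i<d. g i (z i))) =
      (\<Sum>g\<in>Inj d. H g * (\<Prod>i<d. g i ((z(j := x * z j)) i)))"
  proof (intro sum.cong refl)
    fix g assume "g \<in> Inj d"
    hence "field_hom (g j)" using j by (auto simp: Inj_def embeddings_def)
    then interpret field_hom "g j" .
    have "(\<Prod>i<d. g i ((z(j := x * z j)) i)) =
        g j (x * z j) * (\<Prod>i\<in>{..<d} - {j}. g i ((z(j := x * z j)) i))"
      using j by (subst prod.remove[of _ j]) auto
    also have "(\<Prod>i\<in>{..<d} - {j}. g i ((z(j := x * z j)) i)) = (\<Prod>i\<in>{..<d} - {j}. g i (z i))"
      by (intro prod.cong) auto
    also have "g j (x * z j) * \<dots> = g j x * (\<Prod>i<d. g i (z i))"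
      using j by (subst (2) prod.remove[of _ j]) (auto simp: hom_mult)
    finally show "g j x * H g * (\<Prod>i<d. g i (z i)) = H g * (\<Prod>i<d. g i ((z(j := x * z j)) i))"
      by simp
  qed
  thus "(\<Sum>g\<in>Inj d. g j x * H g * (\<Prod>i<d. g i (z i))) \<in> \<rat>" using H by simp
qed

lemma emb_poly_rational_sum:
  assumes "emb_poly F"
  shows "(\<Sum>g\<in>Inj d. F g) \<in> \<rat>"
proof -
  have "moments_rational (\<lambda>_. 1)"
    unfolding moments_rational_def using sum_Inj_rational by simp
  hence "moments_rational F" using assms by (force simp: emb_poly_def)
  hence "(\<Sum>g\<in>Inj d. F g * (\<Prod>i<d. g i 1)) \<in> \<rat>" by (simp add: moments_rational_def)
  moreover have "(\<Prod>i<d. g i 1) = 1" if "g \<in> Inj d" for g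
  proof (intro prod.neutral ballI)
    fix i assume "i \<in> {..<d}"
    hence "field_hom (g i)" using that by (auto simp: Inj_def embeddings_def)
    then interpret field_hom "g i" .
    show "g i 1 = 1" by simp
  qed
  ultimately show ?thesis by simp
qed

text \<open>The rational sum over all orderings is the common value times the nonzero number of
  orderings.\<close>

lemma emb_poly_symmetric_rational:
  assumes "emb_poly F" and "\<And>g. g \<in> Inj d \<Longrightarrow> F g = N"
  shows "N \<in> \<rat>"
proof -
  obtain e :: "nat \<Rightarrow> 'k \<Rightarrow> rat alg_closure" where e: "emb_enum e" by (rule exists_emb_enum)
  have "restrict e {..<d} \<in> Inj d"
    using e by (auto simp: Inj_def emb_enum_def d_def bij_betw_def inj_on_def)
  hence "card (Inj d) > 0" using finite_Inj by (auto simp: card_gt_0_iff)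
  moreover have "(\<Sum>g\<in>Inj d. F g) = of_nat (card (Inj d)) * N" using assms(2) by simp
  hence "of_nat (card (Inj d)) * N \<in> \<rat>" using emb_poly_rational_sum[OF assms(1)] by simp
  ultimately have "(of_nat (card (Inj d)) * N) / of_nat (card (Inj d)) \<in> \<rat>" by (intro Rats_divide) auto
  thus ?thesis using \<open>card (Inj d) > 0\<close> by simp
qed

text \<open>Sets \<open>I\<close> of positions replace the sets \<open>S\<close>: for every ordering
  \<open>g\<close> the images of the \<open>I\<close> run over all m-element sets of embeddings, and
  squaring removes the sign that depends on the order, so \<open>F g\<close> is always the same
  product. By the Leibniz formula each determinant is a polynomial expression in values of
  \<open>g\<close>.\<close>

lemma det_sq_prod_rational:
  assumes "finite T" "card T = m" "m \<le> d"
  shows "(\<Prod>S | S \<subseteq> Emb \<and> card S = m. det_sq S T) \<in> \<rat>"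
proof -
  obtain xs where xs: "set xs = T" "distinct xs" using finite_distinct_list[OF assms(1)] by blast
  have len: "length xs = m" using xs assms(2) distinct_card by fastforce
  define \<I> where "\<I> = {I. I \<subseteq> {..<d} \<and> card I = m}"
  define F where "F = (\<lambda>g :: nat \<Rightarrow> 'k \<Rightarrow> rat alg_closure. \<Prod>I\<in>\<I>. (det (embedding_mat (map g (sorted_list_of_set I)) xs))\<^sup>2)"
  show ?thesis
  proof (rule emb_poly_symmetric_rational[of F])
    show "emb_poly F"
      unfolding F_def power2_eq_square
    proof (intro emb_poly_prod emb_poly_mult)
      fix I assume I: "I \<in> \<I>"
      have lI: "length (sorted_list_of_set I) = m" "set (sorted_list_of_set I) \<subseteq> {..<d}"
        using I finite_subset[of I "{..<d}"] by (auto simp: \<I>_def)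
      show "emb_poly (\<lambda>g. det (embedding_mat (map g (sorted_list_of_set I)) xs))"
      proof -
        have "det (embedding_mat (map g (sorted_list_of_set I)) xs) =
            (\<Sum>p\<in>{p. p permutes {0..<m}}. signof p * (\<Prod>i\<in>{0..<m}. g (sorted_list_of_set I ! i) (xs ! p i)))"
          for g :: "nat \<Rightarrow> 'k \<Rightarrow> rat alg_closure"
        proof -
          have "embedding_mat (map g (sorted_list_of_set I)) xs \<in> carrier_mat m m"
            using lI len by (simp add: embedding_mat_def)
          hence "det (embedding_mat (map g (sorted_list_of_set I)) xs) =
              (\<Sum>p\<in>{p. p permutes {0..<m}}. signof p *
                (\<Prod>i\<in>{0..<m}. embedding_mat (map g (sorted_list_of_set I)) xs $$ (i, p i)))"
            by (rule det_def')
          also have "\<dots> = (\<Sum>p\<in>{p. p permutes {0..<m}}. signof p *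
                (\<Prod>i\<in>{0..<m}. g (sorted_list_of_set I ! i) (xs ! p i)))"
          proof (intro sum.cong refl arg_cong2[where f = times] prod.cong)
            fix p i assume "p \<in> {p. p permutes {0..<m}}" and i: "i \<in> {0..<m}"
            hence "p i < m" using permutes_in_image[of p "{0..<m}" i] by simp
            thus "embedding_mat (map g (sorted_list_of_set I)) xs $$ (i, p i) =
                g (sorted_list_of_set I ! i) (xs ! p i)"
              using lI len i by (simp add: embedding_mat_def)
          qed
          finally show ?thesis .
        qed
        moreover have "sorted_list_of_set I ! i < d" if "i < m" for i
          using lI that nth_mem[of i "sorted_list_of_set I"] by (metis lessThan_iff subsetD)
        moreover have "signof p \<in> (\<rat> :: rat alg_closure set)" for p :: "nat \<Rightarrow> nat"
          by (simp add: sign_def)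
        ultimately show ?thesis
          by (simp only:) (intro emb_poly_sum emb_poly_mult emb_poly_prod emb_poly_const emb_poly_eval, auto)
      qed
      thus "emb_poly (\<lambda>g. det (embedding_mat (map g (sorted_list_of_set I)) xs))" .
    qed
  next
    fix g assume g: "g \<in> Inj d"
    hence inj: "inj_on g {..<d}" and gE: "g ` {..<d} \<subseteq> Emb" by (auto simp: Inj_def)
    hence im: "g ` {..<d} = Emb"
      using card_Emb fin_Emb by (intro card_subset_eq) (auto simp: card_image)
    have bij: "bij_betw (\<lambda>I. g ` I) \<I> {S. S \<subseteq> Emb \<and> card S = m}"
    proof (rule bij_betw_imageI)
      show "inj_on ((`) g) \<I>"
        using inj unfolding \<I>_def by (intro inj_onI) (auto simp: inj_on_image_eq_iff)
      show "(`) g ` \<I> = {S. S \<subseteq> Emb \<and> card S = m}"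
      proof (intro equalityI subsetI)
        fix S assume "S \<in> {S. S \<subseteq> Emb \<and> card S = m}"
        hence S: "S \<subseteq> g ` {..<d}" "card S = m" using im by auto
        then obtain I where "I \<subseteq> {..<d}" "S = g ` I" by (meson subset_imageE)
        thus "S \<in> (`) g ` \<I>" using S(2) inj by (auto simp: \<I>_def card_image inj_on_subset)
      qed (use gE inj in \<open>auto simp: \<I>_def card_image inj_on_subset\<close>)
    qed
    have "F g = (\<Prod>I\<in>\<I>. det_sq (g ` I) T)"
      unfolding F_def
    proof (intro prod.cong refl)
      fix I assume I: "I \<in> \<I>"
      hence fI: "finite I" "I \<subseteq> {..<d}" "card I = m" using finite_subset by (auto simp: \<I>_def)
      have "det_sq (set (map g (sorted_list_of_set I))) (set xs) =
          (det (embedding_mat (map g (sorted_list_of_set I)) xs))\<^sup>2"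
        using fI xs len inj by (intro det_sq_set) (auto simp: distinct_map inj_on_subset)
      thus "(det (embedding_mat (map g (sorted_list_of_set I)) xs))\<^sup>2 = det_sq (g ` I) T"
        using fI xs by simp
    qed
    also have "\<dots> = (\<Prod>S | S \<subseteq> Emb \<and> card S = m. det_sq S T)"
      using bij by (rule prod.reindex_bij_betw)
    finally show "F g = (\<Prod>S | S \<subseteq> Emb \<and> card S = m. det_sq S T)" .
  qed
qed

end

section \<open>Integral bases and the norm of an ideal\<close>

text \<open>In a monic integral relation of least degree the constant term is nonzero, since a
  factor X could be cancelled otherwise. This term is a multiple of \<open>\<delta>\<close>, and
  \<open>D\<close> is its absolute value.\<close>

lemma algebraic_int_dvd_int:
  fixes \<delta> :: "'a::field_char_0"
  assumes "algebraic_int \<delta>" "\<delta> \<noteq> 0"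
  obtains \<delta>' D where "algebraic_int \<delta>'" "D > 0" "\<delta> * \<delta>' = of_int D"
proof -
  define M where "M = (\<lambda>p :: int poly. poly (map_poly of_int p) \<delta> = 0 \<and> lead_coeff p = 1)"
  obtain p0 where "M p0" using assms(1) by (auto simp: algebraic_int_altdef_ipoly M_def)
  then obtain p where p: "M p" "\<And>q. M q \<Longrightarrow> degree p \<le> degree q"
    using ex_has_least_nat[of M p0 degree] by blast
  obtain c q where cq: "p = pCons c q" by (cases p) auto
  have q0: "q \<noteq> 0"
  proof
    assume "q = 0"
    hence "p = 1" using p(1) cq by (auto simp: M_def one_pCons)
    thus False using p(1) by (simp add: M_def)
  qed
  have c0: "c \<noteq> 0"
  proof
    assume "c = 0"
    hence "M q" using p(1) cq q0 assms(2) by (auto simp: M_def map_poly_pCons)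
    thus False using p(2)[of q] cq q0 by simp
  qed
  define \<epsilon> where "\<epsilon> = poly (map_poly of_int q) \<delta>"
  have \<epsilon>: "algebraic_int \<epsilon>"
    using is_subring_poly[OF is_subring_algebraic_int, of \<delta> "map_poly of_int q"] assms(1)
    by (simp add: \<epsilon>_def coeff_map_poly)
  have "of_int c + \<delta> * \<epsilon> = 0" using p(1) by (simp add: M_def cq map_poly_pCons \<epsilon>_def)
  hence eq: "\<delta> * \<epsilon> = of_int (- c)" by (simp add: eq_neg_iff_add_eq_0 add.commute)
  show ?thesis
  proof (cases "c > 0")
    case True
    show ?thesis by (rule that[of "- \<epsilon>" c]) (use True eq \<epsilon> in auto)
  next
    case False
    show ?thesis by (rule that[of \<epsilon> "- c"]) (use False c0 eq \<epsilon> in auto)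
  qed
qed

lemma algebraic_scale_to_int:
  fixes x :: "'a::field_char_0"
  assumes "algebraic x"
  obtains D where "D > 0" "algebraic_int (of_int D * x)"
proof -
  from assms obtain q where q: "q \<noteq> 0" "poly (map_poly of_int q) x = 0" by (rule algebraicE')
  have n: "degree q \<ge> 1"
  proof (rule ccontr)
    assume "\<not> degree q \<ge> 1"
    then obtain c where "q = [:c:]" by (metis One_nat_def degree_eq_zeroE less_one not_le)
    thus False using q by (simp add: map_poly_pCons)
  qed
  \<comment> \<open>The prefix for j = 1 is the leading coefficient times \<open>x\<close> plus the
    next coefficient, an integer that can be subtracted.\<close>
  have "algebraic_int (\<Sum>i\<le>1. of_int (poly.coeff q (degree q - i)) * x ^ (1 - i))"
    by (rule int_poly_scaled_prefix[OF q(2) n])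
  hence "algebraic_int (of_int (lead_coeff q) * x + of_int (poly.coeff q (degree q - 1)))"
    by (simp add: atMost_Suc add.commute)
  hence "algebraic_int (of_int (lead_coeff q) * x + of_int (poly.coeff q (degree q - 1)) - of_int (poly.coeff q (degree q - 1)))"
    by (rule algebraic_int_diff) simp
  hence *: "algebraic_int (of_int (lead_coeff q) * x)" by simp
  show ?thesis
  proof (cases "lead_coeff q > 0")
    case True
    thus ?thesis using * that by blast
  next
    case False
    hence "- lead_coeff q > 0" using q(1) by (metis leading_coeff_0_iff neg_0_less_iff_less not_less_iff_gr_or_eq)
    thus ?thesis using that[of "- lead_coeff q"] * by simp
  qed
qed

lemma algebraic_int_det:
  fixes A :: "'a::field_char_0 mat"
  assumes A: "A \<in> carrier_mat n n" and "\<And>i j. i < n \<Longrightarrow> j < n \<Longrightarrow> algebraic_int (A $$ (i, j))"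
  shows "algebraic_int (det A)"
proof -
  have "algebraic_int (signof p * (\<Prod>i = 0..<n. A $$ (i, p i)))" if "p permutes {0..<n}" for p
    using that assms(2) permutes_in_image[OF that]
    by (intro algebraic_int_mult algebraic_int_prod) (auto simp: sign_def)
  thus ?thesis unfolding det_def'[OF A] by (intro algebraic_int_sum) auto
qed

context nf
begin

lemma rat_spanning_scale:
  assumes w: "rat_spanning (w :: nat \<Rightarrow> 'k)" and D: "\<And>i. D i \<noteq> (0 :: rat)"
  shows "rat_spanning (\<lambda>i. of_rat (D i) * w i)"
  unfolding rat_spanning_def
proof
  fix x :: 'k
  obtain c where c: "x = (\<Sum>i<nf_degree TYPE('k). of_rat (c i) * w i)" using w by (auto simp: rat_spanning_def)
  have "of_rat (c i) * w i = of_rat (c i / D i) * (of_rat (D i) * w i)" for i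
  proof -
    have "c i = c i / D i * D i" using D by simp
    thus ?thesis by (metis mult.assoc of_rat_mult)
  qed
  hence "x = (\<Sum>i<nf_degree TYPE('k). of_rat (c i / D i) * (of_rat (D i) * w i))"
    unfolding c by (intro sum.cong refl)
  thus "\<exists>c. x = (\<Sum>i<nf_degree TYPE('k). of_rat (c i) * (of_rat (D i) * w i))"
    by (rule exI[of _ "\<lambda>i. c i / D i"])
qed

lemma field_hom_zcomb:
  assumes "field_hom \<sigma>"
  shows "\<sigma> (zcomb n w c) = (\<Sum>i<n. of_int (c i) * \<sigma> (w i))"
proof -
  interpret field_hom \<sigma> by fact
  show ?thesis by (simp add: zcomb_def hom_sum hom_mult hom_of_int)
qed

lemma rat_spanning_zindep:
  assumes w: "rat_spanning (w :: nat \<Rightarrow> 'k)"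
  shows "zindep d w"
  unfolding zindep_def
proof (intro allI impI)
  fix c j assume c: "zcomb d w c = 0" and j: "j < d"
  obtain e :: "nat \<Rightarrow> 'k \<Rightarrow> rat alg_closure" where e: "emb_enum e" by (rule exists_emb_enum)
  obtain W where W: "\<And>i j. i < d \<Longrightarrow> j < d \<Longrightarrow> (\<Sum>k<d. W i k * e k (w j)) = of_bool (i = j)"
    using emat_inverse[OF e w] by metis
  have z: "(\<Sum>i<d. of_int (c i) * e k (w i)) = 0" if "k < d" for k
  proof -
    have "field_hom (e k)" using emb_enum_hom[OF e] that by (simp add: d_def)
    then interpret field_hom "e k" .
    show ?thesis using field_hom_zcomb[OF \<open>field_hom (e k)\<close>, of d w c] c by simp
  qed
  have "of_int (c j) = (\<Sum>i<d. of_int (c i) * (\<Sum>k<d. W j k * e k (w i)))"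
    using j by (simp add: W)
  also have "\<dots> = (\<Sum>i<d. \<Sum>k<d. W j k * (of_int (c i) * e k (w i)))"
    by (simp add: sum_distrib_left mult_ac)
  also have "\<dots> = (\<Sum>k<d. W j k * (\<Sum>i<d. of_int (c i) * e k (w i)))"
    by (subst sum.swap) (simp add: sum_distrib_left)
  also have "\<dots> = 0" by (simp add: z)
  finally show "c j = 0" by simp
qed

text \<open>Cramer's rule bounds the denominators. With respect to a field basis \<open>u\<close> of
  algebraic integers, the coordinates of an algebraic integer times \<open>det ?M\<close> are
  algebraic integers; the factor \<open>\<delta>'\<close> replaces the determinant by a rational
  integer \<open>N\<close>, and rational algebraic integers are integers. So the ring of integers
  lies between the lattices spanned by \<open>u\<close> and by \<open>v\<close>, the members of
  \<open>u\<close> divided by \<open>N\<close>, and the Hermite rows form its basis.\<close>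

lemma exists_integral_basis:
  obtains w :: "nat \<Rightarrow> 'k" where "zindep d w" "{x. algebraic_int x} = range (zcomb d w)"
proof -
  obtain w0 :: "nat \<Rightarrow> 'k" where w0: "rat_spanning w0" by (rule exists_basis)
  have "\<forall>i. \<exists>D > 0. algebraic_int (of_int D * w0 i)"
    using algebraic_scale_to_int[OF number_field_algebraic[OF nf]] by metis
  then obtain D where D: "\<And>i. D i > 0" "\<And>i. algebraic_int (of_int (D i) * w0 i)" by metis
  define u where "u = (\<lambda>i. of_int (D i) * w0 i)"
  have u: "rat_spanning u"
    using rat_spanning_scale[OF w0, of "\<lambda>i. of_int (D i)"] D(1) by (simp add: u_def less_imp_neq[THEN not_sym])
  have ui: "algebraic_int (u i)" for i by (simp add: u_def D(2))
  obtain e :: "nat \<Rightarrow> 'k \<Rightarrow> rat alg_closure" where e: "emb_enum e" by (rule exists_emb_enum)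
  have hom: "field_hom (e k)" if "k < d" for k using emb_enum_hom[OF e] that by (simp add: d_def)
  let ?M = "emat e u"
  have C: "?M \<in> carrier_mat d d" by (simp add: emat_def)
  have Mi: "algebraic_int (?M $$ (i, j))" if "i < d" "j < d" for i j
    using that by (simp add: emat_def field_hom_algebraic_int[OF hom ui])
  have \<delta>: "algebraic_int (det ?M)" "det ?M \<noteq> 0"
    using algebraic_int_det[OF C Mi] det_emat_nonzero[OF e u] by auto
  have adji: "algebraic_int (adj_mat ?M $$ (i, j))" if "i < d" "j < d" for i j
  proof -
    have "algebraic_int (det (mat_delete ?M j i))"
    proof (rule algebraic_int_det[of _ "d - 1"])
      show "mat_delete ?M j i \<in> carrier_mat (d - 1) (d - 1)" using C by (simp add: mat_delete_def)
      fix a b assume ab: "a < d - 1" "b < d - 1"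
      show "algebraic_int (mat_delete ?M j i $$ (a, b))"
        using ab C that by (auto simp: mat_delete_def intro!: Mi)
    qed
    thus ?thesis using that C
      by (simp add: adj_mat_def cofactor_def) (intro algebraic_int_mult algebraic_int_power, auto)
  qed
  obtain \<delta>' N where N: "algebraic_int \<delta>'" "N > 0" "det ?M * \<delta>' = of_int N"
    using algebraic_int_dvd_int[OF \<delta>] by blast
  define v where "v = (\<lambda>i. of_rat (1 / of_int N) * u i)"
  have v: "rat_spanning v" unfolding v_def using rat_spanning_scale[OF u, of "\<lambda>_. 1 / of_int N"] N(2) by simp
  have vu: "of_int N * v i = u i" for i
    using N(2) by (simp add: v_def of_rat_divide)
  have sub: "{x. algebraic_int x} \<subseteq> range (zcomb d v)"
  proof
    fix x :: 'k assume "x \<in> {x. algebraic_int x}"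
    hence x: "algebraic_int x" by simp
    obtain c where c: "x = (\<Sum>i<d. of_rat (c i) * u i)" using u by (auto simp: rat_spanning_def d_def)
    have "of_int N * c j \<in> \<int>" if j: "j < d" for j
    proof -
      have "(\<Sum>k<d. adj_mat ?M $$ (j, k) * e k x) =
          (\<Sum>k<d. \<Sum>i<d. of_rat (c i) * (adj_mat ?M $$ (j, k) * e k (u i)))"
      proof (intro sum.cong refl)
        fix k assume "k \<in> {..<d}"
        hence "e k x = (\<Sum>i<d. of_rat (c i) * e k (u i))" by (simp only: c field_hom_rat_comb[OF hom] lessThan_iff)
        thus "adj_mat ?M $$ (j, k) * e k x = (\<Sum>i<d. of_rat (c i) * (adj_mat ?M $$ (j, k) * e k (u i)))"
          by (simp add: sum_distrib_left mult_ac)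
      qed
      also have "\<dots> = (\<Sum>i<d. of_rat (c i) * (\<Sum>k<d. adj_mat ?M $$ (j, k) * e k (u i)))"
        by (subst sum.swap) (simp add: sum_distrib_left)
      also have "\<dots> = (\<Sum>i<d. of_rat (c i) * (det ?M * of_bool (j = i)))"
      proof (intro sum.cong refl arg_cong2[where f = times])
        fix i assume i: "i \<in> {..<d}"
        have "(\<Sum>k<d. adj_mat ?M $$ (j, k) * e k (u i)) = (adj_mat ?M * ?M) $$ (j, i)"
          using i j C adj_mat(1)[OF C]
          by (auto simp: scalar_prod_def lessThan_atLeast0 emat_def intro!: sum.cong)
        thus "(\<Sum>k<d. adj_mat ?M $$ (j, k) * e k (u i)) = det ?M * of_bool (j = i)"
          using i j by (simp add: adj_mat(3)[OF C])
      qed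
      also have "\<dots> = (\<Sum>i<d. if i = j then of_rat (c j) * det ?M else 0)"
        by (intro sum.cong) auto
      also have "\<dots> = of_rat (c j) * det ?M" using j by simp
      finally have "of_rat (c j) * det ?M * \<delta>' = (\<Sum>k<d. adj_mat ?M $$ (j, k) * e k x) * \<delta>'" by simp
      moreover have "algebraic_int ((\<Sum>k<d. adj_mat ?M $$ (j, k) * e k x) * \<delta>')"
        using N(1) adji j field_hom_algebraic_int[OF hom x]
        by (intro algebraic_int_mult algebraic_int_sum) auto
      moreover have "of_rat (c j) * det ?M * \<delta>' = (of_rat (of_int N * c j) :: rat alg_closure)"
        unfolding mult.assoc N(3) by (simp add: of_rat_mult mult.commute)
      ultimately have "algebraic_int (of_rat (of_int N * c j) :: rat alg_closure)" by simp
      hence "(of_rat (of_int N * c j) :: rat alg_closure) \<in> \<int>"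
        by (rule rational_algebraic_int_is_int) simp
      then obtain n where "(of_rat (of_int N * c j) :: rat alg_closure) = of_int n" by (auto elim: Ints_cases)
      hence "of_int N * c j = of_int n" by (metis of_rat_eq_iff of_rat_of_int_eq)
      thus ?thesis by simp
    qed
    hence "\<forall>j. \<exists>n. j < d \<longrightarrow> of_int N * c j = of_int n" by (auto elim: Ints_cases)
    then obtain n where n: "\<And>j. j < d \<Longrightarrow> of_int N * c j = of_int (n j)" by metis
    have "x = zcomb d v n"
      unfolding c zcomb_def
    proof (intro sum.cong refl)
      fix i assume "i \<in> {..<d}"
      hence "(of_rat (of_int N * c i) :: 'k) = of_int (n i)" using n by simp
      hence "of_int (n i) * v i = of_rat (c i) * (of_int N * v i)" by (simp add: of_rat_mult mult_ac)
      thus "of_rat (c i) * u i = of_int (n i) * v i" by (simp add: vu)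
    qed
    thus "x \<in> range (zcomb d v)" by blast
  qed
  interpret sublattice d v "{x. algebraic_int x}" N
  proof
    show "zindep d v" by (rule rat_spanning_zindep[OF v])
    show "of_int N * zcomb d v c \<in> {x. algebraic_int x}" for c
    proof -
      have "of_int N * zcomb d v c = (\<Sum>i<d. of_int (c i) * (of_int N * v i))"
        by (simp add: zcomb_def sum_distrib_left mult_ac)
      thus ?thesis using ui by (auto simp: vu intro!: algebraic_int_sum algebraic_int_mult)
    qed
  qed (use sub N(2) in \<open>auto intro: algebraic_int_diff\<close>)
  show ?thesis using that[OF mb_indep M_span] .
qed

lemma integral_basis_rat_spanning:
  assumes "{x. algebraic_int x} = range (zcomb d (w :: nat \<Rightarrow> 'k))"
  shows "rat_spanning w"
  unfolding rat_spanning_def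
proof
  fix x :: 'k
  obtain D where D: "D > 0" "algebraic_int (of_int D * x)"
    using algebraic_scale_to_int[OF number_field_algebraic[OF nf]] by metis
  then obtain c where c: "of_int D * x = zcomb d w c" using assms by auto
  have "x = (\<Sum>i<nf_degree TYPE('k). of_rat (of_int (c i) / of_int D) * w i)"
  proof -
    have "x = (of_int D * x) / of_int D" using D(1) by simp
    also have "\<dots> = (\<Sum>i<nf_degree TYPE('k). of_rat (of_int (c i) / of_int D) * w i)"
      unfolding c zcomb_def d_def by (simp add: sum_divide_distrib of_rat_divide)
    finally show ?thesis .
  qed
  thus "\<exists>c. x = (\<Sum>i<nf_degree TYPE('k). of_rat (c i) * w i)"
    by (rule exI[of _ "\<lambda>i. of_int (c i) / of_int D"])
qed

end

section \<open>Ideals of the ring of integers, their index and norms\<close>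

lemma
  fixes I :: "'k::field_char_0 set"
  assumes "ideal I ring_of_integers"
  shows ideal_alg_int: "x \<in> I \<Longrightarrow> algebraic_int x"
    and ideal_0: "0 \<in> I"
    and ideal_add: "x \<in> I \<Longrightarrow> y \<in> I \<Longrightarrow> x + y \<in> I"
    and ideal_mult: "algebraic_int a \<Longrightarrow> x \<in> I \<Longrightarrow> a * x \<in> I"
    and ideal_diff: "x \<in> I \<Longrightarrow> y \<in> I \<Longrightarrow> x - y \<in> I"
    and ideal_sum: "(\<And>i. i \<in> J \<Longrightarrow> f i \<in> I) \<Longrightarrow> sum f J \<in> I"
proof -
  interpret ideal I "ring_of_integers :: 'k ring" by fact
  show a: "algebraic_int x" if "x \<in> I" for x using a_subset that by (auto simp: ring_of_integers_def)
  show z: "0 \<in> I" using additive_subgroup.zero_closed[OF is_additive_subgroup] by (simp add: ring_of_integers_def)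
  show ad: "x + y \<in> I" if "x \<in> I" "y \<in> I" for x y
    using additive_subgroup.a_closed[OF is_additive_subgroup that] by (simp add: ring_of_integers_def)
  show m: "a * x \<in> I" if "algebraic_int a" "x \<in> I" for a x
    using I_l_closed[of x a] that by (simp add: ring_of_integers_def)
  show "x - y \<in> I" if "x \<in> I" "y \<in> I" for x y
  proof -
    have "(- 1) * y \<in> I" using that by (intro m) auto
    from ad[OF that(1) this] show ?thesis by simp
  qed
  show "(\<And>i. i \<in> J \<Longrightarrow> f i \<in> I) \<Longrightarrow> sum f J \<in> I"
    by (induction J rule: infinite_finite_induct) (auto intro: z ad)
qed

lemma ideal_index_altdef:
  "ideal_index (I :: 'k::field_char_0 set) = card {(\<lambda>x. x + a) ` I |a. algebraic_int a}"
proof -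
  have "a_rcosets\<^bsub>ring_of_integers\<^esub> I = {(\<lambda>x. x + a) ` I |a. algebraic_int a}"
    unfolding A_RCOSETS_def' a_r_coset_def' by (auto simp: ring_of_integers_def image_def)
  thus ?thesis by (simp add: ideal_index_def)
qed

context nf
begin

text \<open>Multiplication by \<open>y\<close> sends the integral basis into \<open>I\<close>, so
  its matrix factors as \<open>Cm * Tm\<close> through the Hermite rows of \<open>I\<close>. The
  embedding matrix conjugates it, up to transposition, to the diagonal matrix of conjugates of
  \<open>y\<close>; comparing determinants gives the norm as \<open>det Cm\<close> times the
  index.\<close>

theorem index_dvd_norm:
  assumes I: "ideal (I :: 'k set) ring_of_integers" "I \<noteq> {0}"
  shows "ideal_index I > 0" and "y \<in> I \<Longrightarrow> \<exists>c. (\<Prod>\<sigma>\<in>Emb. \<sigma> y) = of_int (c * int (ideal_index I))"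
proof -
  obtain w :: "nat \<Rightarrow> 'k" where w: "zindep d w" "{x. algebraic_int x} = range (zcomb d w)"
    by (rule exists_integral_basis)
  obtain z where z: "z \<in> I" "z \<noteq> 0" using I(2) ideal_0[OF I(1)] by blast
  obtain z' N where N: "algebraic_int z'" "N > 0" "z * z' = of_int N"
    using algebraic_int_dvd_int[OF ideal_alg_int[OF I(1) z(1)] z(2)] by blast
  have NI: "of_int N \<in> I" using ideal_mult[OF I(1) N(1) z(1)] N(3) by (simp add: mult.commute)
  have alg: "algebraic_int (zcomb d w c)" for c using w(2) by blast
  interpret sublattice d w I N
  proof
    show "of_int N * zcomb d w c \<in> I" for c
      using ideal_mult[OF I(1) alg NI] by (simp add: mult.commute)
    show "I \<subseteq> range (zcomb d w)" using w(2) ideal_alg_int[OF I(1)] by blast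
  qed (use w(1) N(2) ideal_0[OF I(1)] ideal_diff[OF I(1)] in auto)
  have "{(\<lambda>x. x + a) ` I |a. algebraic_int a} = {(\<lambda>x. x + a) ` I |a. a \<in> range (zcomb d w)}"
    unfolding w(2)[symmetric] by simp
  hence idx: "ideal_index I = nat (\<Prod>i<d. T i i)"
    using card_cosets by (simp add: ideal_index_altdef)
  have pos: "(\<Prod>i<d. T i i) > 0" using T_pos by (intro prod_pos) auto
  show "ideal_index I > 0" using idx pos by simp
  assume y: "y \<in> I"
  have "\<forall>i. \<exists>c. i < d \<longrightarrow> y * w i = zcomb d mb c"
  proof (intro allI)
    fix i
    show "\<exists>c. i < d \<longrightarrow> y * w i = zcomb d mb c"
    proof (cases "i < d")
      case True
      have "w i = zcomb d w (\<lambda>j. if j = i then 1 else 0)"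
      proof -
        have "zcomb d w (\<lambda>j. if j = i then 1 else 0) = (\<Sum>j<d. if j = i then w j else 0)"
          unfolding zcomb_def by (intro sum.cong) auto
        thus ?thesis using True by simp
      qed
      hence "algebraic_int (w i)" using alg by metis
      from ideal_mult[OF I(1) this y] have "y * w i \<in> I" by (simp add: mult.commute)
      thus ?thesis using M_span by blast
    qed simp
  qed
  then obtain C where C: "\<And>i. i < d \<Longrightarrow> y * w i = zcomb d mb (C i)" by metis
  obtain e :: "nat \<Rightarrow> 'k \<Rightarrow> rat alg_closure" where e: "emb_enum e" by (rule exists_emb_enum)
  have hom: "field_hom (e k)" if "k < d" for k using emb_enum_hom[OF e] that by (simp add: d_def)
  define Cm where "Cm = mat d d (\<lambda>(i, j). C i j)"
  define Tm where "Tm = mat d d (\<lambda>(i, j). T i j)"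
  define Dm where "Dm = mat d d (\<lambda>(i, j). if i = j then e i y else 0)"
  have car: "Cm \<in> carrier_mat d d" "Tm \<in> carrier_mat d d" "Dm \<in> carrier_mat d d"
    "emat e w \<in> carrier_mat d d" by (simp_all add: Cm_def Tm_def Dm_def emat_def)
  let ?A = "map_mat of_int (Cm * Tm) :: rat alg_closure mat"
  have key: "e k y * e k (w i) = (\<Sum>l<d. e k (w l) * of_int ((Cm * Tm) $$ (i, l)))" if "k < d" "i < d" for k i
  proof -
    interpret field_hom "e k" by (rule hom[OF that(1)])
    have "e k y * e k (w i) = e k (zcomb d mb (C i))" using C[OF that(2)] by (simp add: hom_mult[symmetric])
    also have "\<dots> = (\<Sum>j<d. of_int (C i j) * e k (mb j))" by (rule field_hom_zcomb[OF hom[OF that(1)]])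
    also have "\<dots> = (\<Sum>j<d. \<Sum>l<d. of_int (C i j) * (of_int (T j l) * e k (w l)))"
      by (intro sum.cong refl) (simp add: mb_eq field_hom_zcomb[OF hom[OF that(1)]] sum_distrib_left)
    also have "\<dots> = (\<Sum>l<d. \<Sum>j<d. of_int (C i j) * (of_int (T j l) * e k (w l)))" by (rule sum.swap)
    also have "\<dots> = (\<Sum>l<d. e k (w l) * of_int (\<Sum>j<d. C i j * T j l))"
      by (simp add: sum_distrib_left mult_ac)
    also have "\<dots> = (\<Sum>l<d. e k (w l) * of_int ((Cm * Tm) $$ (i, l)))"
      using that(2) by (intro sum.cong refl)
        (simp add: Cm_def Tm_def scalar_prod_def lessThan_atLeast0)
    finally show ?thesis .
  qed
  have "Dm * emat e w = emat e w * transpose_mat ?A"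
  proof (rule eq_matI)
    fix k i assume "k < dim_row (emat e w * transpose_mat ?A)" "i < dim_col (emat e w * transpose_mat ?A)"
    hence ki: "k < d" "i < d" using car by auto
    have "(Dm * emat e w) $$ (k, i) = (\<Sum>l<d. (if k = l then e k y else 0) * e l (w i))"
      using ki by (simp add: Dm_def emat_def scalar_prod_def lessThan_atLeast0)
    also have "\<dots> = (\<Sum>l<d. if k = l then e k y * e l (w i) else 0)" by (intro sum.cong) auto
    also have "\<dots> = e k y * e k (w i)" using ki by simp
    also have "\<dots> = (emat e w * transpose_mat ?A) $$ (k, i)"
      using ki car key[OF ki]
      by (simp add: emat_def scalar_prod_def lessThan_atLeast0)
    finally show "(Dm * emat e w) $$ (k, i) = (emat e w * transpose_mat ?A) $$ (k, i)" .
  qed (use car in auto)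
  hence "det Dm * det (emat e w) = det (emat e w) * det (transpose_mat ?A)"
    using det_mult[OF car(3,4)] det_mult[OF car(4), of "transpose_mat ?A"] car by auto
  hence "det Dm = det (transpose_mat ?A)"
    using det_emat_nonzero[OF e integral_basis_rat_spanning[OF w(2)]] by simp
  also have "\<dots> = det ?A" using car by (intro det_transpose) auto
  also have "\<dots> = of_int (det Cm * det Tm)"
    using car by (simp add: det_mult)
  also have "det Tm = (\<Prod>i<d. T i i)"
    using det_lower_triangular[of d Tm] car(2) T_triangular
    by (auto simp: Tm_def prod_list_diag_prod lessThan_atLeast0 intro!: prod.cong)
  also have "det Dm = (\<Prod>i<d. e i y)"
    using det_lower_triangular[of d Dm] car(3)
    by (auto simp: Dm_def prod_list_diag_prod lessThan_atLeast0 intro!: prod.cong)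
  also have "\<dots> = (\<Prod>\<sigma>\<in>Emb. \<sigma> y)" by (simp add: prod_emb_enum[OF e] d_def)
  finally have "(\<Prod>\<sigma>\<in>Emb. \<sigma> y) = of_int (det Cm * int (ideal_index I))"
    using idx pos by simp
  thus "\<exists>c. (\<Prod>\<sigma>\<in>Emb. \<sigma> y) = of_int (c * int (ideal_index I))" by blast
qed

end

section \<open>Valuation rings above a prime\<close>

text \<open>That every element is algebraic makes \<open>V\<close> behave like a valuation ring of
  rank one: powers of a non-unit become divisible by \<open>p\<close> (\<open>mx_power_p\<close>),
  and powers of \<open>p\<close> by any nonzero element (\<open>p_power_div\<close>).\<close>

locale pval =
  fixes V :: "'a::field_char_0 set" and p :: nat
  assumes vr: "val_ring V" and p: "Factorial_Ring.prime p" and pV: "inverse (of_nat p) \<notin> V"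
    and alg: "\<And>x :: 'a. algebraic x"
begin

lemma sub: "is_subring V" by (rule val_ring_subring[OF vr])

lemma V_total: "x \<in> V \<or> inverse x \<in> V" using vr by (simp add: val_ring_def)

lemmas V_0 = is_subring_0[OF sub] and V_1 = is_subring_1[OF sub] and V_add = is_subring_add[OF sub]
  and V_diff = is_subring_diff[OF sub] and V_mult = is_subring_mult[OF sub]
  and V_uminus = is_subring_uminus[OF sub] and V_power = is_subring_power[OF sub]
  and V_sum = is_subring_sum[OF sub] and V_prod = is_subring_prod[OF sub]
  and V_of_nat = is_subring_of_nat[OF sub] and V_of_int = is_subring_of_int[OF sub]

lemma p_gt_1: "p > 1" using p by (rule prime_gt_1_nat)

lemma p_pos [simp]: "p > 0" using p_gt_1 by simp

lemma p_neq_0 [simp]: "p \<noteq> 0" using p_gt_1 by simp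

lemma p_nz [simp]: "(of_nat p :: 'a) \<noteq> 0" using p_gt_1 by simp

definition mx :: "'a set" where "mx = {x \<in> V. x = 0 \<or> inverse x \<notin> V}"

definition vunit :: "'a \<Rightarrow> bool" where "vunit x \<longleftrightarrow> x \<in> V \<and> x \<notin> mx"

lemma vunit_iff: "vunit x \<longleftrightarrow> x \<noteq> 0 \<and> x \<in> V \<and> inverse x \<in> V"
  by (auto simp: vunit_def mx_def)

lemma vunit_1: "vunit 1" by (simp add: vunit_iff V_1)

lemma vunit_mult: "vunit x \<Longrightarrow> vunit y \<Longrightarrow> vunit (x * y)"
  by (auto simp: vunit_iff V_mult)

lemma vunit_inverse: "vunit x \<Longrightarrow> vunit (inverse x)"
  by (auto simp: vunit_iff)

lemma vunit_divide: "vunit x \<Longrightarrow> vunit y \<Longrightarrow> vunit (x / y)"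
  by (simp add: divide_inverse vunit_mult vunit_inverse)

lemma vunit_power: "vunit x \<Longrightarrow> vunit (x ^ n)"
  by (induction n) (auto intro: vunit_1 vunit_mult)

lemma mx_V: "x \<in> mx \<Longrightarrow> x \<in> V" by (simp add: mx_def)

lemma mx_0: "0 \<in> mx" by (simp add: mx_def V_0)

lemma not_in_V: "x \<notin> V \<Longrightarrow> inverse x \<in> mx"
  using V_total[of x] by (auto simp: mx_def)

lemma mx_mult: assumes "a \<in> V" "x \<in> mx" shows "a * x \<in> mx"
proof (cases "a * x = 0")
  case False
  have "inverse (a * x) \<notin> V"
  proof
    assume "inverse (a * x) \<in> V"
    from V_mult[OF assms(1) this] have "inverse x \<in> V" using False by (simp add: field_simps)
    thus False using assms(2) False by (auto simp: mx_def)
  qed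
  thus ?thesis using assms V_mult by (auto simp: mx_def)
qed (auto simp: mx_0)

lemma mx_mult': "x \<in> mx \<Longrightarrow> a \<in> V \<Longrightarrow> x * a \<in> mx"
  using mx_mult by (simp add: mult.commute)

lemma mx_uminus: "x \<in> mx \<Longrightarrow> - x \<in> mx"
  using mx_mult[of "- 1" x] V_uminus[OF V_1] by simp

lemma mx_add: assumes "x \<in> mx" "y \<in> mx" shows "x + y \<in> mx"
proof (cases "x = 0 \<or> y = 0")
  case False
  consider "x / y \<in> V" | "y / x \<in> V" using V_total[of "x / y"] False by (auto simp: field_simps)
  thus ?thesis
  proof cases
    case 1
    have "x + y = (x / y + 1) * y" using False by (simp add: field_simps)
    thus ?thesis using mx_mult[OF V_add[OF 1 V_1] assms(2)] by simp
  next
    case 2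
    have "x + y = (y / x + 1) * x" using False by (simp add: field_simps)
    thus ?thesis using mx_mult[OF V_add[OF 2 V_1] assms(1)] by simp
  qed
qed (use assms in auto)

lemma mx_diff: "x \<in> mx \<Longrightarrow> y \<in> mx \<Longrightarrow> x - y \<in> mx"
  using mx_add[OF _ mx_uminus] by fastforce

lemma mx_sum: "(\<And>i. i \<in> I \<Longrightarrow> f i \<in> mx) \<Longrightarrow> sum f I \<in> mx"
  by (induction I rule: infinite_finite_induct) (auto intro: mx_0 mx_add)

lemma one_not_mx: "1 \<notin> mx" using vunit_1 by (simp add: vunit_def)

lemma mx_prime: "x \<in> V \<Longrightarrow> y \<in> V \<Longrightarrow> x * y \<in> mx \<Longrightarrow> x \<in> mx \<or> y \<in> mx"
  using vunit_mult[of x y] by (auto simp: vunit_def)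

lemma mx_power: "x \<in> V \<Longrightarrow> x ^ n \<in> mx \<Longrightarrow> x \<in> mx"
  using vunit_power[of x n] by (auto simp: vunit_def)

lemma vunit_add_mx: "vunit x \<Longrightarrow> y \<in> mx \<Longrightarrow> vunit (x + y)"
  using mx_diff[of "x + y" y] by (auto simp: vunit_def mx_V intro: V_add)

lemma p_mx: "of_nat p \<in> mx"
  using pV V_of_nat by (simp add: mx_def)

lemma vunit_of_int: assumes "\<not> int p dvd n" shows "vunit (of_int n)"
proof -
  have "coprime (int p) n" using p assms by (simp add: prime_imp_coprime)
  then obtain u v where uv: "u * n + v * int p = 1" by (metis bezout_int coprime_iff_gcd_eq_1 gcd.commute)
  have "of_int n \<notin> mx"
  proof
    assume n: "of_int n \<in> mx"
    have "(1 :: 'a) = of_int (u * n + v * int p)" using uv by simp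
    also have "\<dots> = of_int u * of_int n + of_int v * of_nat p" by simp
    also have "\<dots> \<in> mx" by (intro mx_add mx_mult V_of_int n p_mx)
    finally show False using one_not_mx by simp
  qed
  thus ?thesis by (simp add: vunit_def V_of_int)
qed

lemma of_int_mx: assumes "int p dvd n" shows "of_int n \<in> mx"
proof -
  obtain m where "n = int p * m" using assms by (elim dvdE)
  thus ?thesis using mx_mult[OF V_of_int[of m] p_mx] by (simp add: mult.commute)
qed

lemma of_int_mx_iff: "of_int n \<in> mx \<longleftrightarrow> int p dvd n"
  using vunit_of_int[of n] of_int_mx[of n] by (auto simp: vunit_def)

text \<open>The way back from \<open>V\<close> to the rational integers: \<open>p\<close> is not
  invertible in \<open>V\<close> but integers prime to \<open>p\<close> are, so factors
  \<open>p\<close> can be removed one at a time.\<close>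

lemma int_dvd_of_V: "of_int n / of_nat p ^ k \<in> V \<Longrightarrow> int p ^ k dvd n"
proof (induction k arbitrary: n)
  case (Suc k)
  have "(of_int n / of_nat p :: 'a) = of_nat p ^ k * (of_int n / of_nat p ^ Suc k)" by (simp add: field_simps)
  also have "\<dots> \<in> V" using Suc.prems by (intro V_mult V_power V_of_nat)
  finally have 1: "of_int n / of_nat p \<in> V" .
  have "int p dvd n"
  proof (rule ccontr)
    assume "\<not> int p dvd n"
    hence u: "vunit (of_int n)" by (rule vunit_of_int)
    hence "inverse (of_nat p) = inverse (of_int n) * (of_int n / of_nat p :: 'a)"
      by (simp add: vunit_iff field_simps)
    also have "\<dots> \<in> V" using u 1 by (intro V_mult) (auto simp: vunit_iff)
    finally show False using pV by simp
  qed
  then obtain m where m: "n = int p * m" by (elim dvdE)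
  have "of_int m / of_nat p ^ k \<in> V" using Suc.prems by (simp add: m)
  thus ?case using Suc.IH m by simp
qed simp

text \<open>Take an integral relation for \<open>x\<close> whose coefficients are not all divisible
  by \<open>p\<close>, and the least index \<open>i0\<close> with a coefficient prime to
  \<open>p\<close>. The terms from \<open>i0\<close> on are \<open>x ^ i0\<close> times a unit, as
  \<open>x\<close> is in \<open>mx\<close>; the terms before are divisible by
  \<open>p\<close>.\<close>

lemma mx_power_p: assumes "x \<in> mx" shows "\<exists>n. x ^ n / of_nat p \<in> V"
proof -
  obtain q i where q: "poly (map_poly of_int q) x = 0" "\<not> int p dvd poly.coeff q i"
    using algebraic_primitive[OF alg p] by metis
  define i0 where "i0 = (LEAST i. \<not> int p dvd poly.coeff q i)"
  have i0: "\<not> int p dvd poly.coeff q i0" unfolding i0_def by (rule LeastI[of _ i]) (rule q(2))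
  have lt: "int p dvd poly.coeff q j" if "j < i0" for j using not_less_Least[of j] that by (auto simp: i0_def)
  define c where "c = (\<lambda>j. of_int (poly.coeff q j) :: 'a)"
  have ile: "i0 \<le> degree q" using i0 by (intro le_degree) auto
  have "0 = (\<Sum>j\<le>degree q. c j * x ^ j)"
    using q(1) by (simp add: poly_altdef degree_map_poly coeff_map_poly c_def)
  also have "{..degree q} = {..<i0} \<union> ({i0} \<union> {i0<..degree q})" using ile by auto
  also have "(\<Sum>j\<in>\<dots>. c j * x ^ j) = (\<Sum>j<i0. c j * x ^ j) + (c i0 * x ^ i0 + (\<Sum>j\<in>{i0<..degree q}. c j * x ^ j))"
    by (subst sum.union_disjoint) (auto simp: sum.union_disjoint)
  also have "(\<Sum>j\<in>{i0<..degree q}. c j * x ^ j) = x ^ i0 * (x * (\<Sum>j\<in>{i0<..degree q}. c j * x ^ (j - i0 - 1)))"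
    unfolding sum_distrib_left
  proof (intro sum.cong refl)
    fix j assume "j \<in> {i0<..degree q}"
    hence "j = i0 + Suc (j - i0 - 1)" by auto
    hence "x ^ j = x ^ i0 * (x * x ^ (j - i0 - 1))" by (metis power_Suc power_add)
    thus "c j * x ^ j = x ^ i0 * (x * (c j * x ^ (j - i0 - 1)))" by simp
  qed
  finally have eq: "x ^ i0 * (c i0 + x * (\<Sum>j\<in>{i0<..degree q}. c j * x ^ (j - i0 - 1))) = - (\<Sum>j<i0. c j * x ^ j)"
    by (simp add: algebra_simps eq_neg_iff_add_eq_0)
  define u where "u = c i0 + x * (\<Sum>j\<in>{i0<..degree q}. c j * x ^ (j - i0 - 1))"
  have u: "vunit u"
    unfolding u_def using assms
    by (intro vunit_add_mx mx_mult') (auto simp: c_def vunit_of_int[OF i0] mx_V intro!: V_sum V_mult V_of_int V_power)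
  have "(\<Sum>j<i0. c j * x ^ j) / of_nat p \<in> V"
    unfolding sum_divide_distrib
  proof (intro V_sum)
    fix j assume "j \<in> {..<i0}"
    then obtain m where "poly.coeff q j = int p * m" using lt by (auto elim: dvdE)
    thus "c j * x ^ j / of_nat p \<in> V"
      using assms by (simp add: c_def) (intro V_mult V_of_int V_power mx_V)
  qed
  hence "inverse u * - ((\<Sum>j<i0. c j * x ^ j) / of_nat p) \<in> V"
    using u by (intro V_mult V_uminus) (auto simp: vunit_iff)
  moreover have "x ^ i0 / of_nat p = inverse u * - ((\<Sum>j<i0. c j * x ^ j) / of_nat p)"
  proof -
    have "x ^ i0 * u = - (\<Sum>j<i0. c j * x ^ j)" using eq by (simp only: u_def)
    hence "x ^ i0 = inverse u * - (\<Sum>j<i0. c j * x ^ j)" using u by (simp add: vunit_iff field_simps)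
    thus ?thesis by simp
  qed
  ultimately show ?thesis by metis
qed

text \<open>For \<open>x\<close> in \<open>V\<close>, the nonzero constant coefficient of an
  integral relation is a multiple of \<open>x\<close>, and it is a power of \<open>p\<close> times a
  unit.\<close>

lemma p_power_div: assumes "x \<noteq> 0" shows "\<exists>n. of_nat p ^ n / x \<in> V"
proof (cases "x \<in> V")
  case True
  obtain q where q: "poly (map_poly of_int q) x = 0" "poly.coeff q 0 \<noteq> 0"
    using algebraic_primitive[OF alg p, of x] assms by metis
  obtain c r where cr: "q = pCons c r" by (cases q) auto
  have c: "c \<noteq> 0" using q cr by simp
  have eq: "of_int c + x * poly (map_poly of_int r) x = 0" using q(1) by (simp add: cr map_poly_pCons)
  have r: "poly (map_poly of_int r) x \<in> V"
    by (rule is_subring_poly[OF sub True]) (simp add: coeff_map_poly V_of_int)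
  have "\<not> is_unit (int p)" using p_gt_1 by simp
  then obtain c' where c': "c = int p ^ multiplicity (int p) c * c'" "\<not> int p dvd c'"
    using multiplicity_decompose'[of c "int p"] c by metis
  define n where "n = multiplicity (int p) c"
  have u: "vunit (of_int c' :: 'a)" by (rule vunit_of_int[OF c'(2)])
  have "(of_int c :: 'a) = of_nat p ^ n * of_int c'" using arg_cong[OF c'(1), of "of_int :: int \<Rightarrow> 'a"] by (simp add: n_def)
  hence "of_nat p ^ n / x = - (inverse (of_int c') * poly (map_poly of_int r) x)"
    using eq u assms by (simp add: vunit_iff field_simps eq_neg_iff_add_eq_0)
  also have "\<dots> \<in> V" using r u by (intro V_uminus V_mult) (auto simp: vunit_iff)
  finally show ?thesis by blast
next
  case False
  hence "inverse x \<in> V" using V_total by blast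
  thus ?thesis by (intro exI[of _ 0]) (simp add: field_simps)
qed

lemma mx_power_div_ge: assumes "x \<in> mx" "y \<noteq> 0" shows "\<exists>n. \<forall>m\<ge>n. x ^ m / y \<in> V"
proof -
  obtain k where k: "x ^ k / of_nat p \<in> V" using mx_power_p[OF assms(1)] by blast
  obtain n where n: "of_nat p ^ n / y \<in> V" using p_power_div[OF assms(2)] by blast
  have "x ^ m / y \<in> V" if "m \<ge> k * n" for m
  proof -
    have "x ^ m / y = x ^ (m - k * n) * ((x ^ k / of_nat p) ^ n * (of_nat p ^ n / y))"
    proof -
      have "x ^ m = x ^ (m - k * n) * (x ^ k) ^ n"
        using that by (simp flip: power_add power_mult)
      thus ?thesis by (simp add: power_divide)
    qed
    also have "\<dots> \<in> V" using k n assms(1) by (intro V_mult V_power) (auto intro: mx_V)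
    finally show ?thesis .
  qed
  thus ?thesis by blast
qed

text \<open>The mixed binomial terms are divisible by \<open>p\<close>. Keeping also their factor
  \<open>x - y\<close> is what lets \<open>frobenius_congr\<close> gain precision at every
  step.\<close>

lemma freshman:
  assumes "x \<in> V" "y \<in> V"
  shows "\<exists>w\<in>V. x ^ p - y ^ p = (x - y) ^ p + of_nat p * (x - y) * w"
proof -
  define u where "u = x - y"
  have u: "u \<in> V" using assms by (simp add: u_def V_diff)
  define w where "w = (\<Sum>k\<in>{0<..<p}. of_nat ((p choose k) div p) * u ^ (k - 1) * y ^ (p - k))"
  have "x ^ p = (u + y) ^ p" by (simp add: u_def)
  also have "\<dots> = (\<Sum>k\<le>p. of_nat (p choose k) * u ^ k * y ^ (p - k))" by (rule binomial_ring)
  also have "{..p} = insert 0 (insert p {0<..<p})" using p_gt_1 by auto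
  also have "(\<Sum>k\<in>\<dots>. of_nat (p choose k) * u ^ k * y ^ (p - k)) =
      y ^ p + (u ^ p + (\<Sum>k\<in>{0<..<p}. of_nat (p choose k) * u ^ k * y ^ (p - k)))"
    using p_gt_1 by simp
  also have "(\<Sum>k\<in>{0<..<p}. of_nat (p choose k) * u ^ k * y ^ (p - k)) = of_nat p * u * w"
    unfolding w_def sum_distrib_left
  proof (intro sum.cong refl)
    fix k assume k: "k \<in> {0<..<p}"
    hence "p dvd (p choose k)" using p by (intro dvd_choose_prime) auto
    hence "of_nat (p choose k) = (of_nat p * of_nat ((p choose k) div p) :: 'a)"
      by (metis dvd_mult_div_cancel of_nat_mult)
    moreover have "u ^ k = u * u ^ (k - 1)" using k by (cases k) auto
    ultimately show "of_nat (p choose k) * u ^ k * y ^ (p - k) =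
        of_nat p * u * (of_nat ((p choose k) div p) * u ^ (k - 1) * y ^ (p - k))" by simp
  qed
  finally have "x ^ p - y ^ p = u ^ p + of_nat p * u * w" by simp
  moreover have "w \<in> V" unfolding w_def using u assms by (intro V_sum V_mult V_of_nat V_power)
  ultimately show ?thesis by (auto simp: u_def)
qed

text \<open>Each p-th power gains one more factor \<open>s\<close>, a non-unit dividing both
  \<open>p\<close> and \<open>x - y\<close>, and high powers of \<open>s\<close> are divisible by
  any nonzero \<open>z\<close>.\<close>

lemma frobenius_congr:
  assumes x: "x \<in> V" and y: "y \<in> V" and xy: "x - y \<in> mx" and z: "z \<noteq> 0"
  shows "\<exists>n0. \<forall>n\<ge>n0. (x ^ (p ^ n) - y ^ (p ^ n)) / z \<in> V"
proof -
  \<comment> \<open>\<open>s\<close> is whichever of \<open>p\<close> and \<open>x - y\<close>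
    divides the other, so that it divides both.\<close>
  obtain s where s: "s \<noteq> 0" "s \<in> mx" "(x - y) / s \<in> V" "of_nat p / s \<in> V"
  proof (cases "(x - y) / of_nat p \<in> V")
    case True
    show ?thesis by (rule that[of "of_nat p"]) (use True p_mx in \<open>auto simp: V_1\<close>)
  next
    case False
    hence "x - y \<noteq> 0" using V_0 by auto
    show ?thesis
    proof (rule that[of "x - y"])
      show "of_nat p / (x - y) \<in> V" using not_in_V[OF False] mx_V by (simp add: field_simps)
    qed (use xy \<open>x - y \<noteq> 0\<close> in \<open>auto simp: V_1\<close>)
  qed
  have main: "(x ^ (p ^ n) - y ^ (p ^ n)) / s ^ Suc n \<in> V" for n
  proof (induction n)
    case 0
    show ?case using s by simp
  next
    case (Suc n)
    define a b where "a = x ^ (p ^ n)" and "b = y ^ (p ^ n)"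
    have ab: "a \<in> V" "b \<in> V" using x y by (auto simp: a_def b_def V_power)
    from freshman[OF ab] obtain w where w: "w \<in> V" "a ^ p - b ^ p = (a - b) ^ p + of_nat p * (a - b) * w" by blast
    define r where "r = (a - b) / s ^ Suc n"
    have r: "r \<in> V" "a - b = r * s ^ Suc n" using Suc.IH s(1) by (auto simp: r_def a_def b_def)
    define k where "k = p - 2"
    have k: "p = Suc (Suc k)" using p_gt_1 by (simp add: k_def)
    define Q where "Q = r * s ^ n * (a - b) ^ k + (of_nat p / s) * w"
    have pw: "(a - b) ^ p = (a - b) * ((a - b) * (a - b) ^ k)" by (subst k) simp
    have ab1: "(a - b) * (a - b) ^ k = s * (r * s ^ n * (a - b) ^ k)"
      by (subst (1) r(2)) (simp add: mult_ac)
    have "of_nat p * w = s * ((of_nat p / s) * w)" using s(1) by simp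
    hence "(a - b) * (a - b) ^ k + of_nat p * w = s * Q" unfolding Q_def ab1 by (simp only: distrib_left)
    moreover have "a ^ p - b ^ p = (a - b) * ((a - b) * (a - b) ^ k + of_nat p * w)"
      unfolding w(2) pw by (simp only: distrib_left mult_ac)
    ultimately have "a ^ p - b ^ p = (a - b) * (s * Q)" by simp
    also have "\<dots> = r * s ^ Suc n * (s * Q)" by (simp only: r(2))
    also have "\<dots> = s ^ Suc (Suc n) * (r * Q)" by (simp add: mult_ac)
    finally have "(a ^ p - b ^ p) / s ^ Suc (Suc n) = r * (r * s ^ n * (a - b) ^ k + (of_nat p / s) * w)"
      using s(1) by (simp add: Q_def)
    also have "\<dots> \<in> V"
      using r(1) s ab w(1) by (intro V_mult V_add V_power V_diff) (auto intro: mx_V)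
    finally have "(a ^ p - b ^ p) / s ^ Suc (Suc n) \<in> V" .
    moreover have "a ^ p = x ^ (p ^ Suc n)" "b ^ p = y ^ (p ^ Suc n)"
      by (simp_all add: a_def b_def power_mult[symmetric] mult.commute)
    ultimately show ?case by (simp only:)
  qed
  from mx_power_div_ge[OF s(2) z] obtain n0 where n0: "\<And>m. m \<ge> n0 \<Longrightarrow> s ^ m / z \<in> V" by blast
  have "(x ^ (p ^ n) - y ^ (p ^ n)) / z \<in> V" if "n \<ge> n0" for n
  proof -
    have "(x ^ (p ^ n) - y ^ (p ^ n)) / z = ((x ^ (p ^ n) - y ^ (p ^ n)) / s ^ Suc n) * (s ^ Suc n / z)"
      using s(1) by simp
    thus ?thesis using main[of n] n0[of "Suc n"] that by (simp only:) (intro V_mult, auto)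
  qed
  thus ?thesis by blast
qed

text \<open>Modulo \<open>mx\<close>, the difference of two p-th powers is the p-th power of the
  difference, and the residue field has no nilpotent elements.\<close>

lemma frobenius_inj:
  assumes "x \<in> V" "y \<in> V" "x ^ (p ^ n) - y ^ (p ^ n) \<in> mx"
  shows "x - y \<in> mx"
  using assms(3)
proof (induction n)
  case (Suc n)
  define a b where "a = x ^ (p ^ n)" and "b = y ^ (p ^ n)"
  have ab: "a \<in> V" "b \<in> V" using assms by (auto simp: a_def b_def V_power)
  from freshman[OF ab] obtain w where w: "w \<in> V" "a ^ p - b ^ p = (a - b) ^ p + of_nat p * (a - b) * w" by blast
  have "a ^ p - b ^ p \<in> mx"
    using Suc.prems by (simp add: a_def b_def power_mult[symmetric] mult.commute)
  moreover have "of_nat p * (a - b) * w \<in> mx"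
    using mx_mult'[OF mx_mult'[OF p_mx V_diff[OF ab]] w(1)] .
  ultimately have "(a - b) ^ p \<in> mx" using w(2) mx_diff by fastforce
  hence "a - b \<in> mx" using mx_power V_diff[OF ab] by blast
  thus ?case using Suc.IH by (simp add: a_def b_def)
qed simp

end

lemma infinite_sequence_repeat:
  fixes f :: "nat \<Rightarrow> 'b"
  assumes "finite A" "\<And>n. f n \<in> A"
  obtains i j where "i < j" "f i = f j"
proof -
  have "\<not> inj f" using assms finite_imageD[of f UNIV] finite_subset[of "range f" A] by blast
  then obtain i j where "i \<noteq> j" "f i = f j" by (auto simp: inj_def)
  thus ?thesis using that by (metis linorder_neqE_nat)
qed

section \<open>Valuation rings of a number field: uniformizers and finite residue fields\<close>

locale nfval = pval V p for V :: "'k::field_char_0 set" and p +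
  assumes nfld: "number_field TYPE('k)"
begin

text \<open>Elements of strictly increasing valuation between a non-unit and \<open>p\<close>. They are linearly independent over
  the rationals, so a longest such chain exists, and it starts with a uniformizer.\<close>

definition steps :: "nat \<Rightarrow> (nat \<Rightarrow> 'k) \<Rightarrow> bool" where
  "steps n x \<longleftrightarrow> (\<forall>i<n. x i \<in> mx \<and> x i \<noteq> 0 \<and> of_nat p / x i \<in> V) \<and> (\<forall>j<n. \<forall>i<j. x j / x i \<in> mx)"

text \<open>A longer chain would satisfy an integral relation with a coefficient prime to
  \<open>p\<close>. Divide it by \<open>x i0\<close> at the first such index: earlier terms carry a
  factor \<open>p\<close>, which \<open>x i0\<close> divides, times a non-unit, and later terms have
  larger valuation, so the unit coefficient at \<open>i0\<close> would lie in
  \<open>mx\<close>.\<close>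

lemma steps_bound: assumes "steps n x" shows "n \<le> nf_degree TYPE('k)"
proof (rule ccontr)
  assume "\<not> n \<le> nf_degree TYPE('k)"
  hence "card {..<n} > nf_degree TYPE('k)" by simp
  from int_relation[OF nfld finite_lessThan this p] obtain c i
    where c: "(\<Sum>i<n. of_int (c i) * x i) = 0" "i < n" "\<not> int p dvd c i" by (metis lessThan_iff)
  define i0 where "i0 = (LEAST i. i < n \<and> \<not> int p dvd c i)"
  have i0: "i0 < n" "\<not> int p dvd c i0" using LeastI[of "\<lambda>i. i < n \<and> \<not> int p dvd c i" i] c by (auto simp: i0_def)
  have lt: "int p dvd c j" if "j < i0" for j using not_less_Least[of j "\<lambda>i. i < n \<and> \<not> int p dvd c i"] that i0(1) by (auto simp: i0_def)
  have x: "x j \<in> mx" "x j \<noteq> 0" "of_nat p / x j \<in> V" if "j < n" for j using assms that by (auto simp: steps_def)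
  have "0 = (\<Sum>i<n. of_int (c i) * x i) / x i0" by (simp add: c(1))
  also have "\<dots> = (\<Sum>i<n. of_int (c i) * (x i / x i0))" by (simp add: sum_divide_distrib)
  also have "\<dots> = of_int (c i0) + (\<Sum>i\<in>{..<n} - {i0}. of_int (c i) * (x i / x i0))"
    using i0(1) x(2)[OF i0(1)] by (subst sum.remove[of _ i0]) auto
  finally have "of_int (c i0) = - (\<Sum>i\<in>{..<n} - {i0}. of_int (c i) * (x i / x i0))"
    by (simp add: eq_neg_iff_add_eq_0)
  also have "\<dots> \<in> mx"
  proof (intro mx_uminus mx_sum)
    fix j assume j: "j \<in> {..<n} - {i0}"
    show "of_int (c j) * (x j / x i0) \<in> mx"
    proof (cases "j < i0")
      case True
      then obtain m where m: "c j = int p * m" using lt by (auto elim: dvdE)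
      have "of_int (c j) * (x j / x i0) = (of_int m * (of_nat p / x i0)) * x j" by (simp add: m)
      also have "\<dots> \<in> mx" using j by (intro mx_mult V_mult V_of_int x(3) x(1) i0(1)) auto
      finally show ?thesis .
    next
      case False
      hence "x j / x i0 \<in> mx" using assms j by (auto simp: steps_def)
      thus ?thesis by (intro mx_mult V_of_int)
    qed
  qed
  finally show False using i0(2) by (simp add: of_int_mx_iff)
qed

text \<open>The single element \<open>p\<close> is a chain, so a longest one exists. A non-unit
  \<open>z\<close> not divisible by its first member could be put in front of it.\<close>

lemma exists_uniformizer: "\<exists>\<pi>. \<pi> \<in> mx \<and> \<pi> \<noteq> 0 \<and> (\<forall>z\<in>mx. z / \<pi> \<in> V)"
proof -
  let ?P = "\<lambda>n. \<exists>x. steps n x"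
  have P1: "?P 1" by (intro exI[of _ "\<lambda>_. of_nat p"]) (simp add: steps_def p_mx V_1)
  have bd: "\<forall>n. ?P n \<longrightarrow> n \<le> nf_degree TYPE('k)" using steps_bound by blast
  define n where "n = (GREATEST n. ?P n)"
  have "?P n" unfolding n_def by (rule GreatestI_nat[of ?P, OF P1]) (use bd in blast)
  then obtain x where x: "steps n x" by blast
  have n1: "n \<ge> 1" unfolding n_def by (rule Greatest_le_nat[of ?P, OF P1]) (use bd in blast)
  have x0: "x 0 \<in> mx" "x 0 \<noteq> 0" "of_nat p / x 0 \<in> V" using x n1 by (auto simp: steps_def)
  have "z / x 0 \<in> V" if z: "z \<in> mx" for z
  proof (rule ccontr)
    assume neg: "z / x 0 \<notin> V"
    hence z0: "z \<noteq> 0" using V_0 by auto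
    have xz: "x 0 / z \<in> mx" using not_in_V[OF neg] by simp
    define y where "y = case_nat z x"
    have "steps (Suc n) y"
      unfolding steps_def
    proof (intro conjI allI impI)
      fix i assume i: "i < Suc n"
      show "y i \<in> mx" "y i \<noteq> 0" using i x z z0 by (auto simp: y_def steps_def split: nat.splits)
      have "of_nat p / z = (of_nat p / x 0) * (x 0 / z)" using x0(2) by simp
      hence "of_nat p / z \<in> V" using x0(3) mx_V[OF xz] V_mult by metis
      thus "of_nat p / y i \<in> V" using i x by (auto simp: y_def steps_def split: nat.splits)
    next
      fix j i assume ji: "j < Suc n" "i < j"
      have "x k / z \<in> mx" if "k < n" for k
      proof (cases "k = 0")
        case False
        hence "x k / x 0 \<in> mx" using x that by (auto simp: steps_def)
        moreover have "x k / z = (x k / x 0) * (x 0 / z)" using x0(2) by simp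
        ultimately show ?thesis using xz mx_mult mx_V by metis
      qed (simp add: xz)
      thus "y j / y i \<in> mx" using ji x by (auto simp: y_def steps_def split: nat.splits)
    qed
    hence "Suc n \<le> n" unfolding n_def by (intro Greatest_le_nat[of ?P]) (use bd in auto)
    thus False by simp
  qed
  thus ?thesis using x0 by blast
qed

definition uni :: 'k where "uni = (SOME \<pi>. \<pi> \<in> mx \<and> \<pi> \<noteq> 0 \<and> (\<forall>z\<in>mx. z / \<pi> \<in> V))"

lemma uni: "uni \<in> mx" "uni \<noteq> 0" "z \<in> mx \<Longrightarrow> z / uni \<in> V"
  using someI_ex[OF exists_uniformizer] by (auto simp: uni_def)

lemma uni_V: "uni \<in> V" using uni(1) mx_V by blast

lemma exists_ord: assumes "x \<in> V" "x \<noteq> 0" shows "\<exists>i. vunit (x / uni ^ i)"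
proof -
  define i where "i = (LEAST i. uni ^ i / x \<in> V)"
  have ex: "\<exists>i. uni ^ i / x \<in> V" using mx_power_div_ge[OF uni(1) assms(2)] by blast
  have i: "uni ^ i / x \<in> V" unfolding i_def by (rule LeastI_ex[OF ex])
  have "x / uni ^ i \<in> V"
  proof (cases i)
    case 0
    thus ?thesis using assms by simp
  next
    case (Suc j)
    hence "uni ^ j / x \<notin> V" using not_less_Least[of j "\<lambda>i. uni ^ i / x \<in> V"] by (auto simp: i_def)
    hence "x / uni ^ j \<in> mx" using not_in_V by fastforce
    from uni(3)[OF this] show ?thesis by (simp add: Suc mult.commute)
  qed
  thus ?thesis using i assms uni(2) by (intro exI[of _ i]) (auto simp: vunit_iff)
qed

text \<open>The ramification index, that is the valuation of \<open>p\<close> when the uniformizer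
  has valuation 1.\<close>

definition ram :: nat where "ram = (SOME e. vunit (of_nat p / uni ^ e))"

lemma ram: "vunit (of_nat p / uni ^ ram)"
  unfolding ram_def by (rule someI_ex[OF exists_ord]) (auto simp: V_of_nat)

lemma ram_pos: "ram > 0"
proof (rule Nat.gr0I)
  assume "ram = 0"
  thus False using ram p_mx by (simp add: vunit_def)
qed

text \<open>Linear independence of residues over the prime field, expressed by integer coefficients
  so that \<open>int_relation\<close> applies.\<close>

definition res_indep :: "nat \<Rightarrow> (nat \<Rightarrow> 'k) \<Rightarrow> bool" where
  "res_indep n b \<longleftrightarrow> (\<forall>i<n. b i \<in> V) \<and> (\<forall>c. (\<Sum>i<n. of_int (c i) * b i) \<in> mx \<longrightarrow> (\<forall>i<n. int p dvd c i))"

lemma res_indep_bound: assumes "res_indep n b" shows "n \<le> nf_degree TYPE('k)"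
proof (rule ccontr)
  assume "\<not> n \<le> nf_degree TYPE('k)"
  hence "card {..<n} > nf_degree TYPE('k)" by simp
  from int_relation[OF nfld finite_lessThan this p] obtain c i
    where c: "(\<Sum>i<n. of_int (c i) * b i) = 0" "i < n" "\<not> int p dvd c i" by (metis lessThan_iff)
  thus False using assms mx_0 by (auto simp: res_indep_def)
qed

text \<open>Finiteness of the residue field: a maximal independent family spans it, and coefficients
  can be reduced to the range from 0 to p - 1.\<close>

lemma residue_basis:
  "\<exists>(n :: nat) b. \<forall>x\<in>V. \<exists>c\<in>{..<n} \<rightarrow>\<^sub>E {0..<int p}. x - (\<Sum>i<n. of_int (c i) * b i) \<in> mx"
proof -
  let ?P = "\<lambda>n. \<exists>b. res_indep n b"
  have P0: "?P 0" by (simp add: res_indep_def)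
  have bd: "\<forall>n. ?P n \<longrightarrow> n \<le> nf_degree TYPE('k)" using res_indep_bound by blast
  define n where "n = (GREATEST n. ?P n)"
  have "?P n" unfolding n_def by (rule GreatestI_nat[of ?P, OF P0]) (use bd in blast)
  then obtain b where b: "res_indep n b" by blast
  have "\<exists>c\<in>{..<n} \<rightarrow>\<^sub>E {0..<int p}. x - (\<Sum>i<n. of_int (c i) * b i) \<in> mx" if x: "x \<in> V" for x
  proof -
    have "\<not> res_indep (Suc n) (b(n := x))"
    proof
      assume "res_indep (Suc n) (b(n := x))"
      hence "Suc n \<le> n" unfolding n_def by (intro Greatest_le_nat[of ?P]) (use bd in auto)
      thus False by simp
    qed
    moreover have "\<forall>i<Suc n. (b(n := x)) i \<in> V" using b x by (auto simp: res_indep_def)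
    ultimately obtain c where "(\<Sum>i<Suc n. of_int (c i) * (b(n := x)) i) \<in> mx" and
      c2: "\<exists>i<Suc n. \<not> int p dvd c i" unfolding res_indep_def by blast
    hence c1: "(\<Sum>i<n. of_int (c i) * b i) + of_int (c n) * x \<in> mx" by simp
    have cn: "\<not> int p dvd c n"
    proof
      assume pn: "int p dvd c n"
      hence "of_int (c n) * x \<in> mx" using of_int_mx mx_mult' x by blast
      from mx_diff[OF c1 this] have "(\<Sum>i<n. of_int (c i) * b i) \<in> mx" by simp
      hence "\<forall>i<n. int p dvd c i" using b by (simp add: res_indep_def)
      thus False using c2 pn by (auto simp: less_Suc_eq)
    qed
    have "coprime (int p) (c n)" using p cn by (simp add: prime_imp_coprime)
    \<comment> \<open>\<open>u\<close> inverts \<open>c n\<close> modulo \<open>p\<close>, so that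
      the relation can be solved for \<open>x\<close>; \<open>a\<close> collects the reduced
      coefficients and \<open>q\<close> the multiples of \<open>p\<close> split off.\<close>
    then obtain u v where uv: "u * c n + v * int p = 1" by (metis bezout_int coprime_iff_gcd_eq_1 gcd.commute)
    define a where "a = restrict (\<lambda>i. (- u * c i) mod int p) {..<n}"
    have aP: "a \<in> {..<n} \<rightarrow>\<^sub>E {0..<int p}" using p_gt_1 by (auto simp: a_def)
    define q where "q = (\<lambda>i. (- u * c i) div int p)"
    have ai: "of_int (a i) = - of_int u * of_int (c i) - of_nat p * (of_int (q i) :: 'k)" if "i < n" for i
    proof -
      have "a i = - u * c i - int p * q i" using that by (simp add: a_def q_def minus_mult_div_eq_mod)
      hence "(of_int (a i) :: 'k) = of_int (- u * c i - int p * q i)" by simp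
      thus ?thesis by simp
    qed
    have "(\<Sum>i<n. of_int (a i) * b i) =
        (\<Sum>i<n. - (of_int u * (of_int (c i) * b i)) - of_nat p * (of_int (q i) * b i))"
      by (intro sum.cong refl) (simp add: ai algebra_simps)
    also have "\<dots> = - (of_int u * (\<Sum>i<n. of_int (c i) * b i)) - of_nat p * (\<Sum>i<n. of_int (q i) * b i)"
      by (simp add: sum_subtractf sum_distrib_left sum_negf)
    finally have sa: "(\<Sum>i<n. of_int (a i) * b i) =
        - (of_int u * (\<Sum>i<n. of_int (c i) * b i)) - of_nat p * (\<Sum>i<n. of_int (q i) * b i)" .
    have "of_int (u * c n + v * int p) = (1 :: 'k)" using uv by simp
    hence "x = of_int u * (of_int (c n) * x) + of_nat p * (of_int v * x)"
      by (metis (no_types, opaque_lifting) distrib_right mult.assoc mult.commute mult_1 of_int_add of_int_mult of_int_of_nat_eq)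
    hence "x - (\<Sum>i<n. of_int (a i) * b i) =
        of_int u * ((\<Sum>i<n. of_int (c i) * b i) + of_int (c n) * x) +
        (of_int v * x + (\<Sum>i<n. of_int (q i) * b i)) * of_nat p"
      unfolding sa by (simp add: algebra_simps)
    also have "\<dots> \<in> mx"
      using b x by (intro mx_add mx_mult V_add V_mult V_sum V_of_int c1 p_mx) (auto simp: res_indep_def)
    finally show ?thesis using aP by blast
  qed
  thus ?thesis by blast
qed

lemma residue_repeat:
  fixes x :: "nat \<Rightarrow> 'k"
  assumes "\<And>n. x n \<in> V"
  obtains i j where "i < j" "x i - x j \<in> mx"
proof -
  obtain n :: nat and b where b: "\<forall>x\<in>V. \<exists>c\<in>{..<n} \<rightarrow>\<^sub>E {0..<int p}. x - (\<Sum>i<n. of_int (c i) * b i) \<in> mx"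
    using residue_basis by (elim exE)
  have "\<forall>k. \<exists>c. c \<in> {..<n} \<rightarrow>\<^sub>E {0..<int p} \<and> x k - (\<Sum>i<n. of_int (c i) * b i) \<in> mx"
    using assms by (auto dest!: b[rule_format])
  from choice[OF this] obtain c where c: "\<And>k. c k \<in> {..<n} \<rightarrow>\<^sub>E {0..<int p}"
    "\<And>k. x k - (\<Sum>i<n. of_int (c k i) * b i) \<in> mx" by blast
  obtain i j where ij: "i < j" "c i = c j"
    by (rule infinite_sequence_repeat[of "{..<n} \<rightarrow>\<^sub>E {0..<int p}" c]) (auto intro!: finite_PiE c(1))
  have "x i - x j \<in> mx" using mx_diff[OF c(2)[of i] c(2)[of j]] ij(2) by simp
  thus ?thesis using that ij(1) by blast
qed

text \<open>Two of the iterated p-th powers of \<open>x\<close> agree in the finite residue field,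
  and injectivity of the Frobenius map cancels the smaller exponent.\<close>

lemma frobenius_fixed:
  assumes x: "x \<in> V"
  obtains r where "r > 0" "x - x ^ (p ^ r) \<in> mx"
proof -
  obtain i j where ij: "i < j" "x ^ (p ^ i) - x ^ (p ^ j) \<in> mx"
    using residue_repeat[of "\<lambda>n. x ^ (p ^ n)"] V_power[OF x] by blast
  have "x ^ (p ^ j) = (x ^ (p ^ (j - i))) ^ (p ^ i)"
    using ij(1) by (simp flip: power_mult power_add)
  hence "x - x ^ (p ^ (j - i)) \<in> mx"
    using frobenius_inj[OF x V_power[OF x], of i "p ^ (j - i)"] ij(2) by simp
  thus ?thesis using that[of "j - i"] ij(1) by simp
qed

lemma frobenius_fixed_iterate:
  assumes x: "x \<in> V" and xr: "x - x ^ (p ^ r) \<in> mx"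
  shows "x - x ^ (p ^ (r * n)) \<in> mx"
proof (induction n)
  case (Suc n)
  have "x ^ (p ^ r) - (x ^ (p ^ (r * n))) ^ (p ^ r) \<in> mx"
  proof -
    have *: "a ^ k - b ^ k \<in> mx" if "a \<in> V" "b \<in> V" "a - b \<in> mx" for a b k
      using that
    proof (induction k)
      case (Suc k)
      have "a ^ Suc k - b ^ Suc k = a * (a ^ k - b ^ k) + b ^ k * (a - b)" by (simp add: algebra_simps)
      thus ?case using Suc by (simp only:) (intro mx_add mx_mult V_power, auto)
    qed (simp add: mx_0)
    show ?thesis by (rule *[OF x V_power[OF x] Suc.IH])
  qed
  moreover have "(x ^ (p ^ (r * n))) ^ (p ^ r) = x ^ (p ^ (r * Suc n))"
    by (simp add: power_add mult.commute flip: power_mult)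
  ultimately show ?case using mx_add[OF xr] by fastforce
qed (simp add: mx_0)

end

section \<open>Restricting a valuation ring along the embeddings\<close>

lemma field_hom_vimage_val_ring:
  assumes "field_hom \<sigma>" "val_ring V"
  shows "val_ring (\<sigma> -` V)"
proof -
  interpret field_hom \<sigma> by fact
  have s: "is_subring V" using assms(2) by (rule val_ring_subring)
  show ?thesis
    using assms(2) is_subring_1[OF s] is_subring_diff[OF s] is_subring_mult[OF s]
    by (auto simp: val_ring_def is_subring_def hom_minus hom_mult hom_inverse)
qed

lemma (in pval) vunit_prod: "(\<And>i. i \<in> I \<Longrightarrow> vunit (f i)) \<Longrightarrow> vunit (prod f I)"
  by (induction I rule: infinite_finite_induct) (auto intro: vunit_1 vunit_mult)

locale local_nf = nf K d + pval V p
  for K :: "'k::field_char_0 itself" and d and V :: "rat alg_closure set" and p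
begin

definition W :: "('k \<Rightarrow> rat alg_closure) \<Rightarrow> 'k set" where "W \<sigma> = \<sigma> -` V"

lemma W_iff: "x \<in> W \<sigma> \<longleftrightarrow> \<sigma> x \<in> V" by (simp add: W_def)

lemma hom_Emb: "\<sigma> \<in> Emb \<Longrightarrow> field_hom \<sigma>" by (simp add: embeddings_def)

lemma nfval_W: assumes "\<sigma> \<in> Emb" shows "nfval (W \<sigma>) p"
proof -
  interpret field_hom \<sigma> by (rule hom_Emb[OF assms])
  have "inverse (of_nat p) \<notin> W \<sigma>" using pV by (simp add: W_iff hom_inverse hom_of_nat)
  thus ?thesis
    using p number_field_algebraic[OF nf] nf field_hom_vimage_val_ring[OF hom_Emb[OF assms] vr]
    by unfold_locales (auto simp: W_def)
qed

lemma mx_W_iff: assumes "\<sigma> \<in> Emb" shows "x \<in> pval.mx (W \<sigma>) \<longleftrightarrow> \<sigma> x \<in> mx"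
proof -
  interpret field_hom \<sigma> by (rule hom_Emb[OF assms])
  interpret w: nfval "W \<sigma>" p by (rule nfval_W[OF assms])
  show ?thesis
    using field_hom_eq_0_iff[OF hom_Emb[OF assms]] by (auto simp: w.mx_def mx_def W_iff hom_inverse)
qed

lemma vunit_W_iff: assumes "\<sigma> \<in> Emb" shows "pval.vunit (W \<sigma>) x \<longleftrightarrow> vunit (\<sigma> x)"
proof -
  interpret w: nfval "W \<sigma>" p by (rule nfval_W[OF assms])
  show ?thesis by (simp add: w.vunit_def vunit_def mx_W_iff[OF assms] W_iff)
qed

lemma alg_int_V: "algebraic_int x \<Longrightarrow> x \<in> V"
  using vr by (rule algebraic_int_in_val_ring[rotated])

lemma alg_int_W: "algebraic_int x \<Longrightarrow> \<sigma> \<in> Emb \<Longrightarrow> x \<in> W \<sigma>"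
  using alg_int_V field_hom_algebraic_int[OF hom_Emb] by (simp add: W_iff)

text \<open>\<open>W \<sigma>\<close> is a localization of the ring of integers. The denominators
  are Horner prefixes \<open>b j\<close> of a relation for \<open>x\<close> that is nonzero modulo
  \<open>p\<close>, since both \<open>b j\<close> and \<open>x * b j\<close> are integral. If no
  prefix were a unit, the recursion \<open>bS\<close> would put all coefficients into
  \<open>mx\<close>.\<close>

lemma W_fraction:
  assumes \<sigma>: "\<sigma> \<in> Emb" and x: "x \<in> W \<sigma>"
  obtains a b where "algebraic_int a" "algebraic_int b" "vunit (\<sigma> b)" "x = a / b"
proof -
  interpret field_hom \<sigma> by (rule hom_Emb[OF \<sigma>])
  obtain q i where q: "poly (map_poly of_int q) x = 0" "\<not> int p dvd poly.coeff q i"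
    using algebraic_primitive[OF number_field_algebraic[OF nf] p] by metis
  define n where "n = degree q"
  have i: "i \<le> n" unfolding n_def using q(2) by (intro le_degree) auto
  define b where "b = (\<lambda>j. \<Sum>i\<le>j. of_int (poly.coeff q (n - i)) * x ^ (j - i))"
  have bi: "algebraic_int (b j)" if "j \<le> n" for j
    using int_poly_scaled_prefix[OF q(1), of j] that by (simp add: b_def n_def)
  have bS: "b (Suc j) = x * b j + of_int (poly.coeff q (n - Suc j))" for j
    by (simp add: b_def sum_distrib_left Suc_diff_le mult_ac)
  have "\<exists>j<n. vunit (\<sigma> (b j))"
  proof (rule ccontr)
    assume neg: "\<not> (\<exists>j<n. vunit (\<sigma> (b j)))"
    have V: "\<sigma> (b j) \<in> V" if "j \<le> n" for j
      using alg_int_V field_hom_algebraic_int[OF hom_Emb[OF \<sigma>] bi[OF that]] by simp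
    have m: "\<sigma> (b j) \<in> mx" if "j < n" for j using neg V[of j] that by (auto simp: vunit_def)
    have "b n = 0"
    proof -
      have "b n = (\<Sum>i\<le>n. of_int (poly.coeff q i) * x ^ i)"
        unfolding b_def by (rule sum.reindex_bij_witness[of _ "\<lambda>i. n - i" "\<lambda>i. n - i"]) auto
      also have "\<dots> = poly (map_poly of_int q) x"
        by (simp add: poly_altdef degree_map_poly coeff_map_poly n_def)
      finally show ?thesis using q(1) by simp
    qed
    hence m': "\<sigma> (b j) \<in> mx" if "j \<le> n" for j
      using that m[of j] by (cases "j = n") (auto simp: mx_0)
    have u: "vunit (of_int (poly.coeff q i))" by (rule vunit_of_int[OF q(2)])
    show False
    proof (cases "i = n")
      case True
      have "\<sigma> (b 0) = of_int (poly.coeff q i)" by (simp add: b_def True hom_of_int)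
      thus False using m'[of 0] u by (simp add: vunit_def)
    next
      case False
      define j where "j = n - Suc i"
      have j: "j < n" "n - Suc j = i" using i False by (auto simp: j_def)
      have "of_int (poly.coeff q i) = b (Suc j) - x * b j" using bS[of j] j(2) by simp
      hence "\<sigma> (of_int (poly.coeff q i)) = \<sigma> (b (Suc j)) - \<sigma> x * \<sigma> (b j)" by (simp only: hom_minus hom_mult)
      hence "of_int (poly.coeff q i) = \<sigma> (b (Suc j)) - \<sigma> x * \<sigma> (b j)" by (simp only: hom_of_int)
      also have "\<dots> \<in> mx" using x j(1) by (intro mx_diff mx_mult m') (auto simp: W_iff)
      finally show False using u by (simp add: vunit_def)
    qed
  qed
  then obtain j where j: "j < n" "vunit (\<sigma> (b j))" by blast
  have bj0: "b j \<noteq> 0" using j(2) by (auto simp: vunit_iff)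
  have "x * b j = b (Suc j) - of_int (poly.coeff q (n - Suc j))" using bS[of j] by simp
  also have "algebraic_int \<dots>" using bi[of "Suc j"] j(1) by (intro algebraic_int_diff) auto
  finally have "algebraic_int (x * b j)" .
  thus ?thesis using that[of "x * b j" "b j"] bi[of j] j bj0 by simp
qed

text \<open>The prime ideal of the ring of integers that lies below \<open>mx\<close> along
  \<open>\<sigma>\<close>.\<close>

definition center :: "('k \<Rightarrow> rat alg_closure) \<Rightarrow> 'k set" where
  "center \<sigma> = {x. algebraic_int x \<and> \<sigma> x \<in> mx}"

text \<open>These primes are maximal because residue fields are finite. If \<open>x\<close> is in
  \<open>center \<sigma>\<close> but not in \<open>center \<tau>\<close>, two powers of
  \<open>x\<close> agree modulo \<open>center \<tau>\<close>, so some 1 - x^k lies in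
  \<open>center \<tau>\<close> and hence in \<open>center \<sigma>\<close>, which then contains
  1.\<close>

lemma center_subset_imp:
  assumes st: "\<sigma> \<in> Emb" "\<tau> \<in> Emb" and sub: "center \<tau> \<subseteq> center \<sigma>"
  shows "center \<sigma> = center \<tau>"
proof (rule ccontr)
  assume "center \<sigma> \<noteq> center \<tau>"
  then obtain x where x: "x \<in> center \<sigma>" "x \<notin> center \<tau>" using sub by blast
  interpret field_hom \<tau> by (rule hom_Emb[OF st(2)])
  interpret s: field_hom \<sigma> by (rule hom_Emb[OF st(1)])
  interpret w: nfval "W \<tau>" p by (rule nfval_W[OF st(2)])
  have xi: "algebraic_int x" using x(1) by (simp add: center_def)
  hence xV: "\<tau> x \<in> V" "\<sigma> x \<in> V" using alg_int_V field_hom_algebraic_int hom_Emb st by blast+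
  hence xu: "vunit (\<tau> x)" using x(2) xi by (simp add: vunit_def center_def)
  obtain i j where ij: "i < j" "x ^ i - x ^ j \<in> w.mx"
    by (rule w.residue_repeat[of "\<lambda>n. x ^ n"]) (rule w.V_power[OF alg_int_W[OF xi st(2)]])
  have "x ^ j = x ^ i * x ^ (j - i)" using ij(1) by (simp flip: power_add)
  hence "x ^ i - x ^ j = x ^ i * (1 - x ^ (j - i))" by (simp add: algebra_simps)
  hence "\<tau> x ^ i * \<tau> (1 - x ^ (j - i)) \<in> mx"
    using ij(2) by (simp add: mx_W_iff[OF st(2)] hom_mult hom_power)
  moreover have "algebraic_int (1 - x ^ (j - i))" using xi by (intro algebraic_int_diff algebraic_int_power) auto
  ultimately have "1 - x ^ (j - i) \<in> center \<tau>"
    using mx_prime[of "\<tau> x ^ i" "\<tau> (1 - x ^ (j - i))"] vunit_power[OF xu, of i] xV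
      alg_int_V[OF field_hom_algebraic_int[OF hom_Emb[OF st(2)]]]
    by (auto simp: center_def vunit_def V_power)
  hence "\<sigma> (1 - x ^ (j - i)) \<in> mx" using sub by (auto simp: center_def)
  moreover have "\<sigma> (x ^ (j - i)) \<in> mx"
  proof -
    have "\<sigma> x \<in> mx" using x(1) by (simp add: center_def)
    hence "\<sigma> x ^ (j - i - 1) * \<sigma> x \<in> mx" using xV by (intro mx_mult V_power)
    moreover have "j - i = Suc (j - i - 1)" using ij(1) by simp
    ultimately show ?thesis by (metis power_Suc2 s.hom_power)
  qed
  ultimately have "\<sigma> (1 - x ^ (j - i)) + \<sigma> (x ^ (j - i)) \<in> mx" by (rule mx_add)
  hence "1 \<in> mx" by (simp add: s.hom_minus)
  thus False using one_not_mx by simp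
qed

lemma center_eq_imp_W_subset:
  assumes st: "\<sigma> \<in> Emb" "\<tau> \<in> Emb" and eq: "center \<sigma> = center \<tau>"
  shows "W \<sigma> \<subseteq> W \<tau>"
proof
  fix x assume "x \<in> W \<sigma>"
  then obtain a b where ab: "algebraic_int a" "algebraic_int b" "vunit (\<sigma> b)" "x = a / b"
    using W_fraction[OF st(1)] by metis
  interpret field_hom \<tau> by (rule hom_Emb[OF st(2)])
  have "b \<notin> center \<sigma>" using ab by (simp add: center_def vunit_def)
  hence "vunit (\<tau> b)" using eq ab(2) alg_int_W[OF ab(2) st(2)] by (auto simp: center_def vunit_def W_iff)
  thus "x \<in> W \<tau>"
    using alg_int_W[OF ab(1) st(2)] by (simp add: ab(4) W_iff hom_div divide_inverse V_mult vunit_iff hom_inverse hom_mult)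
qed

lemma center_eq_imp_W_eq: "\<sigma> \<in> Emb \<Longrightarrow> \<tau> \<in> Emb \<Longrightarrow> center \<sigma> = center \<tau> \<Longrightarrow> W \<sigma> = W \<tau>"
  using center_eq_imp_W_subset by (metis subset_antisym)

text \<open>Equality of the residue maps into the residue field of \<open>V\<close>. By
  \<open>eqv_imp_W_eq\<close> it refines equality of the pullbacks: a class records the prime
  together with an embedding of its residue field.\<close>

definition eqv :: "('k \<Rightarrow> rat alg_closure) \<Rightarrow> ('k \<Rightarrow> rat alg_closure) \<Rightarrow> bool" where
  "eqv \<sigma> \<tau> \<longleftrightarrow> (\<forall>x. algebraic_int x \<longrightarrow> \<sigma> x - \<tau> x \<in> mx)"

lemma eqv_refl: "eqv \<sigma> \<sigma>" by (simp add: eqv_def mx_0)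

lemma eqv_sym: "eqv \<sigma> \<tau> \<Longrightarrow> eqv \<tau> \<sigma>"
  unfolding eqv_def using mx_uminus by (metis minus_diff_eq)

lemma eqv_trans: "eqv \<sigma> \<tau> \<Longrightarrow> eqv \<tau> \<rho> \<Longrightarrow> eqv \<sigma> \<rho>"
  unfolding eqv_def using mx_add by (metis diff_add_cancel add_diff_eq)

lemma eqv_imp_W_eq:
  assumes "\<sigma> \<in> Emb" "\<tau> \<in> Emb" "eqv \<sigma> \<tau>"
  shows "W \<sigma> = W \<tau>"
proof -
  have "\<sigma> x \<in> mx \<longleftrightarrow> \<tau> x \<in> mx" if "algebraic_int x" for x
  proof -
    have 1: "\<sigma> x - \<tau> x \<in> mx" "\<tau> x - \<sigma> x \<in> mx"
      using assms(3) eqv_sym[OF assms(3)] that by (auto simp: eqv_def)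
    show ?thesis using mx_add[OF 1(1), of "\<tau> x"] mx_add[OF 1(2), of "\<sigma> x"] by auto
  qed
  hence "center \<sigma> = center \<tau>" by (auto simp: center_def)
  thus ?thesis using center_eq_imp_W_eq assms by blast
qed

lemma eqv_W:
  assumes st: "\<sigma> \<in> Emb" "\<tau> \<in> Emb" "eqv \<sigma> \<tau>" and x: "x \<in> W \<sigma>"
  shows "\<sigma> x - \<tau> x \<in> mx"
proof -
  obtain a b where ab: "algebraic_int a" "algebraic_int b" "vunit (\<sigma> b)" "x = a / b"
    using W_fraction[OF st(1) x] by metis
  interpret field_hom \<tau> by (rule hom_Emb[OF st(2)])
  interpret s: field_hom \<sigma> by (rule hom_Emb[OF st(1)])
  have da: "\<sigma> a - \<tau> a \<in> mx" and db: "\<sigma> b - \<tau> b \<in> mx" "\<tau> b - \<sigma> b \<in> mx"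
    using st(3) eqv_sym[OF st(3)] ab by (auto simp: eqv_def)
  have tb: "vunit (\<tau> b)" using vunit_add_mx[OF ab(3) db(2)] by simp
  have V: "\<sigma> a \<in> V" "\<tau> b \<in> V" "\<sigma> b \<in> V" using ab st tb alg_int_W by (auto simp: W_iff vunit_def)
  have nz: "\<sigma> b \<noteq> 0" "\<tau> b \<noteq> 0" using ab(3) tb by (auto simp: vunit_iff)
  have "\<sigma> x - \<tau> x = (inverse (\<sigma> b) * inverse (\<tau> b)) * (\<sigma> b * (\<sigma> a - \<tau> a) - \<sigma> a * (\<sigma> b - \<tau> b))"
    using nz by (simp add: ab(4) hom_div s.hom_div field_simps)
  also have "\<dots> \<in> mx"
  proof -
    have "inverse (\<sigma> b) * inverse (\<tau> b) \<in> V" using ab(3) tb by (intro V_mult) (auto simp: vunit_iff)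
    thus ?thesis by (rule mx_mult[OF _ mx_diff[OF mx_mult[OF V(3) da] mx_mult[OF V(1) db(1)]]])
  qed
  finally show ?thesis .
qed

text \<open>The choice depends on the pullback ring only, so all embeddings with the same ring share
  the uniformizer and the ramification index.\<close>

definition unif :: "'k set \<Rightarrow> 'k" where "unif w = nfval.uni w"
definition ramif :: "'k set \<Rightarrow> nat" where "ramif w = nfval.ram w p"

lemma unif_0: "\<sigma> \<in> Emb \<Longrightarrow> unif (W \<sigma>) \<noteq> 0"
  using nfval.uni(2)[OF nfval_W] by (simp add: unif_def)

lemma hom_unif_0: "\<sigma> \<in> Emb \<Longrightarrow> \<tau> \<in> Emb \<Longrightarrow> \<tau> (unif (W \<sigma>)) \<noteq> 0"
  using unif_0 field_hom_eq_0_iff[OF hom_Emb] by blast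

lemma hom_unif_V: "\<sigma> \<in> Emb \<Longrightarrow> \<sigma> (unif (W \<sigma>)) \<in> V"
  using nfval.uni_V[OF nfval_W, of \<sigma>] by (simp add: unif_def W_iff)

lemma ramif_vunit: assumes "\<sigma> \<in> Emb" shows "vunit (of_nat p / \<sigma> (unif (W \<sigma>)) ^ ramif (W \<sigma>))"
proof -
  interpret field_hom \<sigma> by (rule hom_Emb[OF assms])
  show ?thesis
    using nfval.ram[OF nfval_W[OF assms]] vunit_W_iff[OF assms]
    by (simp add: unif_def ramif_def hom_div hom_power hom_of_nat)
qed

lemma ramif_pos: "\<sigma> \<in> Emb \<Longrightarrow> ramif (W \<sigma>) > 0"
  using nfval.ram_pos[OF nfval_W] by (simp add: ramif_def)

lemma V_of_power: assumes "y ^ n \<in> V" "n > 0" shows "y \<in> V"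
proof (rule ccontr)
  assume y: "y \<notin> V"
  hence i: "inverse y \<in> mx" by (rule not_in_V)
  have y0: "y \<noteq> 0" using y V_0 by auto
  have "inverse y ^ n \<in> mx"
  proof -
    have "inverse y ^ n = inverse y ^ (n - 1) * inverse y" using assms(2) by (cases n) auto
    thus ?thesis using i mx_V by (simp only:) (intro mx_mult V_power, auto)
  qed
  from mx_mult[OF assms(1) this] have "1 \<in> mx" using y0 by (simp flip: power_mult_distrib)
  thus False using one_not_mx by simp
qed

text \<open>Both images, raised to the ramification index, equal \<open>p\<close> up to units of
  \<open>V\<close>; so a power of the ratio is a unit and the ratio itself lies in
  \<open>V\<close>.\<close>

lemma unif_ratio:
  assumes st: "\<sigma> \<in> Emb" "\<tau> \<in> Emb" "W \<sigma> = W \<tau>"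
  shows "\<tau> (unif (W \<sigma>)) / \<sigma> (unif (W \<sigma>)) \<in> V"
proof (rule V_of_power)
  let ?\<pi> = "unif (W \<sigma>)" and ?e = "ramif (W \<sigma>)"
  have u: "vunit (of_nat p / \<sigma> ?\<pi> ^ ?e)" "vunit (of_nat p / \<tau> ?\<pi> ^ ?e)"
    using ramif_vunit[OF st(1)] ramif_vunit[OF st(2)] st(3) by simp_all
  have "(\<tau> ?\<pi> / \<sigma> ?\<pi>) ^ ?e = (of_nat p / \<sigma> ?\<pi> ^ ?e) / (of_nat p / \<tau> ?\<pi> ^ ?e)"
    by (simp add: power_divide)
  thus "(\<tau> ?\<pi> / \<sigma> ?\<pi>) ^ ?e \<in> V" using vunit_divide[OF u] by (simp add: vunit_def)
  show "?e > 0" by (rule ramif_pos[OF st(1)])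
qed

text \<open>The constant coefficient is \<open>\<sigma> x ^ M\<close> for a suitable power
  \<open>M\<close> of \<open>p\<close>, an approximate Teichmueller representative. It is congruent
  to \<open>\<tau> x ^ M\<close> to precision N + 1 for every \<open>\<tau>\<close> in the class,
  and x - x^M is divisible by the uniformizer; the quotient is expanded by induction.\<close>

theorem class_expansion:
  assumes \<sigma>: "\<sigma> \<in> Emb" and x: "x \<in> W \<sigma>"
  shows "\<exists>c. (\<forall>t. c t \<in> V) \<and> (\<forall>\<tau>\<in>Emb. eqv \<sigma> \<tau> \<longrightarrow>
    (\<tau> x - (\<Sum>t<N. c t * \<tau> (unif (W \<sigma>)) ^ t)) / \<sigma> (unif (W \<sigma>)) ^ N \<in> V)"
  using x
proof (induction N arbitrary: x)
  case 0
  have "\<tau> x \<in> V" if "\<tau> \<in> Emb" "eqv \<sigma> \<tau>" for \<tau>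
    using eqv_imp_W_eq[OF \<sigma> that] 0 by (simp add: W_iff set_eq_iff)
  thus ?case by (intro exI[of _ "\<lambda>_. 0"]) (auto simp: V_0)
next
  case (Suc N)
  interpret w: nfval "W \<sigma>" p by (rule nfval_W[OF \<sigma>])
  let ?\<pi> = "unif (W \<sigma>)"
  define z where "z = \<sigma> ?\<pi> ^ Suc N"
  have z0: "z \<noteq> 0" using hom_unif_0[OF \<sigma> \<sigma>] by (simp add: z_def)
  define C where "C = {\<tau> \<in> Emb. eqv \<sigma> \<tau>}"
  have fC: "finite C" using fin_Emb by (simp add: C_def)
  have CV: "\<tau> x \<in> V" if "\<tau> \<in> C" for \<tau>
    using eqv_imp_W_eq[OF \<sigma>, of \<tau>] that Suc.prems by (auto simp: W_iff set_eq_iff C_def)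
  have "\<forall>\<tau>\<in>C. \<exists>n0. \<forall>n\<ge>n0. (\<tau> x ^ (p ^ n) - \<sigma> x ^ (p ^ n)) / z \<in> V"
  proof
    fix \<tau> assume t: "\<tau> \<in> C"
    have "\<tau> x - \<sigma> x \<in> mx" using mx_uminus[OF eqv_W[OF \<sigma> _ _ Suc.prems, of \<tau>]] t by (simp add: C_def)
    thus "\<exists>n0. \<forall>n\<ge>n0. (\<tau> x ^ (p ^ n) - \<sigma> x ^ (p ^ n)) / z \<in> V"
      using frobenius_congr[OF CV[OF t] _ _ z0, of "\<sigma> x"] Suc.prems by (simp add: W_iff)
  qed
  from bchoice[OF this] obtain n0 where n0: "\<And>\<tau> n. \<tau> \<in> C \<Longrightarrow> n \<ge> n0 \<tau> \<Longrightarrow> (\<tau> x ^ (p ^ n) - \<sigma> x ^ (p ^ n)) / z \<in> V"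
    by blast
  \<comment> \<open>A sum serves as a common upper bound for the finitely many thresholds.\<close>
  define n where "n = (\<Sum>\<tau>\<in>C. n0 \<tau>)"
  have nge: "n0 \<tau> \<le> n" if "\<tau> \<in> C" for \<tau> unfolding n_def using fC that by (intro member_le_sum) auto
  obtain r where r: "r > 0" "x - x ^ (p ^ r) \<in> w.mx" using w.frobenius_fixed[OF Suc.prems] by blast
  \<comment> \<open>A multiple of the period \<open>r\<close> keeps x^M congruent to
    \<open>x\<close>; since r > 0, the exponent r n is also beyond every threshold.\<close>
  define M where "M = p ^ (r * n)"
  have "x - x ^ M \<in> w.mx" unfolding M_def by (rule w.frobenius_fixed_iterate[OF Suc.prems r(2)])
  hence yW: "(x - x ^ M) / ?\<pi> \<in> W \<sigma>" using w.uni(3) by (simp add: unif_def)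
  define y where "y = (x - x ^ M) / ?\<pi>"
  from Suc.IH[OF yW] obtain c where c: "\<And>t. c t \<in> V"
    "\<And>\<tau>. \<tau> \<in> C \<Longrightarrow> (\<tau> y - (\<Sum>t<N. c t * \<tau> ?\<pi> ^ t)) / \<sigma> ?\<pi> ^ N \<in> V"
    by (auto simp: C_def y_def)
  define c' where "c' = case_nat (\<sigma> x ^ M) c"
  have "(\<tau> x - (\<Sum>t<Suc N. c' t * \<tau> ?\<pi> ^ t)) / z \<in> V" if t: "\<tau> \<in> C" for \<tau>
  proof -
    have tE: "\<tau> \<in> Emb" "eqv \<sigma> \<tau>" using t by (auto simp: C_def)
    interpret field_hom \<tau> by (rule hom_Emb[OF tE(1)])
    have p0: "\<tau> ?\<pi> \<noteq> 0" "\<sigma> ?\<pi> \<noteq> 0" using hom_unif_0 \<sigma> tE by auto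
    have "\<tau> x = \<tau> x ^ M + \<tau> ?\<pi> * \<tau> y"
      using p0 by (simp add: y_def hom_div hom_minus hom_power)
    moreover have "(\<Sum>t<Suc N. c' t * \<tau> ?\<pi> ^ t) = \<sigma> x ^ M + \<tau> ?\<pi> * (\<Sum>t<N. c t * \<tau> ?\<pi> ^ t)"
      unfolding sum.lessThan_Suc_shift by (simp add: c'_def sum_distrib_left mult_ac)
    ultimately have "\<tau> x - (\<Sum>t<Suc N. c' t * \<tau> ?\<pi> ^ t) =
        (\<tau> x ^ M - \<sigma> x ^ M) + \<tau> ?\<pi> * (\<tau> y - (\<Sum>t<N. c t * \<tau> ?\<pi> ^ t))"
      by (simp add: algebra_simps)
    hence "(\<tau> x - (\<Sum>t<Suc N. c' t * \<tau> ?\<pi> ^ t)) / z =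
        (\<tau> x ^ M - \<sigma> x ^ M) / z + (\<tau> ?\<pi> / \<sigma> ?\<pi>) * ((\<tau> y - (\<Sum>t<N. c t * \<tau> ?\<pi> ^ t)) / \<sigma> ?\<pi> ^ N)"
      by (simp add: add_divide_distrib z_def)
    moreover have "(\<tau> x ^ M - \<sigma> x ^ M) / z \<in> V"
    proof -
      have "1 * n \<le> r * n" using r(1) by (intro mult_right_mono) auto
      hence "n0 \<tau> \<le> r * n" using nge[OF t] by linarith
      from n0[OF t this] show ?thesis by (simp only: M_def)
    qed
    moreover have "\<tau> ?\<pi> / \<sigma> ?\<pi> \<in> V" by (rule unif_ratio[OF \<sigma> tE(1) eqv_imp_W_eq[OF \<sigma> tE]])
    ultimately show ?thesis using V_add[OF _ V_mult[OF _ c(2)[OF t]]] by (simp only:)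
  qed
  moreover have "c' t \<in> V" for t
    using c(1) Suc.prems by (auto simp: c'_def W_iff V_power split: nat.splits)
  ultimately show ?case by (intro exI[of _ c']) (auto simp: C_def z_def)
qed

text \<open>Distinct pullbacks have distinct centers, none containing another, so for each other
  ring some integer lies in its center but not in that of \<open>\<sigma>\<close>. The product of
  these works.\<close>

lemma exists_separator:
  assumes \<sigma>: "\<sigma> \<in> Emb"
  obtains \<epsilon> where "algebraic_int \<epsilon>" "vunit (\<sigma> \<epsilon>)" "\<And>\<tau>. \<tau> \<in> Emb \<Longrightarrow> W \<tau> \<noteq> W \<sigma> \<Longrightarrow> \<tau> \<epsilon> \<in> mx"
proof -
  define B where "B = {\<tau> \<in> Emb. W \<tau> \<noteq> W \<sigma>}"
  have fB: "finite B" using fin_Emb by (simp add: B_def)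
  have "\<forall>\<tau>\<in>B. \<exists>a. a \<in> center \<tau> \<and> a \<notin> center \<sigma>"
    using center_subset_imp[OF \<sigma>] center_eq_imp_W_eq[OF \<sigma>] by (fastforce simp: B_def)
  from bchoice[OF this] obtain a where a: "\<And>\<tau>. \<tau> \<in> B \<Longrightarrow> a \<tau> \<in> center \<tau> \<and> a \<tau> \<notin> center \<sigma>" by blast
  have ai: "algebraic_int (a \<tau>)" if "\<tau> \<in> B" for \<tau> using a[OF that] by (simp add: center_def)
  show ?thesis
  proof (rule that[of "\<Prod>\<tau>\<in>B. a \<tau>"])
    show "algebraic_int (\<Prod>\<tau>\<in>B. a \<tau>)" using ai by (rule algebraic_int_prod)
    interpret field_hom \<sigma> by (rule hom_Emb[OF \<sigma>])
    have "vunit (\<sigma> (a \<tau>))" if "\<tau> \<in> B" for \<tau>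
      using a[OF that] ai[OF that] alg_int_W[OF ai[OF that] \<sigma>] by (auto simp: center_def vunit_def W_iff)
    hence "vunit (\<Prod>\<tau>\<in>B. \<sigma> (a \<tau>))" by (rule vunit_prod)
    thus "vunit (\<sigma> (\<Prod>\<tau>\<in>B. a \<tau>))" by (simp add: hom_prod)
  next
    fix \<tau> assume "\<tau> \<in> Emb" "W \<tau> \<noteq> W \<sigma>"
    hence t: "\<tau> \<in> B" "\<tau> \<in> Emb" by (auto simp: B_def)
    interpret field_hom \<tau> by (rule hom_Emb[OF t(2)])
    have "\<tau> (\<Prod>\<tau>\<in>B. a \<tau>) = (\<Prod>\<rho>\<in>B - {\<tau>}. \<tau> (a \<rho>)) * \<tau> (a \<tau>)"
      using fB t(1) by (simp add: hom_prod prod.remove[of B \<tau>] mult.commute hom_mult)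
    also have "\<dots> \<in> mx"
      using a[OF t(1)] ai alg_int_W[OF ai t(2)] by (intro mx_mult V_prod) (auto simp: center_def W_iff)
    finally show "\<tau> (\<Prod>\<tau>\<in>B. a \<tau>) \<in> mx" .
  qed
qed

definition \<W> :: "'k set set" where "\<W> = W ` Emb"

lemma finite_\<W>: "finite \<W>" by (simp add: \<W>_def fin_Emb)

lemma \<W>_nfval: "w \<in> \<W> \<Longrightarrow> nfval w p" using nfval_W by (auto simp: \<W>_def)

lemma separators:
  obtains \<epsilon> where "\<And>w. w \<in> \<W> \<Longrightarrow> algebraic_int (\<epsilon> w)" "\<And>w. w \<in> \<W> \<Longrightarrow> pval.vunit w (\<epsilon> w)"
    "\<And>w w'. w \<in> \<W> \<Longrightarrow> w' \<in> \<W> \<Longrightarrow> w' \<noteq> w \<Longrightarrow> \<epsilon> w \<in> pval.mx w'"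
proof -
  have "\<forall>w\<in>\<W>. \<exists>\<epsilon>. algebraic_int \<epsilon> \<and> pval.vunit w \<epsilon> \<and> (\<forall>w'\<in>\<W>. w' \<noteq> w \<longrightarrow> \<epsilon> \<in> pval.mx w')"
  proof
    fix w assume "w \<in> \<W>"
    then obtain \<sigma> where s: "\<sigma> \<in> Emb" "w = W \<sigma>" by (auto simp: \<W>_def)
    obtain \<epsilon> where "algebraic_int \<epsilon>" "vunit (\<sigma> \<epsilon>)" "\<And>\<tau>. \<tau> \<in> Emb \<Longrightarrow> W \<tau> \<noteq> W \<sigma> \<Longrightarrow> \<tau> \<epsilon> \<in> mx"
      using exists_separator[OF s(1)] by metis
    thus "\<exists>\<epsilon>. algebraic_int \<epsilon> \<and> pval.vunit w \<epsilon> \<and> (\<forall>w'\<in>\<W>. w' \<noteq> w \<longrightarrow> \<epsilon> \<in> pval.mx w')"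
      using s by (intro exI[of _ \<epsilon>]) (auto simp: vunit_W_iff mx_W_iff \<W>_def)
  qed
  from bchoice[OF this] show ?thesis using that by blast
qed

text \<open>A weak approximation: a high power of a separator is divisible in the ring w' by each of
  the finitely many elements in \<open>Q w w'\<close>, and one exponent serves all of them.\<close>

lemma separators_power:
  fixes Q :: "('k set \<Rightarrow> 'k set \<Rightarrow> 'k set)"
  assumes Q: "\<And>w w'. finite (Q w w')" and Q0: "\<And>w w'. 0 \<notin> Q w w'"
  obtains \<delta> where "\<And>w. w \<in> \<W> \<Longrightarrow> algebraic_int (\<delta> w)" "\<And>w. w \<in> \<W> \<Longrightarrow> pval.vunit w (\<delta> w)"
    "\<And>w w' x. w \<in> \<W> \<Longrightarrow> w' \<in> \<W> \<Longrightarrow> w' \<noteq> w \<Longrightarrow> x \<in> Q w w' \<Longrightarrow> \<delta> w / x \<in> w'"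
proof -
  obtain \<epsilon> where e: "\<And>w. w \<in> \<W> \<Longrightarrow> algebraic_int (\<epsilon> w)" "\<And>w. w \<in> \<W> \<Longrightarrow> pval.vunit w (\<epsilon> w)"
    "\<And>w w'. w \<in> \<W> \<Longrightarrow> w' \<in> \<W> \<Longrightarrow> w' \<noteq> w \<Longrightarrow> \<epsilon> w \<in> pval.mx w'" using separators by blast
  define Y where "Y = (SIGMA w:\<W>. SIGMA w':\<W> - {w}. Q w w')"
  have fY: "finite Y" unfolding Y_def using finite_\<W> Q by (intro finite_SigmaI) auto
  have "\<forall>y\<in>Y. \<exists>n. \<forall>m\<ge>n. \<epsilon> (fst y) ^ m / snd (snd y) \<in> fst (snd y)"
  proof
    fix y assume "y \<in> Y"
    then obtain w w' x where y: "y = (w, w', x)" "w \<in> \<W>" "w' \<in> \<W>" "w' \<noteq> w" "x \<in> Q w w'" by (auto simp: Y_def)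
    interpret w': nfval w' p by (rule \<W>_nfval[OF y(3)])
    have "x \<noteq> 0" using y(5) Q0[of w w'] by blast
    from w'.mx_power_div_ge[OF e(3)[OF y(2-4)] this]
    show "\<exists>n. \<forall>m\<ge>n. \<epsilon> (fst y) ^ m / snd (snd y) \<in> fst (snd y)" by (simp add: y(1))
  qed
  from bchoice[OF this] obtain n where n: "\<And>y m. y \<in> Y \<Longrightarrow> m \<ge> n y \<Longrightarrow> \<epsilon> (fst y) ^ m / snd (snd y) \<in> fst (snd y)" by blast
  define m where "m = (\<Sum>y\<in>Y. n y)"
  have m: "n y \<le> m" if "y \<in> Y" for y unfolding m_def using fY that by (intro member_le_sum) auto
  show ?thesis
  proof (rule that[of "\<lambda>w. \<epsilon> w ^ m"])
    fix w assume w: "w \<in> \<W>"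
    show "algebraic_int (\<epsilon> w ^ m)" by (rule algebraic_int_power[OF e(1)[OF w]])
    interpret w: nfval w p by (rule \<W>_nfval[OF w])
    show "pval.vunit w (\<epsilon> w ^ m)" by (rule w.vunit_power[OF e(2)[OF w]])
    fix w' x assume "w' \<in> \<W>" "w' \<noteq> w" "x \<in> Q w w'"
    hence "(w, w', x) \<in> Y" using w by (simp add: Y_def)
    from n[OF this m[OF this]] show "\<epsilon> w ^ m / x \<in> w'" by simp
  qed
qed

end

section \<open>Local generators and ramification\<close>

lemma homogeneous_system_solution:
  fixes M :: "'b \<Rightarrow> nat \<Rightarrow> 'a::field"
  assumes "finite A" "card A > f"
  shows "\<exists>c. (\<forall>j<f. (\<Sum>s\<in>A. c s * M s j) = 0) \<and> (\<exists>s\<in>A. c s \<noteq> 0)"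
  using assms
proof (induction f arbitrary: A M)
  case 0
  hence "A \<noteq> {}" by auto
  thus ?case by (intro exI[of _ "\<lambda>_. 1"]) auto
next
  case (Suc f)
  show ?case
  proof (cases "\<forall>s\<in>A. M s f = 0")
    case True
    from Suc.IH[OF Suc.prems(1), of M] Suc.prems(2) obtain c where
      c: "\<forall>j<f. (\<Sum>s\<in>A. c s * M s j) = 0" "\<exists>s\<in>A. c s \<noteq> 0" by auto
    moreover have "(\<Sum>s\<in>A. c s * M s f) = 0" using True by simp
    ultimately show ?thesis by (intro exI[of _ c]) (auto simp: less_Suc_eq)
  next
    case False
    then obtain s0 where s0: "s0 \<in> A" "M s0 f \<noteq> 0" by blast
    define M' where "M' = (\<lambda>s j. M s j - M s f / M s0 f * M s0 j)"
    have "card (A - {s0}) > f" using Suc.prems s0(1) by simp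
    from Suc.IH[OF _ this, of M'] Suc.prems(1) obtain c where
      c: "\<forall>j<f. (\<Sum>s\<in>A - {s0}. c s * M' s j) = 0" "\<exists>s\<in>A - {s0}. c s \<noteq> 0" by auto
    define c0 where "c0 = - (\<Sum>s\<in>A - {s0}. c s * (M s f / M s0 f))"
    define c' where "c' = c(s0 := c0)"
    have split: "(\<Sum>s\<in>A. c' s * M s j) = c0 * M s0 j + (\<Sum>s\<in>A - {s0}. c s * M s j)" for j
    proof -
      have "(\<Sum>s\<in>A. c' s * M s j) = c' s0 * M s0 j + (\<Sum>s\<in>A - {s0}. c' s * M s j)"
        using Suc.prems(1) s0(1) by (rule sum.remove)
      also have "(\<Sum>s\<in>A - {s0}. c' s * M s j) = (\<Sum>s\<in>A - {s0}. c s * M s j)"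
        by (intro sum.cong) (auto simp: c'_def)
      finally show ?thesis by (simp add: c'_def)
    qed
    have eq: "(\<Sum>s\<in>A. c' s * M s j) = (\<Sum>s\<in>A - {s0}. c s * M' s j)" for j
      unfolding split M'_def c0_def
      by (simp add: right_diff_distrib sum_subtractf sum_distrib_right mult.assoc)
    have "(\<Sum>s\<in>A. c' s * M s j) = 0" if "j < Suc f" for j
    proof (cases "j < f")
      case True
      thus ?thesis using c(1) eq by simp
    next
      case False
      hence "j = f" using that by simp
      thus ?thesis using s0(2) by (simp add: eq M'_def)
    qed
    moreover have "\<exists>s\<in>A. c' s \<noteq> 0" using c(2) by (auto simp: c'_def)
    ultimately show ?thesis by blast
  qed
qed

context pval
begin

lemma exists_dominant:
  assumes "finite A" "\<exists>s\<in>A. c s \<noteq> 0"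
  shows "\<exists>s0\<in>A. c s0 \<noteq> 0 \<and> (\<forall>s\<in>A. c s / c s0 \<in> V)"
  using assms
proof (induction A rule: finite_induct)
  case (insert a A)
  show ?case
  proof (cases "\<exists>s\<in>A. c s \<noteq> 0")
    case False
    hence "c a \<noteq> 0" "\<forall>s\<in>A. c s = 0" using insert.prems by auto
    thus ?thesis by (intro bexI[of _ a]) (auto simp: V_0 V_1)
  next
    case True
    then obtain s0 where s0: "s0 \<in> A" "c s0 \<noteq> 0" "\<forall>s\<in>A. c s / c s0 \<in> V" using insert.IH by blast
    show ?thesis
    proof (cases "c a / c s0 \<in> V")
      case True
      thus ?thesis using s0 by (intro bexI[of _ s0]) auto
    next
      case False
      hence a0: "c a \<noteq> 0" using V_0 by auto
      have 1: "c s0 / c a \<in> V" using not_in_V[OF False] mx_V by fastforce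
      have "c s / c a \<in> V" if "s \<in> A" for s
      proof -
        have "c s / c a = (c s / c s0) * (c s0 / c a)" using s0(2) by simp
        thus ?thesis using s0(3) that 1 by (simp only:) (intro V_mult, auto)
      qed
      thus ?thesis using a0 by (intro bexI[of _ a]) (auto simp: V_1)
    qed
  qed
qed auto

end

context nfval
begin

lemma exists_minimal:
  assumes I: "I \<subseteq> V" and z: "z \<in> I" "z \<noteq> 0"
  shows "\<exists>x\<in>I. x \<noteq> 0 \<and> (\<forall>y\<in>I. y / x \<in> V)"
proof -
  define P where "P = (\<lambda>i. \<exists>x\<in>I. x \<noteq> 0 \<and> vunit (x / uni ^ i))"
  have ex: "\<exists>i. P i" using exists_ord[of z] z I by (auto simp: P_def)
  define i where "i = (LEAST i. P i)"
  have "P i" unfolding i_def by (rule LeastI_ex[OF ex])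
  then obtain x where x: "x \<in> I" "x \<noteq> 0" "vunit (x / uni ^ i)" by (auto simp: P_def)
  have "y / x \<in> V" if y: "y \<in> I" for y
  proof (cases "y = 0")
    case False
    then obtain j where j: "vunit (y / uni ^ j)" using exists_ord[of y] y I by auto
    hence "P j" using y False by (auto simp: P_def)
    hence ij: "i \<le> j" unfolding i_def by (rule Least_le)
    have "y / x = (y / uni ^ j) * uni ^ (j - i) * inverse (x / uni ^ i)"
      using uni(2) ij by (simp add: power_diff field_simps)
    also have "\<dots> \<in> V" using j x(3) uni_V by (intro V_mult V_power) (auto simp: vunit_iff)
    finally show ?thesis .
  qed (simp add: V_0)
  thus ?thesis using x by blast
qed

end

context local_nf
begin

lemma \<W>_nonempty: "\<W> \<noteq> {}"
  using card_Emb d_pos by (auto simp: \<W>_def)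

text \<open>One element generates the ideal at all rings in \<open>\<W>\<close> simultaneously.
  Elements \<open>x w\<close> of least valuation are glued with separators: at \<open>w\<close> the
  term \<open>\<delta> w * x w\<close> dominates, so \<open>y\<close> has the valuation of
  \<open>x w\<close>.\<close>

theorem ideal_minimal_element:
  assumes I: "ideal (I :: 'k set) ring_of_integers" "I \<noteq> {0}"
  obtains y where "y \<in> I" "y \<noteq> 0" "\<And>\<sigma> x. \<sigma> \<in> Emb \<Longrightarrow> x \<in> I \<Longrightarrow> x / y \<in> W \<sigma>"
proof -
  obtain z where z: "z \<in> I" "z \<noteq> 0" using I(2) ideal_0[OF I(1)] by blast
  have "\<forall>w. \<exists>x. x \<noteq> 0 \<and> (w \<in> \<W> \<longrightarrow> x \<in> I \<and> (\<forall>y\<in>I. y / x \<in> w))"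
  proof
    fix w
    show "\<exists>x. x \<noteq> 0 \<and> (w \<in> \<W> \<longrightarrow> x \<in> I \<and> (\<forall>y\<in>I. y / x \<in> w))"
    proof (cases "w \<in> \<W>")
      case True
      interpret w: nfval w p by (rule \<W>_nfval[OF True])
      have "I \<subseteq> w" using ideal_alg_int[OF I(1)] algebraic_int_in_val_ring[OF _ w.vr] by blast
      from w.exists_minimal[OF this z] show ?thesis by blast
    qed (auto intro: exI[of _ 1])
  qed
  from choice[OF this] obtain x where x: "\<And>w. x w \<noteq> 0" "\<And>w. w \<in> \<W> \<Longrightarrow> x w \<in> I"
    "\<And>w y. w \<in> \<W> \<Longrightarrow> y \<in> I \<Longrightarrow> y / x w \<in> w" by blast
  \<comment> \<open>The demanded divisor makes \<open>\<delta> w * x w / x w'\<close> a multiple of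
    \<open>p\<close> in w', so foreign terms cannot disturb the unit \<open>\<delta> w'\<close>
    there.\<close>
  obtain \<delta> where \<delta>: "\<And>w. w \<in> \<W> \<Longrightarrow> algebraic_int (\<delta> w)" "\<And>w. w \<in> \<W> \<Longrightarrow> pval.vunit w (\<delta> w)"
    "\<And>w w' q. w \<in> \<W> \<Longrightarrow> w' \<in> \<W> \<Longrightarrow> w' \<noteq> w \<Longrightarrow> q \<in> {of_nat p * x w' / x w} \<Longrightarrow> \<delta> w / q \<in> w'"
    by (rule separators_power[of "\<lambda>w w'. {of_nat p * x w' / x w}"]) (use x(1) in auto)
  define y where "y = (\<Sum>w\<in>\<W>. \<delta> w * x w)"
  have yI: "y \<in> I" unfolding y_def by (intro ideal_sum[OF I(1)] ideal_mult[OF I(1)] \<delta>(1) x(2))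
  have yu: "pval.vunit w (y / x w)" if w: "w \<in> \<W>" for w
  proof -
    interpret w: nfval w p by (rule \<W>_nfval[OF w])
    have "y = \<delta> w * x w + (\<Sum>v\<in>\<W> - {w}. \<delta> v * x v)"
      unfolding y_def using finite_\<W> w by (rule sum.remove)
    hence "y / x w = \<delta> w + (\<Sum>v\<in>\<W> - {w}. \<delta> v * x v / x w)"
      using x(1) by (simp add: add_divide_distrib sum_divide_distrib)
    moreover have "(\<Sum>v\<in>\<W> - {w}. \<delta> v * x v / x w) \<in> w.mx"
    proof (intro w.mx_sum)
      fix v assume v: "v \<in> \<W> - {w}"
      have "\<delta> v * x v / x w = \<delta> v / (of_nat p * x w / x v) * of_nat p"
        using x(1) by simp
      also have "\<dots> \<in> w.mx" using v w by (intro w.mx_mult w.p_mx \<delta>(3)) auto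
      finally show "\<delta> v * x v / x w \<in> w.mx" .
    qed
    ultimately show ?thesis using w.vunit_add_mx[OF \<delta>(2)[OF w]] by simp
  qed
  show ?thesis
  proof (rule that[OF yI])
    obtain w where w: "w \<in> \<W>" using \<W>_nonempty by blast
    interpret w: nfval w p by (rule \<W>_nfval[OF w])
    show "y \<noteq> 0" using yu[OF w] by (auto simp: w.vunit_iff)
  next
    fix \<sigma> z assume s: "\<sigma> \<in> Emb" and z: "z \<in> I"
    define w where "w = W \<sigma>"
    have w: "w \<in> \<W>" using s by (simp add: w_def \<W>_def)
    interpret w: nfval w p by (rule \<W>_nfval[OF w])
    have "z / y = (z / x w) * inverse (y / x w)" using x(1) by simp
    also have "\<dots> \<in> w" using x(3)[OF w z] yu[OF w] by (intro w.V_mult) (auto simp: w.vunit_iff)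
    finally show "z / y \<in> W \<sigma>" by (simp add: w_def)
  qed
qed

text \<open>The products of powers of the uniformizer below the ramification index with lifted
  residues, localized by separators, satisfy no integral relation with a coefficient prime to
  \<open>p\<close>. Dividing such a relation by the first relevant power of the uniformizer leaves a
  relation between residues modulo \<open>mx\<close>.\<close>

theorem sum_ramif_inertia_le:
  assumes b: "\<And>w. w \<in> \<W> \<Longrightarrow> nfval.res_indep w p (f w) (b w)"
  shows "(\<Sum>w\<in>\<W>. ramif w * f w) \<le> d"
proof (rule ccontr)
  assume neg: "\<not> (\<Sum>w\<in>\<W>. ramif w * f w) \<le> d"
  \<comment> \<open>These divisors make every generator attached to \<open>w\<close> a multiple of
    \<open>p\<close> in the other rings. Zero is removed because \<open>separators_power\<close>
    asks for nonzero divisors.\<close>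
  define Q where "Q = (\<lambda>w (w' :: 'k set). (\<lambda>(i, j). of_nat p / (unif w ^ i * b w j)) ` ({..<ramif w} \<times> {..<f w}) - {0})"
  obtain \<delta> where \<delta>: "\<And>w. w \<in> \<W> \<Longrightarrow> algebraic_int (\<delta> w)" "\<And>w. w \<in> \<W> \<Longrightarrow> pval.vunit w (\<delta> w)"
    "\<And>w w' q. w \<in> \<W> \<Longrightarrow> w' \<in> \<W> \<Longrightarrow> w' \<noteq> w \<Longrightarrow> q \<in> Q w w' \<Longrightarrow> \<delta> w / q \<in> w'"
    by (rule separators_power[of Q]) (auto simp: Q_def)
  define E where "E = (\<lambda>(w, i, j). \<delta> w * (unif w ^ i * b w j))"
  define \<Lambda> where "\<Lambda> = (SIGMA w:\<W>. {..<ramif w} \<times> {..<f w})"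
  have f\<Lambda>: "finite \<Lambda>" unfolding \<Lambda>_def using finite_\<W> by (intro finite_SigmaI) auto
  have "card \<Lambda> = (\<Sum>w\<in>\<W>. ramif w * f w)" unfolding \<Lambda>_def using finite_\<W> by (simp add: card_SigmaI)
  hence "card \<Lambda> > nf_degree TYPE('k)" using neg d_def by simp
  from int_relation[OF nf f\<Lambda> this p, of E] obtain c l0 where
    c: "(\<Sum>l\<in>\<Lambda>. of_int (c l) * E l) = 0" "l0 \<in> \<Lambda>" "\<not> int p dvd c l0" by metis
  obtain w i1 j1 where l: "l0 = (w, i1, j1)" by (cases l0) auto
  have w: "w \<in> \<W>" using c(2) l by (simp add: \<Lambda>_def)
  interpret w: nfval w p by (rule \<W>_nfval[OF w])
  have uw: "unif w = w.uni" "ramif w = w.ram" by (simp_all add: unif_def ramif_def)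
  define P where "P = (\<lambda>i. i < ramif w \<and> (\<exists>j<f w. \<not> int p dvd c (w, i, j)))"
  have "P i1" using c(2,3) l by (auto simp: P_def \<Lambda>_def)
  \<comment> \<open>After division by the power \<open>i0\<close> of the uniformizer, terms with
    smaller exponents still contain p / q, which is a non-unit since i0 is below the ramification
    index; those with larger exponents contain a factor \<open>w.uni\<close>.\<close>
  define i0 where "i0 = (LEAST i. P i)"
  have i0: "P i0" unfolding i0_def by (rule LeastI) (rule \<open>P i1\<close>)
  have lt: "int p dvd c (w, i, j)" if "i < i0" "j < f w" for i j
    using not_less_Least[of i P] that i0 by (auto simp: i0_def P_def)
  have i0r: "i0 < w.ram" using i0 by (simp add: P_def uw)
  define q where "q = w.uni ^ i0"
  have q0: "q \<noteq> 0" using w.uni(2) by (simp add: q_def)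
  have pq: "of_nat p / q \<in> w.mx"
  proof -
    have "of_nat p / q = (of_nat p / w.uni ^ w.ram) * w.uni ^ (w.ram - i0 - 1) * w.uni"
    proof -
      have "w.ram = i0 + Suc (w.ram - i0 - 1)" using i0r by simp
      hence "w.uni ^ w.ram = q * (w.uni ^ (w.ram - i0 - 1) * w.uni)"
        unfolding q_def by (metis power_Suc2 power_add)
      thus ?thesis using w.uni(2) by simp
    qed
    also have "\<dots> \<in> w.mx"
      using w.ram by (intro w.mx_mult w.V_mult w.V_power w.uni(1) w.uni_V) (auto simp: w.vunit_def)
    finally show ?thesis .
  qed
  define \<Lambda>0 where "\<Lambda>0 = (\<lambda>j. (w, i0, j)) ` {..<f w}"
  have sub: "\<Lambda>0 \<subseteq> \<Lambda>" using w i0 by (auto simp: \<Lambda>0_def \<Lambda>_def P_def)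
  have bw: "b w j \<in> w" if "j < f w" for j using b[OF w] that by (simp add: w.res_indep_def)
  have rest: "of_int (c l) * E l / q \<in> w.mx" if l: "l \<in> \<Lambda> - \<Lambda>0" for l
  proof -
    obtain v i j where vij: "l = (v, i, j)" by (cases l) auto
    have v: "v \<in> \<W>" "i < ramif v" "j < f v" using l vij by (auto simp: \<Lambda>_def)
    show ?thesis
    proof (cases "v = w")
      case False
      have "E l / of_nat p \<in> w"
      proof (cases "unif v ^ i * b v j = 0")
        case True
        hence "E l = 0" by (auto simp: E_def vij)
        thus ?thesis by (simp add: w.V_0)
      next
        case nz: False
        have "of_nat p / (unif v ^ i * b v j) \<in> Q v w"
          using v nz unfolding Q_def by (auto intro!: image_eqI[of _ _ "(i, j)"])
        from \<delta>(3)[OF v(1) w _ this] False have "\<delta> v / (of_nat p / (unif v ^ i * b v j)) \<in> w" by simp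
        thus ?thesis by (simp add: E_def vij)
      qed
      moreover have "of_int (c l) * E l / q = of_int (c l) * (E l / of_nat p) * (of_nat p / q)" by simp
      ultimately show ?thesis using pq by (simp only:) (intro w.mx_mult w.V_mult w.V_of_int)
    next
      case True
      have bj: "b w j \<in> w" using bw v(3) True by simp
      have dw: "\<delta> w \<in> w" using \<delta>(2)[OF w] by (simp add: w.vunit_def)
      show ?thesis
      proof (cases "i < i0")
        case True
        then obtain m where m: "c l = int p * m" using lt[of i j] v vij \<open>v = w\<close> by (auto elim: dvdE)
        have "of_int (c l) * E l / q = (of_int m * (\<delta> w * (w.uni ^ i * b w j))) * (of_nat p / q)"
        proof -
          have "E l = \<delta> w * (w.uni ^ i * b w j)" by (simp add: E_def vij \<open>v = w\<close> uw)
          moreover have "(of_int (c l) :: 'k) = of_int m * of_nat p" by (simp add: m)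
          ultimately show ?thesis by simp
        qed
        also have "\<dots> \<in> w.mx" by (intro w.mx_mult w.V_mult w.V_of_int w.V_power w.uni_V bj dw pq)
        finally show ?thesis .
      next
        case False
        have "i \<noteq> i0" using l vij v \<open>v = w\<close> by (auto simp: \<Lambda>0_def)
        hence "i = i0 + Suc (i - i0 - 1)" using False by simp
        hence "w.uni ^ i = q * (w.uni ^ (i - i0 - 1) * w.uni)" unfolding q_def by (metis power_Suc2 power_add)
        hence "of_int (c l) * E l / q = (of_int (c l) * \<delta> w * b w j * w.uni ^ (i - i0 - 1)) * w.uni"
          using q0 by (simp add: E_def vij \<open>v = w\<close> uw)
        also have "\<dots> \<in> w.mx" by (intro w.mx_mult w.V_mult w.V_of_int w.V_power w.uni_V bj dw w.uni(1))
        finally show ?thesis .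
      qed
    qed
  qed
  have "0 = (\<Sum>l\<in>\<Lambda>. of_int (c l) * E l) / q" by (simp add: c(1))
  also have "\<dots> = (\<Sum>l\<in>\<Lambda>. of_int (c l) * E l / q)" by (rule sum_divide_distrib)
  also have "\<dots> = (\<Sum>l\<in>\<Lambda> - \<Lambda>0. of_int (c l) * E l / q) + (\<Sum>l\<in>\<Lambda>0. of_int (c l) * E l / q)"
    by (rule sum.subset_diff[OF sub f\<Lambda>])
  also have "(\<Sum>l\<in>\<Lambda>0. of_int (c l) * E l / q) = (\<Sum>j<f w. of_int (c (w, i0, j)) * E (w, i0, j) / q)"
    unfolding \<Lambda>0_def by (subst sum.reindex) (auto simp: inj_on_def)
  also have "\<dots> = \<delta> w * (\<Sum>j<f w. of_int (c (w, i0, j)) * b w j)"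
    using w.uni(2) by (simp add: sum_distrib_left E_def uw q_def mult_ac)
  finally have "\<delta> w * (\<Sum>j<f w. of_int (c (w, i0, j)) * b w j) = - (\<Sum>l\<in>\<Lambda> - \<Lambda>0. of_int (c l) * E l / q)"
    by (simp add: eq_neg_iff_add_eq_0 add.commute)
  also have "\<dots> \<in> w.mx" using rest by (intro w.mx_uminus w.mx_sum)
  finally have m: "\<delta> w * (\<Sum>j<f w. of_int (c (w, i0, j)) * b w j) \<in> w.mx" .
  have "(\<Sum>j<f w. of_int (c (w, i0, j)) * b w j) \<in> w.mx"
  proof -
    have "inverse (\<delta> w) \<in> w" "\<delta> w \<noteq> 0" using \<delta>(2)[OF w] by (auto simp: w.vunit_iff)
    with w.mx_mult[OF this(1) m] show ?thesis by (simp only: mult.assoc[symmetric] left_inverse mult_1 not_False_eq_True)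
  qed
  hence "\<forall>j<f w. int p dvd c (w, i0, j)"
    using b[OF w, unfolded w.res_indep_def, THEN conjunct2, THEN spec, of "\<lambda>j. c (w, i0, j)"]
    by (rule mp[rotated])
  thus False using i0 by (auto simp: P_def)
qed

section \<open>Representatives of the classes and independence of residue maps\<close>

definition rep :: "('k \<Rightarrow> rat alg_closure) \<Rightarrow> ('k \<Rightarrow> rat alg_closure)" where
  "rep \<sigma> = (SOME \<tau>. \<tau> \<in> Emb \<and> eqv \<sigma> \<tau>)"

definition Reps :: "('k \<Rightarrow> rat alg_closure) set" where "Reps = rep ` Emb"

lemma rep: assumes "\<sigma> \<in> Emb" shows "rep \<sigma> \<in> Emb" "eqv \<sigma> (rep \<sigma>)"
  using someI[of "\<lambda>\<tau>. \<tau> \<in> Emb \<and> eqv \<sigma> \<tau>" \<sigma>] assms eqv_refl by (auto simp: rep_def)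

lemma rep_eq: "eqv \<sigma> \<tau> \<Longrightarrow> rep \<sigma> = rep \<tau>"
  unfolding rep_def using eqv_sym eqv_trans by (intro arg_cong[where f = Eps] ext) blast

lemma rep_rep: "\<sigma> \<in> Emb \<Longrightarrow> rep (rep \<sigma>) = rep \<sigma>"
  using rep rep_eq eqv_sym by metis

lemma Reps_subset: "Reps \<subseteq> Emb" using rep by (auto simp: Reps_def)

lemma finite_Reps: "finite Reps" by (simp add: Reps_def fin_Emb)

lemma Reps_eqv_imp_eq: "\<rho> \<in> Reps \<Longrightarrow> \<rho>' \<in> Reps \<Longrightarrow> eqv \<rho> \<rho>' \<Longrightarrow> \<rho> = \<rho>'"
  using rep_eq rep_rep by (fastforce simp: Reps_def)

lemma W_rep: "\<sigma> \<in> Emb \<Longrightarrow> W (rep \<sigma>) = W \<sigma>"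
  using rep eqv_imp_W_eq by metis

text \<open>Dedekind's independence of characters for the residue maps of distinct classes;
  primality of \<open>mx\<close> replaces cancellation in a field.\<close>

lemma residue_characters_independent:
  assumes "finite A" "A \<subseteq> Reps" "\<And>\<rho>. \<rho> \<in> A \<Longrightarrow> c \<rho> \<in> V"
    and "\<And>x. algebraic_int x \<Longrightarrow> (\<Sum>\<rho>\<in>A. c \<rho> * \<rho> x) \<in> mx" and "\<rho> \<in> A"
  shows "c \<rho> \<in> mx"
  using assms
proof (induction "card A" arbitrary: A c \<rho> rule: less_induct)
  case less
  show ?case
  proof (cases "A = {\<rho>}")
    case True
    interpret field_hom \<rho> using less.prems Reps_subset hom_Emb by blast
    show ?thesis using less.prems(4)[of 1] True by simp
  next
    case False
    then obtain \<tau> where t: "\<tau> \<in> A" "\<tau> \<noteq> \<rho>" using less.prems(5) by blast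
    have AE: "A \<subseteq> Emb" using less.prems(2) Reps_subset by blast
    have homA: "field_hom \<sigma>" if "\<sigma> \<in> A" for \<sigma> using AE that hom_Emb by blast
    have "\<not> eqv \<rho> \<tau>" using Reps_eqv_imp_eq t less.prems(2,5) by blast
    then obtain y where y: "algebraic_int y" "\<rho> y - \<tau> y \<notin> mx" by (auto simp: eqv_def)
    have yV: "\<sigma> y \<in> V" if "\<sigma> \<in> A" for \<sigma> using alg_int_W[OF y(1)] AE that by (auto simp: W_iff)
    \<comment> \<open>Subtracting \<open>\<tau> y\<close> times the relation at \<open>x\<close>
      from the relation at \<open>x * y\<close> eliminates \<open>\<tau>\<close>; the factor for
      \<open>\<rho>\<close> is a unit by the choice of \<open>y\<close>.\<close>
    define c' where "c' = (\<lambda>\<sigma>. c \<sigma> * (\<sigma> y - \<tau> y))"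
    have "c' \<rho> \<in> mx"
    proof (rule less.hyps[of "A - {\<tau>}" c' \<rho>])
      show "card (A - {\<tau>}) < card A" using less.prems(1) t(1) by (rule card_Diff1_less)
      show "c' \<sigma> \<in> V" if "\<sigma> \<in> A - {\<tau>}" for \<sigma>
        using that less.prems(3) yV t(1) by (auto simp: c'_def intro!: V_mult V_diff)
      fix x :: 'k assume x: "algebraic_int x"
      have "(\<Sum>\<sigma>\<in>A - {\<tau>}. c' \<sigma> * \<sigma> x) = (\<Sum>\<sigma>\<in>A. c' \<sigma> * \<sigma> x)"
        using less.prems(1) t(1) by (subst sum.remove[of A \<tau>]) (auto simp: c'_def)
      also have "\<dots> = (\<Sum>\<sigma>\<in>A. c \<sigma> * \<sigma> (x * y) - \<tau> y * (c \<sigma> * \<sigma> x))"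
      proof (intro sum.cong refl)
        fix \<sigma> assume "\<sigma> \<in> A"
        then interpret field_hom \<sigma> by (rule homA)
        show "c' \<sigma> * \<sigma> x = c \<sigma> * \<sigma> (x * y) - \<tau> y * (c \<sigma> * \<sigma> x)"
          by (simp add: c'_def hom_mult algebra_simps)
      qed
      also have "\<dots> = (\<Sum>\<sigma>\<in>A. c \<sigma> * \<sigma> (x * y)) - \<tau> y * (\<Sum>\<sigma>\<in>A. c \<sigma> * \<sigma> x)"
        by (simp add: sum_subtractf sum_distrib_left)
      also have "\<dots> \<in> mx"
        using x y(1) by (intro mx_diff mx_mult less.prems(4) yV t(1) algebraic_int_mult)
      finally show "(\<Sum>\<sigma>\<in>A - {\<tau>}. c' \<sigma> * \<sigma> x) \<in> mx" .
    qed (use less.prems t in auto)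
    thus ?thesis
      using mx_prime[OF less.prems(3)[OF less.prems(5)] V_diff[OF yV[OF less.prems(5)] yV[OF t(1)]]] y(2)
      by (auto simp: c'_def)
  qed
qed

text \<open>More than \<open>f\<close> residue maps would admit a nontrivial combination that
  vanishes on the \<open>f\<close> generators. Scaling by a coefficient of least valuation makes all
  coefficients lie in \<open>V\<close> and one of them 1, against independence.\<close>

theorem card_Reps_le:
  assumes w: "w \<in> \<W>" and b: "\<And>j. j < f \<Longrightarrow> algebraic_int (b j :: 'k)"
    and span: "\<And>x. algebraic_int x \<Longrightarrow> \<exists>c. x - (\<Sum>j<f. of_int (c j) * b j) \<in> pval.mx w"
  shows "card {\<rho> \<in> Reps. W \<rho> = w} \<le> f"
proof (rule ccontr)
  define A where "A = {\<rho> \<in> Reps. W \<rho> = w}"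
  have fA: "finite A" using finite_Reps by (simp add: A_def)
  have AE: "A \<subseteq> Emb" using Reps_subset by (auto simp: A_def)
  assume "\<not> card {\<rho> \<in> Reps. W \<rho> = w} \<le> f"
  hence "card A > f" by (simp add: A_def)
  from homogeneous_system_solution[OF fA this, of "\<lambda>\<rho> j. \<rho> (b j)"]
  obtain c where c: "\<forall>j<f. (\<Sum>s\<in>A. c s * s (b j)) = 0" "\<exists>s\<in>A. c s \<noteq> 0" by blast
  from exists_dominant[OF fA c(2)] obtain s0 where s0: "s0 \<in> A" "c s0 \<noteq> 0" "\<forall>s\<in>A. c s / c s0 \<in> V" by blast
  define c' where "c' = (\<lambda>s. c s / c s0)"
  have "c' s0 \<in> mx"
  proof (rule residue_characters_independent[OF fA _ _ _ s0(1)])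
    show "A \<subseteq> Reps" by (auto simp: A_def)
    show "c' s \<in> V" if "s \<in> A" for s using s0(3) that by (simp add: c'_def)
    fix x :: 'k assume x: "algebraic_int x"
    obtain n where n: "x - (\<Sum>j<f. of_int (n j) * b j) \<in> pval.mx w" using span[OF x] by blast
    have "(\<Sum>s\<in>A. c' s * s x) =
        (\<Sum>s\<in>A. c' s * s (x - (\<Sum>j<f. of_int (n j) * b j)) + (\<Sum>j<f. of_int (n j) * (c' s * s (b j))))"
    proof (intro sum.cong refl)
      fix s assume "s \<in> A"
      hence "field_hom s" using AE hom_Emb by blast
      then interpret field_hom s .
      show "c' s * s x = c' s * s (x - (\<Sum>j<f. of_int (n j) * b j)) + (\<Sum>j<f. of_int (n j) * (c' s * s (b j)))"
        by (simp add: hom_minus hom_sum hom_mult hom_of_int algebra_simps sum_distrib_left)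
    qed
    also have "\<dots> = (\<Sum>s\<in>A. c' s * s (x - (\<Sum>j<f. of_int (n j) * b j))) +
        (\<Sum>j<f. of_int (n j) * (\<Sum>s\<in>A. c' s * s (b j)))"
      by (simp add: sum.distrib sum.swap[of _ A] sum_distrib_left)
    also have "(\<Sum>j<f. of_int (n j) * (\<Sum>s\<in>A. c' s * s (b j))) = 0"
    proof -
      have "(\<Sum>s\<in>A. c' s * s (b j)) = (\<Sum>s\<in>A. c s * s (b j)) / c s0" for j
        by (simp add: c'_def sum_divide_distrib)
      thus ?thesis using c(1) by simp
    qed
    also have "(\<Sum>s\<in>A. c' s * s (x - (\<Sum>j<f. of_int (n j) * b j))) + 0 \<in> mx"
    proof -
      have "s (x - (\<Sum>j<f. of_int (n j) * b j)) \<in> mx" if "s \<in> A" for s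
      proof -
        have "s \<in> Emb" "W s = w" using that AE by (auto simp: A_def)
        thus ?thesis using n mx_W_iff[of s] by simp
      qed
      moreover have "c' s \<in> V" if "s \<in> A" for s using s0(3) that by (simp add: c'_def)
      ultimately have "(\<Sum>s\<in>A. c' s * s (x - (\<Sum>j<f. of_int (n j) * b j))) \<in> mx"
        by (intro mx_sum mx_mult)
      thus ?thesis by simp
    qed
    finally show "(\<Sum>s\<in>A. c' s * s x) \<in> mx" .
  qed
  thus False using s0(2) one_not_mx by (simp add: c'_def)
qed

end

section \<open>Prime ideals and inertia degrees\<close>

lemma ring_of_integers_simps:
  "x \<in> carrier ring_of_integers \<longleftrightarrow> algebraic_int x"
  "x \<otimes>\<^bsub>ring_of_integers\<^esub> y = x * y" "x \<oplus>\<^bsub>ring_of_integers\<^esub> y = x + y"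
  "\<zero>\<^bsub>ring_of_integers\<^esub> = 0" "\<one>\<^bsub>ring_of_integers\<^esub> = 1"
  by (simp_all add: ring_of_integers_def)

lemma cring_ring_of_integers: "cring (ring_of_integers :: 'k::field_char_0 ring)"
proof (rule cringI)
  show "abelian_group (ring_of_integers :: 'k ring)"
  proof (rule abelian_groupI)
    fix x :: 'k assume "x \<in> carrier ring_of_integers"
    thus "\<exists>y\<in>carrier ring_of_integers. y \<oplus>\<^bsub>ring_of_integers\<^esub> x = \<zero>\<^bsub>ring_of_integers\<^esub>"
      by (intro bexI[of _ "- x"]) (auto simp: ring_of_integers_simps)
  qed (auto simp: ring_of_integers_simps algebraic_int_add)
  show "Group.comm_monoid (ring_of_integers :: 'k ring)"
    by (rule comm_monoidI) (auto simp: ring_of_integers_simps algebraic_int_mult)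
qed (auto simp: ring_of_integers_simps algebra_simps)

lemma primeideal_ring_of_integersI:
  fixes P :: "'k::field_char_0 set"
  assumes alg: "\<And>x. x \<in> P \<Longrightarrow> algebraic_int x" and zero: "0 \<in> P"
    and add: "\<And>x y. x \<in> P \<Longrightarrow> y \<in> P \<Longrightarrow> x + y \<in> P"
    and mult: "\<And>a x. algebraic_int a \<Longrightarrow> x \<in> P \<Longrightarrow> a * x \<in> P"
    and one: "1 \<notin> P"
    and prime: "\<And>a b. algebraic_int a \<Longrightarrow> algebraic_int b \<Longrightarrow> a * b \<in> P \<Longrightarrow> a \<in> P \<or> b \<in> P"
  shows "primeideal P ring_of_integers"
proof -
  interpret O: cring "ring_of_integers :: 'k ring" by (rule cring_ring_of_integers)
  have "ideal P ring_of_integers"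
  proof (rule idealI)
    show "subgroup P (add_monoid ring_of_integers)"
    proof (rule O.add.subgroupI)
      show "P \<noteq> {}" using zero by blast
      fix a assume a: "a \<in> P"
      have "\<ominus>\<^bsub>ring_of_integers\<^esub> a = - a"
        by (rule O.minus_equality) (use alg[OF a] in \<open>auto simp: ring_of_integers_simps\<close>)
      moreover have "- a \<in> P" using mult[of "- 1" a] a by simp
      ultimately show "\<ominus>\<^bsub>ring_of_integers\<^esub> a \<in> P" by simp
    qed (use alg add in \<open>auto simp: ring_of_integers_simps\<close>)
    have "x * a \<in> P" if "x \<in> P" "algebraic_int a" for a x
      using mult[OF that(2,1)] by (simp add: mult.commute)
    thus "a \<otimes>\<^bsub>ring_of_integers\<^esub> x \<in> P"
      if "a \<in> P" "x \<in> carrier ring_of_integers" for a x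
      using that by (simp add: ring_of_integers_simps)
  qed (use mult in \<open>auto simp: ring_of_integers_simps O.ring_axioms\<close>)
  thus ?thesis
  proof (rule primeidealI)
    show "carrier ring_of_integers \<noteq> P" using one by (metis algebraic_int_1 ring_of_integers_simps(1))
  qed (use prime O.cring_axioms in \<open>auto simp: ring_of_integers_simps\<close>)
qed

context nf
begin

text \<open>An ideal containing \<open>p\<close> is determined by its members with coordinates from
  0 to p - 1 in an integral basis, hence by a subset of a finite box.\<close>

lemma finite_primes_above:
  assumes p: "Factorial_Ring.prime p"
  shows "finite (primes_above p :: 'k set set)"
proof -
  obtain w :: "nat \<Rightarrow> 'k" where w: "zindep d w" "{x. algebraic_int x} = range (zcomb d w)"
    by (rule exists_integral_basis)
  define C where "C = {..<d} \<rightarrow>\<^sub>E {0..<int p}"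
  define F where "F = (\<lambda>P :: 'k set. {c \<in> C. zcomb d w c \<in> P})"
  have p0: "int p > 0" using p prime_gt_0_nat by simp
  have alg: "algebraic_int (zcomb d w c)" for c using w(2) by blast
  have mem: "P = {x. \<exists>b. x = zcomb d w b \<and> restrict (\<lambda>i. b i mod int p) {..<d} \<in> F P}"
    if P: "P \<in> primes_above p" for P
  proof -
    have I: "ideal P ring_of_integers" "of_nat p \<in> P"
      using P by (auto simp: primes_above_def primeideal_def)
    have "x \<in> P \<longleftrightarrow> (\<exists>b. x = zcomb d w b \<and> zcomb d w (restrict (\<lambda>i. b i mod int p) {..<d}) \<in> P)" for x
    proof -
      have diff: "zcomb d w b - zcomb d w (restrict (\<lambda>i. b i mod int p) {..<d}) \<in> P" for b
      proof -
        have "zcomb d w b - zcomb d w (restrict (\<lambda>i. b i mod int p) {..<d}) = zcomb d w (\<lambda>i. int p * (b i div int p))"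
          unfolding zcomb_diff by (rule zcomb_cong) (simp add: minus_mod_eq_mult_div)
        also have "\<dots> = of_int (int p) * zcomb d w (\<lambda>i. b i div int p)" by (rule zcomb_mult[symmetric])
        also have "\<dots> = zcomb d w (\<lambda>i. b i div int p) * of_nat p" by simp
        also have "\<dots> \<in> P" by (rule ideal_mult[OF I(1) alg I(2)])
        finally show ?thesis .
      qed
      show ?thesis
      proof
        assume x: "x \<in> P"
        then obtain b where b: "x = zcomb d w b" using ideal_alg_int[OF I(1)] w(2) by blast
        have "zcomb d w (restrict (\<lambda>i. b i mod int p) {..<d}) \<in> P"
          using ideal_diff[OF I(1) x[unfolded b] diff[of b]] by simp
        thus "\<exists>b. x = zcomb d w b \<and> zcomb d w (restrict (\<lambda>i. b i mod int p) {..<d}) \<in> P" using b by blast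
      next
        assume "\<exists>b. x = zcomb d w b \<and> zcomb d w (restrict (\<lambda>i. b i mod int p) {..<d}) \<in> P"
        then obtain b where "x = zcomb d w b" "zcomb d w (restrict (\<lambda>i. b i mod int p) {..<d}) \<in> P" by blast
        thus "x \<in> P" using ideal_add[OF I(1) _ diff[of b]] by fastforce
      qed
    qed
    note iff = this
    have inC: "restrict (\<lambda>i. b i mod int p) {..<d} \<in> C" for b using p0 by (auto simp: C_def)
    show ?thesis
    proof (rule Set.set_eqI)
      fix x
      show "x \<in> P \<longleftrightarrow> x \<in> {x. \<exists>b. x = zcomb d w b \<and> restrict (\<lambda>i. b i mod int p) {..<d} \<in> F P}"
        unfolding iff[of x] F_def using inC by simp
    qed
  qed
  have "inj_on F (primes_above p)"
  proof (rule inj_onI)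
    fix P P' assume *: "P \<in> primes_above p" "P' \<in> primes_above p" "F P = F P'"
    have "P = {x. \<exists>b. x = zcomb d w b \<and> restrict (\<lambda>i. b i mod int p) {..<d} \<in> F P}" by (rule mem[OF *(1)])
    also have "\<dots> = P'" unfolding *(3) by (rule mem[OF *(2), symmetric])
    finally show "P = P'" .
  qed
  moreover have "F ` primes_above p \<subseteq> Pow C" by (auto simp: F_def)
  moreover have "finite (Pow C)" by (simp add: C_def finite_PiE)
  ultimately show ?thesis using finite_imageD finite_subset by metis
qed

text \<open>This translates the abstract dimension in \<open>inertia_degree\<close> into algebraic
  integers: lifts of a basis of the quotient, with independence and spanning stated through integer
  coefficients.\<close>

theorem inertia_basis:
  assumes p: "Factorial_Ring.prime p" and P: "P \<in> (primes_above p :: 'k set set)"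
  obtains b where "\<And>j. j < inertia_degree P \<Longrightarrow> algebraic_int (b j)"
    "\<And>c. (\<Sum>j<inertia_degree P. of_int (c j) * b j) \<in> P \<Longrightarrow> \<forall>j<inertia_degree P. int p dvd c j"
    "\<And>x. algebraic_int x \<Longrightarrow> \<exists>c. x - (\<Sum>j<inertia_degree P. of_int (c j) * b j) \<in> P"
proof -
  let ?O = "ring_of_integers :: 'k ring"
  interpret O: cring ?O by (rule cring_ring_of_integers)
  interpret P: primeideal P ?O using P by (simp add: primes_above_def)
  have pP: "of_nat p \<in> P" using P by (simp add: primes_above_def)
  have I: "ideal P ?O" by (rule P.ideal_axioms)
  have oneP: "1 \<notin> P"
  proof
    assume "1 \<in> P"
    hence "carrier ?O \<subseteq> P" using ideal_mult[OF I, of _ 1] by (auto simp: ring_of_integers_simps)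
    thus False using P.I_notcarr P.a_subset by blast
  qed
  define Q where "Q = ?O Quot P"
  interpret Q: ring Q unfolding Q_def by (rule P.quotient_is_ring)
  define cs where "cs = (\<lambda>x. P +>\<^bsub>?O\<^esub> x)"
  have cs_alt: "cs x = (\<lambda>h. h + x) ` P" for x
    by (auto simp: cs_def a_r_coset_def' ring_of_integers_simps image_def)
  have carQ: "carrier Q = {cs x |x. algebraic_int x}"
    by (auto simp: Q_def FactRing_def A_RCOSETS_def' cs_def ring_of_integers_simps)
  have zeroQ: "\<zero>\<^bsub>Q\<^esub> = cs 0" by (simp add: Q_def FactRing_def cs_alt)
  have oneQ: "\<one>\<^bsub>Q\<^esub> = cs 1" by (simp add: Q_def FactRing_def cs_def ring_of_integers_simps)
  have multQ: "cs x \<otimes>\<^bsub>Q\<^esub> cs y = cs (x * y)" if "algebraic_int x" "algebraic_int y" for x y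
    using P.rcoset_mult_add[of x y] that by (simp add: Q_def FactRing_def cs_def ring_of_integers_simps)
  have addQ: "cs x \<oplus>\<^bsub>Q\<^esub> cs y = cs (x + y)" if "algebraic_int x" "algebraic_int y" for x y
    using P.a_rcos_sum[of x y] that by (simp add: Q_def FactRing_def cs_def ring_of_integers_simps)
  have cs_eq: "cs x = cs y \<longleftrightarrow> x - y \<in> P" for x y
  proof
    assume "cs x = cs y"
    moreover have "x \<in> cs x" unfolding cs_alt using ideal_0[OF I] by (intro image_eqI[of _ _ 0]) auto
    ultimately have "x \<in> cs y" by simp
    thus "x - y \<in> P" by (auto simp: cs_alt)
  next
    have sub: "cs a \<subseteq> cs b" if "a - b \<in> P" for a b
    proof
      fix z assume "z \<in> cs a"
      then obtain h where h: "h \<in> P" "z = h + a" by (auto simp: cs_alt)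
      hence "z = (h + (a - b)) + b" by simp
      thus "z \<in> cs b" unfolding cs_alt using ideal_add[OF I h(1) that] by blast
    qed
    assume xy: "x - y \<in> P"
    have "y - x \<in> P" using ideal_diff[OF I ideal_0[OF I] xy] by simp
    thus "cs x = cs y" using sub xy by blast
  qed
  have int_P: "of_int n \<in> P \<longleftrightarrow> int p dvd n" for n
  proof
    assume "int p dvd n"
    then obtain m where "n = int p * m" by (elim dvdE)
    thus "of_int n \<in> P" using ideal_mult[OF I algebraic_int_of_int[of m] pP] by (simp add: mult.commute)
  next
    assume n: "of_int n \<in> P"
    show "int p dvd n"
    proof (rule ccontr)
      assume "\<not> int p dvd n"
      hence "coprime (int p) n" using p by (simp add: prime_imp_coprime)
      then obtain u v where "u * n + v * int p = 1" by (metis bezout_int coprime_iff_gcd_eq_1 gcd.commute)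
      hence "(1 :: 'k) = of_int u * of_int n + of_int v * of_nat p"
        by (metis of_int_1 of_int_add of_int_mult of_int_of_nat_eq)
      thus False using oneP ideal_add[OF I ideal_mult[OF I _ n] ideal_mult[OF I _ pP], of "of_int u" "of_int v"] by simp
    qed
  qed
  define K where "K = range (\<lambda>i::int. cs (of_int i))"
  have KQ: "K \<subseteq> carrier Q" by (auto simp: K_def carQ)
  have minusQ: "\<ominus>\<^bsub>Q\<^esub> cs x = cs (- x)" if "algebraic_int x" for x
    using that by (intro Q.minus_equality) (auto simp: addQ zeroQ carQ)
  have sf: "subfield K Q"
  proof (rule Q.subfieldI)
    have "subring K Q"
    proof (rule Q.subringI[OF KQ])
      show "\<one>\<^bsub>Q\<^esub> \<in> K" unfolding oneQ K_def by (rule range_eqI[of _ _ 1]) simp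
      show "\<ominus>\<^bsub>Q\<^esub> h \<in> K" if hK: "h \<in> K" for h
      proof -
        obtain n where "h = cs (of_int n)" using hK by (auto simp: K_def)
        hence "\<ominus>\<^bsub>Q\<^esub> h = cs (of_int (- n))" by (simp add: minusQ)
        thus ?thesis unfolding K_def by (rule range_eqI)
      qed
      fix h1 h2 assume "h1 \<in> K" "h2 \<in> K"
      then obtain n1 n2 where h: "h1 = cs (of_int n1)" "h2 = cs (of_int n2)" by (auto simp: K_def)
      have "h1 \<otimes>\<^bsub>Q\<^esub> h2 = cs (of_int (n1 * n2))" by (simp add: h multQ)
      thus "h1 \<otimes>\<^bsub>Q\<^esub> h2 \<in> K" unfolding K_def by (rule range_eqI)
      have "h1 \<oplus>\<^bsub>Q\<^esub> h2 = cs (of_int (n1 + n2))" by (simp add: h addQ)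
      thus "h1 \<oplus>\<^bsub>Q\<^esub> h2 \<in> K" unfolding K_def by (rule range_eqI)
    qed
    thus "subcring K Q"
      by (rule Q.subcringI) (auto simp: K_def multQ mult.commute)
    show "Units (Q\<lparr>carrier := K\<rparr>) = K - {\<zero>\<^bsub>Q\<^esub>}"
    proof (intro equalityI subsetI)
      fix k assume k: "k \<in> Units (Q\<lparr>carrier := K\<rparr>)"
      then obtain k' where k': "k \<in> K" "k' \<in> K" "k' \<otimes>\<^bsub>Q\<^esub> k = \<one>\<^bsub>Q\<^esub>" by (auto simp: Units_def)
      then obtain n n' where n: "k = cs (of_int n)" "k' = cs (of_int n')" by (auto simp: K_def)
      have "k \<noteq> cs 0"
      proof
        assume "k = cs 0"
        hence "cs (of_int n' * 0) = cs 1" using k'(3) n multQ[of "of_int n'" 0] by (simp add: oneQ)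
        hence "0 - 1 \<in> P" using cs_eq by simp
        from ideal_diff[OF I ideal_0[OF I] this] show False using oneP by simp
      qed
      thus "k \<in> K - {\<zero>\<^bsub>Q\<^esub>}" using k'(1) by (simp add: zeroQ)
    next
      fix k assume "k \<in> K - {\<zero>\<^bsub>Q\<^esub>}"
      then obtain n where n: "k = cs (of_int n)" "k \<noteq> cs 0" by (auto simp: K_def zeroQ)
      hence "\<not> int p dvd n" using cs_eq[of "of_int n" 0] int_P by auto
      hence "coprime (int p) n" using p by (simp add: prime_imp_coprime)
      then obtain u v where uv: "u * n + v * int p = 1" by (metis bezout_int coprime_iff_gcd_eq_1 gcd.commute)
      have "of_int (u * n - 1) \<in> P" unfolding int_P using uv by (metis add_diff_cancel_left' diff_minus_eq_add dvd_minus_iff dvd_triv_right minus_diff_eq)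
      hence un: "cs (of_int u * of_int n) = cs 1" by (simp add: cs_eq)
      have "cs (of_int u) \<in> K" "k \<in> K" by (auto simp: K_def n(1))
      moreover have "cs (of_int u) \<otimes>\<^bsub>Q\<^esub> k = \<one>\<^bsub>Q\<^esub>" "k \<otimes>\<^bsub>Q\<^esub> cs (of_int u) = \<one>\<^bsub>Q\<^esub>"
        using un by (simp_all add: n(1) multQ oneQ mult.commute)
      ultimately show "k \<in> Units (Q\<lparr>carrier := K\<rparr>)" by (auto simp: Units_def)
    qed
  qed
  have comb: "Q.combine (map (\<lambda>i. cs (of_int i)) cl) (map cs bl) = cs (\<Sum>j<length bl. of_int (cl ! j) * bl ! j)"
    if "length cl = length bl" "\<forall>x\<in>set bl. algebraic_int x" for cl bl
    using that
  proof (induction cl bl rule: list_induct2)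
    case Nil
    thus ?case by (simp add: zeroQ)
  next
    case (Cons c cl b bl)
    have a: "algebraic_int (of_int c * b)" "algebraic_int (\<Sum>j<length bl. of_int (cl ! j) * bl ! j)"
      using Cons.prems by (auto intro!: algebraic_int_mult algebraic_int_sum)
    show ?case
      using Cons a by (simp add: multQ addQ sum.lessThan_Suc_shift del: sum.lessThan_Suc)
  qed
  obtain w :: "nat \<Rightarrow> 'k" where w: "{x. algebraic_int x} = range (zcomb d w)"
    using exists_integral_basis by metis
  have wi: "algebraic_int (w i)" if "i < d" for i
  proof -
    have "zcomb d w (\<lambda>j. if j = i then 1 else 0) = (\<Sum>j<d. if j = i then w j else 0)"
      unfolding zcomb_def by (intro sum.cong) auto
    also have "\<dots> = w i" using that by simp
    finally show ?thesis using w by (metis mem_Collect_eq rangeI)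
  qed
  \<comment> \<open>The images of an integral basis span the quotient over its prime field. This
    secures finite dimension, so that \<open>ring.dim\<close> is the length of an actual
    basis.\<close>
  define Us where "Us = map cs (map w [0..<d])"
  have Us: "set Us \<subseteq> carrier Q" using wi by (auto simp: Us_def carQ)
  have "carrier Q \<subseteq> Q.Span K Us"
  proof
    fix q assume "q \<in> carrier Q"
    then obtain x where x: "algebraic_int x" "q = cs x" by (auto simp: carQ)
    then obtain c where c: "x = zcomb d w c" using w by blast
    have "q = Q.combine (map (\<lambda>i. cs (of_int i)) (map c [0..<d])) Us"
      unfolding Us_def by (subst comb) (auto simp: x c zcomb_def wi)
    moreover have "set (map (\<lambda>i. cs (of_int i)) (map c [0..<d])) \<subseteq> K" by (auto simp: K_def)
    ultimately show "q \<in> Q.Span K Us"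
      unfolding Q.Span_eq_combine_set[OF sf Us] by blast
  qed
  hence "Q.Span K Us = carrier Q" using Q.Span_in_carrier[OF _ Us, of K] KQ by blast
  hence "Q.finite_dimension K (carrier Q)" using Q.Span_finite_dimension[OF sf Us] by simp
  from Q.finite_dimensionE[OF sf this] have "Q.dimension (inertia_degree P) K (carrier Q)"
    by (simp add: over_def inertia_degree_def Q_def K_def cs_def)
  from Q.exists_base[OF sf this] obtain Vs where
    Vs: "set Vs \<subseteq> carrier Q" "Q.independent K Vs" "length Vs = inertia_degree P" "Q.Span K Vs = carrier Q" by blast
  define g where "g = (\<lambda>v. SOME x. algebraic_int x \<and> v = cs x)"
  have g: "algebraic_int (g v) \<and> v = cs (g v)" if "v \<in> set Vs" for v
    unfolding g_def by (rule someI_ex) (use Vs(1) that in \<open>auto simp: carQ\<close>)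
  define bl where "bl = map g Vs"
  have bl: "Vs = map cs bl" "\<forall>x\<in>set bl. algebraic_int x" "length bl = inertia_degree P"
    using g Vs(3) by (auto simp: bl_def map_idI comp_def intro!: map_idI[symmetric])
  show ?thesis
  proof (rule that[of "\<lambda>j. bl ! j"])
    show "algebraic_int (bl ! j)" if "j < inertia_degree P" for j
      using bl that by simp
  next
    fix c assume c: "(\<Sum>j<inertia_degree P. of_int (c j) * bl ! j) \<in> P"
    define Ks where "Ks = map (\<lambda>i. cs (of_int i)) (map c [0..<inertia_degree P])"
    have "Q.combine Ks Vs = cs (\<Sum>j<inertia_degree P. of_int (c j) * bl ! j)"
      unfolding Ks_def bl(1) by (subst comb) (use bl in auto)
    also have "\<dots> = \<zero>\<^bsub>Q\<^esub>" using c by (simp add: zeroQ cs_eq)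
    finally have "set (take (length Vs) Ks) \<subseteq> {\<zero>\<^bsub>Q\<^esub>}"
      by (intro Q.independent_imp_trivial_combine[OF sf Vs(2)]) (auto simp: Ks_def K_def)
    hence "set Ks \<subseteq> {cs 0}" by (simp add: Ks_def Vs(3) zeroQ)
    hence "\<forall>j<inertia_degree P. cs (of_int (c j)) = cs 0" unfolding Ks_def by (simp add: image_subset_iff)
    thus "\<forall>j<inertia_degree P. int p dvd c j" by (simp add: cs_eq int_P)
  next
    fix x :: 'k assume x: "algebraic_int x"
    hence "cs x \<in> Q.Span K Vs" using Vs(4) by (auto simp: carQ)
    then obtain Ks where Ks: "set Ks \<subseteq> K" "length Ks = length Vs" "cs x = Q.combine Ks Vs"
      using Q.Span_mem_iff_length_version[OF sf Vs(1)] by blast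
    have "\<forall>k\<in>set Ks. \<exists>n. k = cs (of_int n)" using Ks(1) by (auto simp: K_def)
    from bchoice[OF this] obtain n where n: "\<forall>k\<in>set Ks. k = cs (of_int (n k))" by blast
    have "Ks = map (\<lambda>i. cs (of_int i)) (map n Ks)"
      using n by (simp add: comp_def map_idI)
    hence "Q.combine Ks Vs = Q.combine (map (\<lambda>i. cs (of_int i)) (map n Ks)) (map cs bl)"
      using bl(1) by simp
    also have "\<dots> = cs (\<Sum>j<length bl. of_int (map n Ks ! j) * bl ! j)"
      by (rule comb) (use bl Ks(2) in auto)
    finally have "cs x = cs (\<Sum>j<inertia_degree P. of_int (map n Ks ! j) * bl ! j)"
      using Ks(3) bl(3) by simp
    hence "x - (\<Sum>j<inertia_degree P. of_int (map n Ks ! j) * bl ! j) \<in> P" by (simp add: cs_eq)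
    thus "\<exists>c. x - (\<Sum>j<inertia_degree P. of_int (c j) * bl ! j) \<in> P" by blast
  qed
qed

end

section \<open>Matching valuation rings with prime ideals above \<open>p\<close>\<close>

context local_nf
begin

definition prm :: "'k set \<Rightarrow> 'k set" where "prm w = {x. algebraic_int x \<and> x \<in> pval.mx w}"

lemma prm_W: "\<sigma> \<in> Emb \<Longrightarrow> prm (W \<sigma>) = center \<sigma>"
  by (simp add: prm_def center_def mx_W_iff)

lemma prm_primes_above: assumes w: "w \<in> \<W>" shows "prm w \<in> primes_above p"
proof -
  interpret w: nfval w p by (rule \<W>_nfval[OF w])
  have alg: "x \<in> w" if "algebraic_int x" for x using algebraic_int_in_val_ring[OF that w.vr] .
  have "primeideal (prm w) ring_of_integers"
  proof (rule primeideal_ring_of_integersI)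
    fix a b assume "algebraic_int a" "algebraic_int b" "a * b \<in> prm w"
    thus "a \<in> prm w \<or> b \<in> prm w" using w.mx_prime[of a b] alg by (auto simp: prm_def)
  qed (auto simp: prm_def w.mx_0 w.one_not_mx intro: algebraic_int_add algebraic_int_mult w.mx_add w.mx_mult alg)
  thus ?thesis using w.p_mx by (simp add: primes_above_def prm_def)
qed

lemma inj_prm: "inj_on prm \<W>"
proof (rule inj_onI)
  fix v w assume vw: "v \<in> \<W>" "w \<in> \<W>" "prm v = prm w"
  from vw(1) obtain \<sigma> where \<sigma>: "\<sigma> \<in> Emb" "v = W \<sigma>" unfolding \<W>_def by (rule imageE)
  from vw(2) obtain \<tau> where \<tau>: "\<tau> \<in> Emb" "w = W \<tau>" unfolding \<W>_def by (rule imageE)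
  have "center \<sigma> = center \<tau>" using vw(3) unfolding \<sigma>(2) \<tau>(2) prm_W[OF \<sigma>(1)] prm_W[OF \<tau>(1)] .
  thus "v = w" unfolding \<sigma>(2) \<tau>(2) by (rule center_eq_imp_W_eq[OF \<sigma>(1) \<tau>(1)])
qed

text \<open>At most f classes lie over a ring with inertia degree f, so the ramification indices
  summed over classes are bounded by the sum of e f over rings, hence by \<open>d\<close>. The same
  count bounds the number of classes by the sum of f, and distinct rings have distinct
  primes.\<close>

theorem ramification_bounds:
  shows "(\<Sum>\<rho>\<in>Reps. ramif (W \<rho>)) \<le> d"
    and "card Reps \<le> inertia_degree_sum TYPE('k) p"
proof -
  define f where "f = (\<lambda>w. inertia_degree (prm w))"
  define Q where "Q = (\<lambda>w b. (\<forall>j<f w. algebraic_int (b j)) \<and>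
      (\<forall>c. (\<Sum>j<f w. of_int (c j) * b j) \<in> prm w \<longrightarrow> (\<forall>j<f w. int p dvd c j)) \<and>
      (\<forall>x. algebraic_int x \<longrightarrow> (\<exists>c. x - (\<Sum>j<f w. of_int (c j) * b j) \<in> prm w)))"
  define b where "b = (\<lambda>w. SOME b. Q w b)"
  have Q: "Q w (b w)" if w: "w \<in> \<W>" for w
  proof -
    have "\<exists>b. Q w b"
    proof (rule inertia_basis[OF p prm_primes_above[OF w]])
      fix b assume b: "\<And>j. j < inertia_degree (prm w) \<Longrightarrow> algebraic_int (b j)"
        "\<And>c. (\<Sum>j<inertia_degree (prm w). of_int (c j) * b j) \<in> prm w \<Longrightarrow> \<forall>j<inertia_degree (prm w). int p dvd c j"
        "\<And>x. algebraic_int x \<Longrightarrow> \<exists>c. x - (\<Sum>j<inertia_degree (prm w). of_int (c j) * b j) \<in> prm w"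
      have "Q w b"
        unfolding Q_def f_def
      proof (intro conjI)
        show "\<forall>j<inertia_degree (prm w). algebraic_int (b j)" by (intro allI impI b(1))
        show "\<forall>c. (\<Sum>j<inertia_degree (prm w). of_int (c j) * b j) \<in> prm w \<longrightarrow>
            (\<forall>j<inertia_degree (prm w). int p dvd c j)"
          by (rule allI, rule impI, rule b(2))
        show "\<forall>x. algebraic_int x \<longrightarrow> (\<exists>c. x - (\<Sum>j<inertia_degree (prm w). of_int (c j) * b j) \<in> prm w)"
          by (rule allI, rule impI, rule b(3))
      qed
      thus "\<exists>b. Q w b" by (rule exI[where x = b])
    qed
    thus ?thesis unfolding b_def by (rule someI_ex)
  qed
  have b: "w \<in> \<W> \<Longrightarrow> j < f w \<Longrightarrow> algebraic_int (b w j)"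
    "w \<in> \<W> \<Longrightarrow> (\<Sum>j<f w. of_int (c j) * b w j) \<in> prm w \<Longrightarrow> \<forall>j<f w. int p dvd c j"
    "w \<in> \<W> \<Longrightarrow> algebraic_int x \<Longrightarrow> \<exists>c. x - (\<Sum>j<f w. of_int (c j) * b w j) \<in> prm w" for w j c x
    using Q[of w] unfolding Q_def by simp_all
  have "nfval.res_indep w p (f w) (b w)" if w: "w \<in> \<W>" for w
  proof -
    interpret w: nfval w p by (rule \<W>_nfval[OF w])
    have "algebraic_int (\<Sum>j<f w. of_int (c j) * b w j)" for c
      using b(1)[OF w] by (intro algebraic_int_sum algebraic_int_mult) auto
    thus ?thesis
      using b(1,2)[OF w] algebraic_int_in_val_ring[OF _ w.vr] by (auto simp: w.res_indep_def prm_def)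
  qed
  from sum_ramif_inertia_le[OF this] have ef: "(\<Sum>w\<in>\<W>. ramif w * f w) \<le> d" .
  have r: "card {\<rho> \<in> Reps. W \<rho> = w} \<le> f w" if w: "w \<in> \<W>" for w
  proof (rule card_Reps_le[OF w])
    show "algebraic_int (b w j)" if "j < f w" for j by (rule b(1)[OF w that])
    show "\<exists>c. x - (\<Sum>j<f w. of_int (c j) * b w j) \<in> pval.mx w" if "algebraic_int x" for x
      using b(3)[OF w that] by (auto simp: prm_def)
  qed
  have WR: "W ` Reps \<subseteq> \<W>" using Reps_subset by (auto simp: \<W>_def)
  have group: "(\<Sum>\<rho>\<in>Reps. F (W \<rho>)) = (\<Sum>w\<in>\<W>. F w * card {\<rho> \<in> Reps. W \<rho> = w})" for F :: "'k set \<Rightarrow> nat"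
  proof -
    have "(\<Sum>\<rho>\<in>Reps. F (W \<rho>)) = (\<Sum>w\<in>\<W>. \<Sum>\<rho>\<in>{\<rho> \<in> Reps. W \<rho> = w}. F (W \<rho>))"
      using sum.group[OF finite_Reps finite_\<W> WR, of "\<lambda>\<rho>. F (W \<rho>)"] by simp
    also have "\<dots> = (\<Sum>w\<in>\<W>. F w * card {\<rho> \<in> Reps. W \<rho> = w})"
      by (intro sum.cong refl) (simp add: mult.commute)
    finally show ?thesis .
  qed
  have "(\<Sum>\<rho>\<in>Reps. ramif (W \<rho>)) \<le> (\<Sum>w\<in>\<W>. ramif w * f w)"
    unfolding group[of ramif] using r by (intro sum_mono mult_left_mono) auto
  thus "(\<Sum>\<rho>\<in>Reps. ramif (W \<rho>)) \<le> d" using ef by simp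
  have "card Reps \<le> (\<Sum>w\<in>\<W>. f w)"
    using group[of "\<lambda>_. 1"] r by (simp add: sum_mono)
  also have "\<dots> = (\<Sum>P\<in>prm ` \<W>. inertia_degree P)"
    unfolding f_def using inj_prm by (simp add: sum.reindex)
  also have "\<dots> \<le> (\<Sum>P\<in>(primes_above p :: 'k set set). inertia_degree P)"
    using sum_mono2[OF finite_primes_above[OF p], of "prm ` \<W>" inertia_degree] prm_primes_above by auto
  finally show "card Reps \<le> inertia_degree_sum TYPE('k) p" by (simp add: inertia_degree_sum_def)
qed

end

section \<open>The local determinant bound\<close>

text \<open>Distinct natural numbers sum to at least 0 + 1 + 2 and so on, and truncation at
  \<open>N\<close> does no harm to at most N + 1 of them. In the determinant bound truncated indices
  are the remainder slots, and the factor 2 avoids halving.\<close>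

lemma sum_min_distinct_ge:
  fixes t :: "'b \<Rightarrow> nat"
  assumes "finite A" "inj_on t A" "card A \<le> Suc N"
  shows "card A * (card A - 1) \<le> 2 * (\<Sum>a\<in>A. min (t a) N)"
  using assms
proof (induction "card A" arbitrary: A)
  case (Suc n)
  hence A: "A \<noteq> {}" by auto
  define M where "M = Max (t ` A)"
  have "M \<in> t ` A" unfolding M_def using Suc.prems(1) A by (intro Max_in) auto
  then obtain a where a: "a \<in> A" "t a = M" by blast
  have "t ` A \<subseteq> {..M}" unfolding M_def using Suc.prems(1) by auto
  hence "card (t ` A) \<le> card {..M}" by (intro card_mono) auto
  hence "n \<le> M" using Suc.prems(2) Suc.hyps(2) by (simp add: card_image)
  hence min: "n \<le> min (t a) N" using a(2) Suc.prems(3) Suc.hyps(2) by simp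
  have cA: "card (A - {a}) = n" using Suc.hyps(2) Suc.prems(1) a(1) by simp
  have "card (A - {a}) * (card (A - {a}) - 1) \<le> 2 * (\<Sum>a\<in>A - {a}. min (t a) N)"
    using Suc.prems Suc.hyps(2) cA by (intro Suc.hyps(1)) (auto intro: inj_on_subset)
  moreover have "(\<Sum>a\<in>A. min (t a) N) = min (t a) N + (\<Sum>a\<in>A - {a}. min (t a) N)"
    using Suc.prems(1) a(1) by (rule sum.remove)
  moreover have "Suc n * n \<le> n * (n - 1) + 2 * n" by (cases n) auto
  moreover have "card A * (card A - 1) = Suc n * n" "card (A - {a}) * (card (A - {a}) - 1) = n * (n - 1)"
    by (simp_all add: cA Suc.hyps(2)[symmetric])
  ultimately show ?case using min by linarith
qed simp

lemma card_supersets: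
  assumes "finite E" "U \<subseteq> E" "card U \<le> m"
  shows "card {S. S \<subseteq> E \<and> card S = m \<and> U \<subseteq> S} = (card E - card U) choose (m - card U)"
proof -
  have fU: "finite U" using assms(1,2) by (rule finite_subset[rotated])
  have "bij_betw (\<lambda>S. S \<union> U) {S. S \<subseteq> E - U \<and> card S = m - card U} {S. S \<subseteq> E \<and> card S = m \<and> U \<subseteq> S}"
  proof (rule bij_betwI[where g = "\<lambda>S. S - U"])
    show "(\<lambda>S. S \<union> U) \<in> {S. S \<subseteq> E - U \<and> card S = m - card U} \<rightarrow> {S. S \<subseteq> E \<and> card S = m \<and> U \<subseteq> S}"
    proof (intro funcsetI CollectI conjI)
      fix S assume "S \<in> {S. S \<subseteq> E - U \<and> card S = m - card U}"
      hence S: "S \<subseteq> E - U" "card S = m - card U" by auto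
      have "finite S" using S(1) assms(1) finite_subset by blast
      thus "card (S \<union> U) = m" using S fU assms(3) by (subst card_Un_disjoint) auto
    qed (use assms(2) in auto)
    show "(\<lambda>S. S - U) \<in> {S. S \<subseteq> E \<and> card S = m \<and> U \<subseteq> S} \<rightarrow> {S. S \<subseteq> E - U \<and> card S = m - card U}"
      using fU by (auto simp: card_Diff_subset)
  qed auto
  hence "card {S. S \<subseteq> E \<and> card S = m \<and> U \<subseteq> S} = card {S. S \<subseteq> E - U \<and> card S = m - card U}"
    by (rule bij_betw_same_card[symmetric])
  also have "\<dots> = card (E - U) choose (m - card U)" using assms(1) by (intro n_subsets) auto
  also have "card (E - U) = card E - card U" using fU assms(2) by (rule card_Diff_subset)
  finally show ?thesis .
qed

text \<open>Double counting: \<open>D B\<close> consists of the ordered pairs of distinct elements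
  of \<open>B\<close>, and each pair from \<open>C\<close> is contained in the same number of sets
  \<open>S\<close>.\<close>

lemma sum_card_inter_pairs:
  assumes E: "finite E" and C: "C \<subseteq> E" and m: "2 \<le> m"
  shows "(\<Sum>S | S \<subseteq> E \<and> card S = m. card (S \<inter> C) * (card (S \<inter> C) - 1)) =
    card C * (card C - 1) * ((card E - 2) choose (m - 2))"
proof -
  have fC: "finite C" using E C by (rule finite_subset[rotated])
  define D where "D = (\<lambda>B :: 'a set. {q \<in> B \<times> B. fst q \<noteq> snd q})"
  have cD: "card (D B) = card B * (card B - 1)" if B: "finite B" for B
  proof -
    have "D B = B \<times> B - (\<lambda>x. (x, x)) ` B" by (auto simp: D_def)
    moreover have "card ((\<lambda>x. (x, x)) ` B) = card B" by (intro card_image) (auto simp: inj_on_def)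
    ultimately have "card (D B) = card B * card B - card B"
      using B by (subst \<open>D B = _\<close>, subst card_Diff_subset) (auto simp: card_cartesian_product)
    thus ?thesis by (simp add: algebra_simps diff_mult_distrib2)
  qed
  define \<S> where "\<S> = {S. S \<subseteq> E \<and> card S = m}"
  have f\<S>: "finite \<S>" unfolding \<S>_def using E by auto
  have "(\<Sum>S\<in>\<S>. card (S \<inter> C) * (card (S \<inter> C) - 1)) = (\<Sum>S\<in>\<S>. card (D (S \<inter> C)))"
    using fC by (simp add: cD)
  also have "\<dots> = (\<Sum>S\<in>\<S>. \<Sum>q\<in>D C. of_bool (fst q \<in> S \<and> snd q \<in> S))"
  proof (intro sum.cong refl)
    fix S
    have "D (S \<inter> C) = {q \<in> D C. fst q \<in> S \<and> snd q \<in> S}" by (auto simp: D_def)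
    moreover have "finite (D C)" using fC by (auto simp: D_def)
    ultimately show "card (D (S \<inter> C)) = (\<Sum>q\<in>D C. of_bool (fst q \<in> S \<and> snd q \<in> S))"
      by (simp add: sum_of_bool_eq Int_def conj_commute)
  qed
  also have "\<dots> = (\<Sum>q\<in>D C. \<Sum>S\<in>\<S>. of_bool (fst q \<in> S \<and> snd q \<in> S))" by (rule sum.swap)
  also have "\<dots> = (\<Sum>q\<in>D C. (card E - 2) choose (m - 2))"
  proof (intro sum.cong refl)
    fix q assume q: "q \<in> D C"
    have "(\<Sum>S\<in>\<S>. of_bool (fst q \<in> S \<and> snd q \<in> S)) = card {S \<in> \<S>. fst q \<in> S \<and> snd q \<in> S}"
      using f\<S> by (simp add: sum_of_bool_eq Int_def conj_commute)
    also have "{S \<in> \<S>. fst q \<in> S \<and> snd q \<in> S} = {S. S \<subseteq> E \<and> card S = m \<and> {fst q, snd q} \<subseteq> S}"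
      by (auto simp: \<S>_def)
    also have "card \<dots> = (card E - 2) choose (m - 2)"
    proof -
      have "card {fst q, snd q} = 2" using q by (auto simp: D_def)
      moreover have "{fst q, snd q} \<subseteq> E" using q C by (auto simp: D_def)
      ultimately show ?thesis using card_supersets[OF E, of "{fst q, snd q}" m] m by simp
    qed
    finally show "(\<Sum>S\<in>\<S>. of_bool (fst q \<in> S \<and> snd q \<in> S)) = (card E - 2) choose (m - 2)" by simp
  qed
  also have "\<dots> = card C * (card C - 1) * ((card E - 2) choose (m - 2))" using cD[OF fC] by simp
  finally show ?thesis by (simp add: \<S>_def)
qed

context local_nf
begin

text \<open>The yardstick of a class. By \<open>unif_ratio\<close>, every member of the class maps
  the uniformizer to a multiple of it in \<open>V\<close>.\<close>

definition \<omega> :: "('k \<Rightarrow> rat alg_closure) \<Rightarrow> rat alg_closure" where "\<omega> \<rho> = \<rho> (unif (W \<rho>))"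

lemma \<omega>_0: "\<rho> \<in> Emb \<Longrightarrow> \<omega> \<rho> \<noteq> 0" by (simp add: \<omega>_def hom_unif_0)

lemma \<omega>_V: "\<rho> \<in> Emb \<Longrightarrow> \<omega> \<rho> \<in> V" by (simp add: \<omega>_def hom_unif_V)

definition mult_in :: "('k \<Rightarrow> rat alg_closure) list \<Rightarrow> ('k \<Rightarrow> rat alg_closure) \<Rightarrow> nat" where
  "mult_in ss \<rho> = card {i. i < length ss \<and> rep (ss ! i) = \<rho>}"

text \<open>Each row is a combination of vectors \<open>Y\<close> that depend only on its class,
  weighted by powers of the uniformizer up to a remainder of order \<open>m\<close>. Expanding the
  determinant by rows, a nonzero summand uses different vectors for rows of the same class, so its
  weights contain at least the powers 0, 1, 2 and so on.\<close>

theorem det_embedding_mat_bound: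
  assumes ss: "distinct ss" "set ss \<subseteq> Emb" and len: "length ss = m" "length xs = m"
    and xs: "\<And>x \<sigma>. x \<in> set xs \<Longrightarrow> \<sigma> \<in> Emb \<Longrightarrow> x \<in> W \<sigma>"
  shows "(det (embedding_mat ss xs))\<^sup>2 / (\<Prod>\<rho>\<in>Reps. \<omega> \<rho> ^ (mult_in ss \<rho> * (mult_in ss \<rho> - 1))) \<in> V"
proof -
  have sE: "ss ! i \<in> Emb" if "i < m" for i using ss(2) len that nth_mem[of i ss] by blast
  define r where "r = (\<lambda>i. rep (ss ! i))"
  have r: "r i \<in> Reps" "r i \<in> Emb" "W (ss ! i) = W (r i)" if "i < m" for i
    using sE[OF that] rep W_rep by (auto simp: r_def Reps_def)
  define P where "P = (\<lambda>\<rho> j c. (\<forall>t. c t \<in> V) \<and> (\<forall>\<tau>\<in>Emb. eqv \<rho> \<tau> \<longrightarrow>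
    (\<tau> (xs ! j) - (\<Sum>t<m. c t * \<tau> (unif (W \<rho>)) ^ t)) / \<rho> (unif (W \<rho>)) ^ m \<in> V))"
  define c where "c = (\<lambda>\<rho> j. SOME c. P \<rho> j c)"
  have P: "P \<rho> j (c \<rho> j)" if "\<rho> \<in> Reps" "j < m" for \<rho> j
  proof -
    have \<rho>: "\<rho> \<in> Emb" using that(1) Reps_subset by (rule subsetD[rotated])
    have "xs ! j \<in> set xs" using that(2) len(2) by simp
    from class_expansion[OF \<rho> xs[OF this \<rho>], of m] have "\<exists>c. P \<rho> j c" unfolding P_def .
    thus ?thesis unfolding c_def by (rule someI_ex)
  qed
  have c: "c \<rho> j t \<in> V" if "\<rho> \<in> Reps" "j < m" for \<rho> j t using P[OF that] by (simp add: P_def)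
  define R where "R = (\<lambda>i j. ((ss ! i) (xs ! j) - (\<Sum>t<m. c (r i) j t * (ss ! i) (unif (W (r i))) ^ t)) / \<omega> (r i) ^ m)"
  have R: "R i j \<in> V" if "i < m" "j < m" for i j
  proof -
    have "eqv (r i) (ss ! i)" unfolding r_def by (rule eqv_sym[OF rep(2)[OF sE[OF that(1)]]])
    thus ?thesis using P[OF r(1)[OF that(1)] that(2)] sE[OF that(1)] unfolding R_def \<omega>_def P_def by simp
  qed
  \<comment> \<open>Slots below \<open>m\<close> carry the powers of the uniformizer. Slot m + i is
    reserved for the remainder of row \<open>i\<close>, with weight
    \<open>\<omega> (r i) ^ m\<close>, so that the remainder vectors also fit into the list indexed
    by class and slot.\<close>
  define G where "G = (\<lambda>i t. if t < m then (ss ! i) (unif (W (r i))) ^ t else if t = m + i then \<omega> (r i) ^ m else 0)"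
  define Y where "Y = (\<lambda>\<rho> t. vec m (\<lambda>j. if t < m then c \<rho> j t else R (t - m) j))"
  define gens where "gens = {0..<2 * m}"
  have Yc: "Y \<rho> t \<in> carrier_vec m" for \<rho> t by (simp add: Y_def)
  have expand: "(ss ! i) (xs ! j) = (\<Sum>t\<in>gens. G i t * Y (r i) t $ j)" if "i < m" "j < m" for i j
  proof -
    have "gens = {..<m} \<union> {m..<2 * m}" by (auto simp: gens_def)
    hence "(\<Sum>t\<in>gens. G i t * Y (r i) t $ j) =
        (\<Sum>t<m. G i t * Y (r i) t $ j) + (\<Sum>t\<in>{m..<2 * m}. G i t * Y (r i) t $ j)"
      by (simp only:) (rule sum.union_disjoint, auto)
    also have "(\<Sum>t<m. G i t * Y (r i) t $ j) = (\<Sum>t<m. c (r i) j t * (ss ! i) (unif (W (r i))) ^ t)"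
      using that by (intro sum.cong) (auto simp: G_def Y_def)
    also have "(\<Sum>t\<in>{m..<2 * m}. G i t * Y (r i) t $ j) = (\<Sum>t\<in>{m..<2 * m}. if t = m + i then \<omega> (r i) ^ m * R i j else 0)"
      using that by (intro sum.cong) (auto simp: G_def Y_def)
    also have "\<dots> = \<omega> (r i) ^ m * R i j" using that by simp
    also have "\<dots> = (ss ! i) (xs ! j) - (\<Sum>t<m. c (r i) j t * (ss ! i) (unif (W (r i))) ^ t)"
      using \<omega>_0[OF r(2)[OF that(1)]] by (simp add: R_def)
    finally show ?thesis by simp
  qed
  define a where "a = (\<lambda>i t. G i t \<cdot>\<^sub>v Y (r i) t)"
  have ac: "a \<in> {0..<m} \<rightarrow> gens \<rightarrow> carrier_vec m" by (auto simp: a_def Yc)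
  have "embedding_mat ss xs = mat\<^sub>r m m (\<lambda>i. finsum_vec TYPE(rat alg_closure) m (a i) gens)"
  proof (rule eq_matI)
    fix i j assume "i < dim_row (mat\<^sub>r m m (\<lambda>i. finsum_vec TYPE(rat alg_closure) m (a i) gens))"
      "j < dim_col (mat\<^sub>r m m (\<lambda>i. finsum_vec TYPE(rat alg_closure) m (a i) gens))"
    hence ij: "i < m" "j < m" by auto
    have "finsum_vec TYPE(rat alg_closure) m (a i) gens $ j = (\<Sum>t\<in>gens. a i t $ j)"
      using ac ij by (intro index_finsum_vec) (auto simp: gens_def)
    also have "\<dots> = (ss ! i) (xs ! j)"
      unfolding expand[OF ij] using ij Yc by (intro sum.cong) (auto simp: a_def Y_def)
    finally show "embedding_mat ss xs $$ (i, j) = mat\<^sub>r m m (\<lambda>i. finsum_vec TYPE(rat alg_closure) m (a i) gens) $$ (i, j)"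
      using ij len by (simp add: embedding_mat_def mat_of_rows_def)
  qed (use len in \<open>auto simp: embedding_mat_def\<close>)
  \<comment> \<open>A function assigns a slot to each row; its value \<open>f i = i\<close> outside
    the rows is the normalisation in \<open>det_linear_rows_sum\<close>.\<close>
  define \<F> where "\<F> = {f. (\<forall>i\<in>{0..<m}. f i \<in> gens) \<and> (\<forall>i. i \<notin> {0..<m} \<longrightarrow> f i = i)}"
  have "det (embedding_mat ss xs) = (\<Sum>f\<in>\<F>. det (mat\<^sub>r m m (\<lambda>i. a i (f i))))"
    unfolding \<open>embedding_mat ss xs = _\<close> \<F>_def by (rule det_linear_rows_sum[OF _ ac]) (simp add: gens_def)
  also have "\<dots> = (\<Sum>f\<in>\<F>. (\<Prod>i\<in>{0..<m}. G i (f i)) * det (mat\<^sub>r m m (\<lambda>i. Y (r i) (f i))))"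
    unfolding a_def by (intro sum.cong refl det_rows_mul) (auto simp: Yc)
  finally have det: "det (embedding_mat ss xs) =
      (\<Sum>f\<in>\<F>. (\<Prod>i\<in>{0..<m}. G i (f i)) * det (mat\<^sub>r m m (\<lambda>i. Y (r i) (f i))))" .
  define I where "I = (\<lambda>\<rho>. {i. i < m \<and> r i = \<rho>})"
  have mI: "mult_in ss \<rho> = card (I \<rho>)" for \<rho> by (simp add: mult_in_def I_def r_def len)
  \<comment> \<open>The sum 0 + 1 + ... + (s - 1) for a class meeting the rows \<open>s\<close>
    times; squaring the determinant doubles it.\<close>
  define q where "q = (\<lambda>\<rho>. card (I \<rho>) * (card (I \<rho>) - 1) div 2)"
  have q2: "2 * q \<rho> = card (I \<rho>) * (card (I \<rho>) - 1)" for \<rho>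
  proof -
    have "even (card (I \<rho>) * (card (I \<rho>) - 1))" by (cases "card (I \<rho>)") auto
    thus ?thesis unfolding q_def by simp
  qed
  define Z where "Z = (\<Prod>\<rho>\<in>Reps. \<omega> \<rho> ^ q \<rho>)"
  have Z0: "Z \<noteq> 0" unfolding Z_def using finite_Reps \<omega>_0 Reps_subset by (auto simp: prod_zero_iff)
  have summand: "(\<Prod>i\<in>{0..<m}. G i (f i)) * det (mat\<^sub>r m m (\<lambda>i. Y (r i) (f i))) / Z \<in> V" if f: "f \<in> \<F>" for f
  \<comment> \<open>Two rows of one class with the same slot are equal up to their weights, so that
    summand vanishes.\<close>
  proof (cases "\<exists>i j. i < m \<and> j < m \<and> i \<noteq> j \<and> r i = r j \<and> f i = f j")
    case True
    then obtain i j where ij: "i < m" "j < m" "i \<noteq> j" "r i = r j" "f i = f j" by blast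
    have "det (mat\<^sub>r m m (\<lambda>i. Y (r i) (f i))) = 0"
      by (rule det_identical_rows[of _ m i j]) (use ij Yc in auto)
    thus ?thesis by (simp add: V_0)
  next
    case False
    define e where "e = (\<lambda>\<rho>. \<Sum>i\<in>I \<rho>. min (f i) m)"
    have dV: "det (mat\<^sub>r m m (\<lambda>i. Y (r i) (f i))) \<in> V"
    proof -
      have fm: "f i < 2 * m" if "i < m" for i using f that by (auto simp: \<F>_def gens_def)
      have Yin: "Y (r i) (f i) $ j \<in> V" if "i < m" "j < m" for i j
        using c[OF r(1)[OF that(1)] that(2)] R[of "f i - m" j] fm[OF that(1)] that by (auto simp: Y_def)
      have car: "mat\<^sub>r m m (\<lambda>i. Y (r i) (f i)) \<in> carrier_mat m m" by simp
      show ?thesis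
        unfolding det_def'[OF car]
      proof (intro V_sum V_mult V_prod)
        fix g assume g: "g \<in> {g. g permutes {0..<m}}"
        show "signof g \<in> V" by (simp add: sign_def V_1 V_uminus)
        fix i assume i: "i \<in> {0..<m}"
        hence "g i < m" using g permutes_in_image[of g "{0..<m}" i] by simp
        thus "mat\<^sub>r m m (\<lambda>i. Y (r i) (f i)) $$ (i, g i) \<in> V"
          using i Yin by (simp add: mat_of_rows_def)
      qed
    qed
    have Gw: "G i (f i) / \<omega> (r i) ^ min (f i) m \<in> V" if i: "i < m" for i
    proof -
      have u: "(ss ! i) (unif (W (r i))) / \<omega> (r i) \<in> V"
        unfolding \<omega>_def using unif_ratio[OF r(2)[OF i] sE[OF i] r(3)[OF i, symmetric]] .
      show ?thesis
        using V_power[OF u, of "f i"] \<omega>_0[OF r(2)[OF i]]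
        by (auto simp: G_def power_divide V_0 V_1 min_def)
    qed
    have fI: "finite (I \<rho>)" for \<rho> by (simp add: I_def)
    have qe: "q \<rho> \<le> e \<rho>" for \<rho>
    proof -
      have "inj_on f (I \<rho>)"
      proof (rule inj_onI)
        fix i j assume "i \<in> I \<rho>" "j \<in> I \<rho>" "f i = f j"
        thus "i = j" using False unfolding I_def by (metis (mono_tags, lifting) mem_Collect_eq)
      qed
      moreover have "card (I \<rho>) \<le> card {..<m}" by (intro card_mono) (auto simp: I_def)
      ultimately have "card (I \<rho>) * (card (I \<rho>) - 1) \<le> 2 * e \<rho>"
        unfolding e_def using fI by (intro sum_min_distinct_ge) auto
      thus ?thesis using q2[of \<rho>] by simp
    qed
    have "(\<Prod>i\<in>{0..<m}. \<omega> (r i) ^ min (f i) m) = (\<Prod>\<rho>\<in>Reps. \<omega> \<rho> ^ e \<rho>)"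
    proof -
      have "(\<Prod>\<rho>\<in>Reps. \<Prod>i\<in>{i \<in> {0..<m}. r i = \<rho>}. \<omega> (r i) ^ min (f i) m) = (\<Prod>i\<in>{0..<m}. \<omega> (r i) ^ min (f i) m)"
        using r(1) by (intro prod.group finite_Reps) auto
      moreover have "(\<Prod>i\<in>{i \<in> {0..<m}. r i = \<rho>}. \<omega> (r i) ^ min (f i) m) = \<omega> \<rho> ^ e \<rho>" for \<rho>
      proof -
        have "{i \<in> {0..<m}. r i = \<rho>} = I \<rho>" by (auto simp: I_def)
        moreover have "(\<Prod>i\<in>I \<rho>. \<omega> (r i) ^ min (f i) m) = (\<Prod>i\<in>I \<rho>. \<omega> \<rho> ^ min (f i) m)"
          by (intro prod.cong) (auto simp: I_def)
        ultimately show ?thesis by (simp add: e_def power_sum)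
      qed
      ultimately show ?thesis by simp
    qed
    moreover have "(\<Prod>\<rho>\<in>Reps. \<omega> \<rho> ^ e \<rho>) = Z * (\<Prod>\<rho>\<in>Reps. \<omega> \<rho> ^ (e \<rho> - q \<rho>))"
      unfolding Z_def prod.distrib[symmetric] using qe by (intro prod.cong refl) (simp flip: power_add)
    moreover have "(\<Prod>i\<in>{0..<m}. G i (f i)) =
        (\<Prod>i\<in>{0..<m}. G i (f i) / \<omega> (r i) ^ min (f i) m) * (\<Prod>i\<in>{0..<m}. \<omega> (r i) ^ min (f i) m)"
      unfolding prod.distrib[symmetric] using \<omega>_0[OF r(2)] by (intro prod.cong refl) simp
    ultimately have "(\<Prod>i\<in>{0..<m}. G i (f i)) / Z =
        (\<Prod>i\<in>{0..<m}. G i (f i) / \<omega> (r i) ^ min (f i) m) * (\<Prod>\<rho>\<in>Reps. \<omega> \<rho> ^ (e \<rho> - q \<rho>))"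
      using Z0 by simp
    also have "\<dots> \<in> V"
      using Gw \<omega>_V Reps_subset by (intro V_mult V_prod V_power) auto
    finally have "(\<Prod>i\<in>{0..<m}. G i (f i)) / Z \<in> V" .
    from V_mult[OF this dV] show ?thesis by simp
  qed
  have "det (embedding_mat ss xs) / Z \<in> V"
    unfolding det sum_divide_distrib using summand by (intro V_sum)
  hence "(det (embedding_mat ss xs) / Z)\<^sup>2 \<in> V" by (rule V_power)
  moreover have "Z\<^sup>2 = (\<Prod>\<rho>\<in>Reps. \<omega> \<rho> ^ (mult_in ss \<rho> * (mult_in ss \<rho> - 1)))"
    unfolding Z_def prod_power_distrib[symmetric] mI q2[symmetric]
    by (simp add: power_mult[symmetric] mult.commute prod_power_distrib)
  ultimately show ?thesis by (simp add: power_divide)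
qed

end

section \<open>From local to global\<close>

lemma det_embedding_mat_scale:
  fixes ss :: "('k::field_char_0 \<Rightarrow> 'l::field_char_0) list"
  assumes len: "length ss = length xs" and hom: "\<And>\<sigma>. \<sigma> \<in> set ss \<Longrightarrow> field_hom \<sigma>" and y: "y \<noteq> 0"
  shows "det (embedding_mat ss xs) = (\<Prod>i<length ss. (ss ! i) y) * det (embedding_mat ss (map (\<lambda>x. x / y) xs))"
proof -
  let ?n = "length ss" and ?A = "embedding_mat ss (map (\<lambda>x. x / y) xs)"
  have eq: "(ss ! i) (xs ! j) = (ss ! i) y * (ss ! i) (xs ! j / y)" if "i < ?n" for i j
  proof -
    interpret field_hom "ss ! i" using hom nth_mem[OF that] .
    show ?thesis using y by (simp flip: hom_mult)
  qed
  have "embedding_mat ss xs = mat\<^sub>r ?n ?n (\<lambda>i. (ss ! i) y \<cdot>\<^sub>v row ?A i)"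
    using len by (intro eq_matI) (auto simp: embedding_mat_def mat_of_rows_def intro: eq)
  also have "det \<dots> = (\<Prod>i = 0..<?n. (ss ! i) y) * det (mat\<^sub>r ?n ?n (row ?A))"
    using len by (intro det_rows_mul) (auto simp: embedding_mat_def)
  also have "mat\<^sub>r ?n ?n (row ?A) = ?A"
    using len by (intro eq_matI) (auto simp: embedding_mat_def mat_of_rows_def)
  finally show ?thesis by (simp add: atLeast0LessThan)
qed

section \<open>Exponents accumulated over all sets of embeddings\<close>

context local_nf
begin

definition cls :: "('k \<Rightarrow> rat alg_closure) \<Rightarrow> ('k \<Rightarrow> rat alg_closure) set" where
  "cls \<rho> = {\<sigma> \<in> Emb. rep \<sigma> = \<rho>}"

lemma mult_in_eq:
  assumes "distinct ss" "set ss \<subseteq> Emb"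
  shows "mult_in ss \<rho> = card (set ss \<inter> cls \<rho>)"
proof -
  have "bij_betw (\<lambda>i. ss ! i) {i. i < length ss \<and> rep (ss ! i) = \<rho>} (set ss \<inter> cls \<rho>)"
    unfolding bij_betw_def
  proof
    show "inj_on ((!) ss) {i. i < length ss \<and> rep (ss ! i) = \<rho>}"
      using assms(1) by (auto simp: inj_on_def nth_eq_iff_index_eq)
    show "(!) ss ` {i. i < length ss \<and> rep (ss ! i) = \<rho>} = set ss \<inter> cls \<rho>"
      using assms(2) by (force simp: in_set_conv_nth cls_def)
  qed
  thus ?thesis unfolding mult_in_def by (rule bij_betw_same_card)
qed

lemma hom_prod_nz:
  assumes "S \<subseteq> Emb" "y \<noteq> 0"
  shows "(\<Prod>\<sigma>\<in>S. \<sigma> y) \<noteq> 0"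
proof -
  have "finite S" using assms(1) fin_Emb by (rule finite_subset)
  moreover have "\<sigma> y \<noteq> 0" if "\<sigma> \<in> S" for \<sigma>
    using that assms field_hom_eq_0_iff[OF hom_Emb] by blast
  ultimately show ?thesis by simp
qed

lemma det_sq_bound:
  assumes T: "finite T" "card T = m" and S: "S \<subseteq> Emb" "card S = m" and y: "y \<noteq> 0"
    and quot: "\<And>\<sigma> x. \<sigma> \<in> Emb \<Longrightarrow> x \<in> T \<Longrightarrow> x / y \<in> W \<sigma>"
  shows "det_sq S T / ((\<Prod>\<sigma>\<in>S. \<sigma> y)\<^sup>2 *
    (\<Prod>\<rho>\<in>Reps. \<omega> \<rho> ^ (card (S \<inter> cls \<rho>) * (card (S \<inter> cls \<rho>) - 1)))) \<in> V"
proof -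
  have "finite S" using S(1) fin_Emb by (rule finite_subset)
  then obtain ss where ss: "set ss = S" "distinct ss" using finite_distinct_list by blast
  obtain xs where xs: "set xs = T" "distinct xs" using finite_distinct_list[OF T(1)] by blast
  have len: "length ss = m" "length xs = m"
    using ss xs S(2) T(2) distinct_card[OF ss(2)] distinct_card[OF xs(2)] by simp_all
  define zs where "zs = map (\<lambda>x. x / y) xs"
  have "(\<Prod>i<length ss. (ss ! i) y) = (\<Prod>\<sigma>\<in>S. \<sigma> y)"
    by (rule prod.reindex_bij_betw[OF bij_betw_nth[OF ss(2)]]) (simp_all add: ss(1))
  hence "det (embedding_mat ss xs) = (\<Prod>\<sigma>\<in>S. \<sigma> y) * det (embedding_mat ss zs)"
    unfolding zs_def using det_embedding_mat_scale[of ss xs y] len S(1) ss(1) hom_Emb y by auto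
  moreover have "det_sq S T = (det (embedding_mat ss xs))\<^sup>2"
    using det_sq_set[OF ss(2) xs(2)] ss(1) xs(1) len by simp
  ultimately have "det_sq S T = (\<Prod>\<sigma>\<in>S. \<sigma> y)\<^sup>2 * (det (embedding_mat ss zs))\<^sup>2"
    by (simp add: power_mult_distrib)
  moreover have "(det (embedding_mat ss zs))\<^sup>2 /
      (\<Prod>\<rho>\<in>Reps. \<omega> \<rho> ^ (mult_in ss \<rho> * (mult_in ss \<rho> - 1))) \<in> V"
    using ss S(1) len quot xs(1) by (intro det_embedding_mat_bound[of ss m zs]) (auto simp: zs_def)
  moreover have "mult_in ss \<rho> = card (S \<inter> cls \<rho>)" for \<rho>
    using mult_in_eq[of ss] ss S(1) by simp
  ultimately show ?thesis using hom_prod_nz[OF S(1) y] by simp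
qed

text \<open>The bounds for the single determinants are multiplied. An embedding lies in (d - 1)
  choose (m - 1) of the sets \<open>S\<close>, with an extra factor 2 from squaring; the powers of
  the class yardsticks are counted by \<open>sum_card_inter_pairs\<close>.\<close>

lemma det_sq_prod_bound:
  assumes T: "finite T" "card T = m" "2 \<le> m" and y: "y \<noteq> 0"
    and quot: "\<And>\<sigma> x. \<sigma> \<in> Emb \<Longrightarrow> x \<in> T \<Longrightarrow> x / y \<in> W \<sigma>"
  shows "(\<Prod>S | S \<subseteq> Emb \<and> card S = m. det_sq S T) /
    ((\<Prod>\<sigma>\<in>Emb. \<sigma> y) ^ (2 * ((d - 1) choose (m - 1))) *
     (\<Prod>\<rho>\<in>Reps. \<omega> \<rho> ^ (card (cls \<rho>) * (card (cls \<rho>) - 1))) ^ ((d - 2) choose (m - 2))) \<in> V"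
proof -
  define \<S> where "\<S> = {S. S \<subseteq> (Emb :: ('k \<Rightarrow> rat alg_closure) set) \<and> card S = m}"
  have f\<S>: "finite \<S>" unfolding \<S>_def using fin_Emb by auto
  have "(\<Prod>S\<in>\<S>. det_sq S T / ((\<Prod>\<sigma>\<in>S. \<sigma> y)\<^sup>2 *
      (\<Prod>\<rho>\<in>Reps. \<omega> \<rho> ^ (card (S \<inter> cls \<rho>) * (card (S \<inter> cls \<rho>) - 1))))) \<in> V"
    using det_sq_bound[OF T(1,2) _ _ y quot] by (intro V_prod) (auto simp: \<S>_def)
  hence main: "(\<Prod>S\<in>\<S>. det_sq S T) / ((\<Prod>S\<in>\<S>. (\<Prod>\<sigma>\<in>S. \<sigma> y)\<^sup>2) *
      (\<Prod>S\<in>\<S>. \<Prod>\<rho>\<in>Reps. \<omega> \<rho> ^ (card (S \<inter> cls \<rho>) * (card (S \<inter> cls \<rho>) - 1)))) \<in> V"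
    by (simp only: prod_dividef prod.distrib)
  have count: "(\<Sum>S\<in>\<S>. of_bool (\<sigma> \<in> S)) = (d - 1) choose (m - 1)" if "\<sigma> \<in> Emb" for \<sigma>
  proof -
    have "(\<Sum>S\<in>\<S>. of_bool (\<sigma> \<in> S)) = card {S \<in> \<S>. \<sigma> \<in> S}"
      using f\<S> by (simp add: sum_of_bool_eq Int_def conj_commute)
    also have "{S \<in> \<S>. \<sigma> \<in> S} = {S. S \<subseteq> Emb \<and> card S = m \<and> {\<sigma>} \<subseteq> S}" by (auto simp: \<S>_def)
    also have "card \<dots> = (d - 1) choose (m - 1)"
      using card_supersets[OF fin_Emb, of "{\<sigma>}" m] that T(3) by (simp add: card_Emb)
    finally show ?thesis .
  qed
  have "(\<Prod>S\<in>\<S>. \<Prod>\<sigma>\<in>S. \<sigma> y) = (\<Prod>S\<in>\<S>. \<Prod>\<sigma>\<in>Emb. \<sigma> y ^ of_bool (\<sigma> \<in> S))"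
    by (intro prod.cong refl prod.mono_neutral_cong_left fin_Emb) (auto simp: \<S>_def)
  also have "\<dots> = (\<Prod>\<sigma>\<in>Emb. \<Prod>S\<in>\<S>. \<sigma> y ^ of_bool (\<sigma> \<in> S))" by (rule prod.swap)
  also have "\<dots> = (\<Prod>\<sigma>\<in>Emb. \<sigma> y ^ ((d - 1) choose (m - 1)))"
    by (intro prod.cong refl) (simp only: power_sum[symmetric] count)
  finally have "(\<Prod>S\<in>\<S>. \<Prod>\<sigma>\<in>S. \<sigma> y) = (\<Prod>\<sigma>\<in>Emb. \<sigma> y) ^ ((d - 1) choose (m - 1))"
    by (simp only: prod_power_distrib)
  hence 1: "(\<Prod>S\<in>\<S>. (\<Prod>\<sigma>\<in>S. \<sigma> y)\<^sup>2) = (\<Prod>\<sigma>\<in>Emb. \<sigma> y) ^ (2 * ((d - 1) choose (m - 1)))"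
    by (simp only: prod_power_distrib[symmetric] power_mult[symmetric] mult.commute[of 2])
  have "(\<Prod>S\<in>\<S>. \<Prod>\<rho>\<in>Reps. \<omega> \<rho> ^ (card (S \<inter> cls \<rho>) * (card (S \<inter> cls \<rho>) - 1))) =
      (\<Prod>\<rho>\<in>Reps. \<Prod>S\<in>\<S>. \<omega> \<rho> ^ (card (S \<inter> cls \<rho>) * (card (S \<inter> cls \<rho>) - 1)))"
    by (rule prod.swap)
  also have "\<dots> = (\<Prod>\<rho>\<in>Reps. (\<omega> \<rho> ^ (card (cls \<rho>) * (card (cls \<rho>) - 1))) ^ ((d - 2) choose (m - 2)))"
  proof (intro prod.cong refl)
    fix \<rho>
    have "cls \<rho> \<subseteq> Emb" by (auto simp: cls_def)
    from sum_card_inter_pairs[OF fin_Emb this T(3)]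
    show "(\<Prod>S\<in>\<S>. \<omega> \<rho> ^ (card (S \<inter> cls \<rho>) * (card (S \<inter> cls \<rho>) - 1))) =
        (\<omega> \<rho> ^ (card (cls \<rho>) * (card (cls \<rho>) - 1))) ^ ((d - 2) choose (m - 2))"
      by (simp only: power_sum[symmetric] power_mult[symmetric] \<S>_def[symmetric] card_Emb)
  qed
  finally have 2: "(\<Prod>S\<in>\<S>. \<Prod>\<rho>\<in>Reps. \<omega> \<rho> ^ (card (S \<inter> cls \<rho>) * (card (S \<inter> cls \<rho>) - 1))) =
      (\<Prod>\<rho>\<in>Reps. \<omega> \<rho> ^ (card (cls \<rho>) * (card (cls \<rho>) - 1))) ^ ((d - 2) choose (m - 2))"
    by (simp only: prod_power_distrib)
  show ?thesis using main unfolding 1 2 by (simp only: \<S>_def)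
qed

text \<open>With \<open>e\<close> the ramification index, the valuation of the left-hand side, normalised so that
  the uniformizer has valuation 1, is \<open>(n - e) * (n - e - 1)\<close>.\<close>

lemma ramification_exponent:
  assumes \<rho>: "\<rho> \<in> Emb"
  shows "\<omega> \<rho> ^ (n * (n - 1)) * of_nat p ^ (ramif (W \<rho>) + 1) / of_nat p ^ (2 * n) \<in> V"
proof -
  define e where "e = ramif (W \<rho>)"
  define u where "u = of_nat p / \<omega> \<rho> ^ e"
  have u: "vunit u" unfolding u_def e_def \<omega>_def by (rule ramif_vunit[OF \<rho>])
  have p: "of_nat p = u * \<omega> \<rho> ^ e" using \<omega>_0[OF \<rho>] by (simp add: u_def)
  \<comment> \<open>This is the inequality 0 \<le> (n - e) (n - e - 1), rearranged into sums because
    subtraction of natural numbers truncates.\<close>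
  have le: "2 * n * e \<le> n * (n - 1) + e * (e + 1)"
  proof (cases n)
    case (Suc k)
    have "0 \<le> (int k - int e) * (int k - int e + 1)"
      by (cases "k \<ge> e") (auto intro: mult_nonneg_nonneg mult_nonpos_nonpos)
    hence "int (2 * n * e) \<le> int (n * (n - 1) + e * (e + 1))" by (simp add: Suc algebra_simps)
    thus ?thesis by (simp only: of_nat_le_iff)
  qed simp
  define c where "c = n * (n - 1) + e * (e + 1) - 2 * n * e"
  have c: "n * (n - 1) + e * (e + 1) = 2 * n * e + c" using le by (simp add: c_def)
  have u0: "u \<noteq> 0" using u by (simp add: vunit_iff)
  have "\<omega> \<rho> ^ (n * (n - 1)) * of_nat p ^ (e + 1) = u ^ (e + 1) * \<omega> \<rho> ^ (n * (n - 1) + e * (e + 1))"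
  proof -
    have "(of_nat p :: rat alg_closure) ^ (e + 1) = u ^ (e + 1) * \<omega> \<rho> ^ (e * (e + 1))"
      unfolding p by (simp only: power_mult_distrib power_mult[symmetric])
    thus ?thesis by (simp only: power_add[of "\<omega> \<rho>" "n * (n - 1)"] mult.left_commute)
  qed
  also have "\<dots> = u ^ (e + 1) * (\<omega> \<rho> ^ c * \<omega> \<rho> ^ (2 * n * e))"
    unfolding c by (simp only: power_add[of "\<omega> \<rho>" "2 * n * e"] mult.commute[of "\<omega> \<rho> ^ c"])
  finally have num: "\<omega> \<rho> ^ (n * (n - 1)) * of_nat p ^ (e + 1) = u ^ (e + 1) * (\<omega> \<rho> ^ c * \<omega> \<rho> ^ (2 * n * e))" .
  have den: "(of_nat p :: rat alg_closure) ^ (2 * n) = u ^ (2 * n) * \<omega> \<rho> ^ (2 * n * e)"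
    unfolding p power_mult_distrib power_mult[symmetric] by (simp only: mult.commute[of e])
  have "\<omega> \<rho> ^ (n * (n - 1)) * of_nat p ^ (e + 1) / of_nat p ^ (2 * n) = u ^ (e + 1) / u ^ (2 * n) * \<omega> \<rho> ^ c"
    unfolding num den using \<omega>_0[OF \<rho>] u0 by simp
  moreover have "u ^ (e + 1) / u ^ (2 * n) \<in> V"
    using vunit_divide[OF vunit_power[OF u, of "e + 1"] vunit_power[OF u, of "2 * n"]] by (simp only: vunit_iff)
  ultimately show ?thesis using \<omega>_V[OF \<rho>] unfolding e_def by (simp only: V_mult V_power)
qed

lemma sum_card_cls: "(\<Sum>\<rho>\<in>Reps. card (cls \<rho>)) = d"
  using sum.group[OF fin_Emb finite_Reps, of rep "\<lambda>_. 1 :: nat"]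
  by (simp add: cls_def Reps_def card_Emb)

text \<open>Multiplying \<open>ramification_exponent\<close> over all classes, with \<open>n\<close>
  the class size, gives at least 2 d minus the sum of e + 1 factors \<open>p\<close>. By
  \<open>ramification_bounds\<close> the subtracted sum is at most \<open>d\<close> plus the inertia
  degree sum.\<close>

lemma tame_exponent:
  "(\<Prod>\<rho>\<in>Reps. \<omega> \<rho> ^ (card (cls \<rho>) * (card (cls \<rho>) - 1))) /
    of_nat p ^ (d - inertia_degree_sum TYPE('k) p) \<in> V"
proof (cases "d \<le> inertia_degree_sum TYPE('k) p")
  case True
  have "(\<Prod>\<rho>\<in>Reps. \<omega> \<rho> ^ (card (cls \<rho>) * (card (cls \<rho>) - 1))) \<in> V"
    using \<omega>_V Reps_subset by (intro V_prod V_power) auto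
  thus ?thesis using True by simp
next
  case False
  define f where "f = inertia_degree_sum TYPE('k) p"
  define k where "k = (\<Sum>\<rho>\<in>Reps. ramif (W \<rho>) + 1)"
  define A where "A = (\<Prod>\<rho>\<in>Reps. \<omega> \<rho> ^ (card (cls \<rho>) * (card (cls \<rho>) - 1)))"
  have k: "k \<le> d + f" unfolding k_def f_def sum.distrib using ramification_bounds by simp
  define P where "P = (of_nat p :: rat alg_closure)"
  have P0: "P \<noteq> 0" by (simp add: P_def)
  have "(\<Prod>\<rho>\<in>Reps. \<omega> \<rho> ^ (card (cls \<rho>) * (card (cls \<rho>) - 1)) * P ^ (ramif (W \<rho>) + 1) /
      P ^ (2 * card (cls \<rho>))) \<in> V"
    unfolding P_def using ramification_exponent Reps_subset by (intro V_prod) blast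
  also have "(\<Prod>\<rho>\<in>Reps. \<omega> \<rho> ^ (card (cls \<rho>) * (card (cls \<rho>) - 1)) * P ^ (ramif (W \<rho>) + 1) /
      P ^ (2 * card (cls \<rho>))) = A * P ^ k / P ^ (2 * d)"
    unfolding prod_dividef prod.distrib A_def k_def
    by (simp only: power_sum[symmetric] sum_distrib_left[symmetric] sum_card_cls)
  \<comment> \<open>The slack \<open>d + f - k\<close> in the bound for \<open>k\<close> is filled
    up with further factors \<open>p\<close>, which lie in \<open>V\<close>.\<close>
  finally have "A * P ^ k / P ^ (2 * d) * P ^ (d + f - k) \<in> V"
    by (rule V_mult) (simp add: P_def V_power V_of_nat)
  moreover have "A * P ^ k / P ^ (2 * d) * P ^ (d + f - k) = A / P ^ (d - f)"
  proof -
    have "2 * d = (d - f) + (k + (d + f - k))" using False k by (simp add: f_def)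
    hence "P ^ (2 * d) = P ^ (d - f) * (P ^ k * P ^ (d + f - k))" by (simp only: power_add)
    thus ?thesis using P0 by simp
  qed
  ultimately show ?thesis by (simp add: A_def P_def f_def)
qed

text \<open>With a local generator \<open>y\<close> the determinants split off powers of the norm of
  \<open>y\<close>, which contains the full \<open>p\<close>-part of the index, and of the class
  yardsticks, which contain the tame part. Multiplying the three membership statements leaves an
  integer over a power of \<open>p\<close>.\<close>

theorem prime_power_dvd:
  assumes I: "ideal (I :: 'k set) ring_of_integers" "I \<noteq> {0}"
    and T: "T \<subseteq> I" "finite T" "card T = m" "2 \<le> m"
    and N: "of_int N = (\<Prod>S | S \<subseteq> Emb \<and> card S = m. det_sq S T)"
  shows "int p ^ ((d - inertia_degree_sum TYPE('k) p) * ((d - 2) choose (m - 2)) +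
    multiplicity p (ideal_index I) * (2 * ((d - 1) choose (m - 1)))) dvd N"
proof (rule int_dvd_of_V)
  obtain y where y: "y \<in> I" "y \<noteq> 0" "\<And>\<sigma> x. \<sigma> \<in> Emb \<Longrightarrow> x \<in> I \<Longrightarrow> x / y \<in> W \<sigma>"
    by (rule ideal_minimal_element[OF I]) blast
  define Y where "Y = (\<Prod>\<sigma>\<in>Emb. \<sigma> y :: rat alg_closure)"
  define A where "A = (\<Prod>\<rho>\<in>Reps. \<omega> \<rho> ^ (card (cls \<rho>) * (card (cls \<rho>) - 1)))"
  define P where "P = (of_nat p :: rat alg_closure)"
  define \<mu> where "\<mu> = multiplicity p (ideal_index I)"
  define f where "f = d - inertia_degree_sum TYPE('k) p"
  define a where "a = (d - 2) choose (m - 2)"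
  define b where "b = 2 * ((d - 1) choose (m - 1))"
  have Y0: "Y \<noteq> 0" unfolding Y_def using y(2) by (intro hom_prod_nz) auto
  have A0: "A \<noteq> 0" unfolding A_def using finite_Reps \<omega>_0 Reps_subset by (auto simp: prod_zero_iff)
  have P0: "P \<noteq> 0" by (simp add: P_def)
  have 1: "of_int N / (Y ^ b * A ^ a) \<in> V"
    unfolding N Y_def A_def a_def b_def using y T(1) by (intro det_sq_prod_bound[OF T(2-4)]) auto
  obtain c where c: "Y = of_int (c * int (ideal_index I))"
    using index_dvd_norm(2)[OF I y(1)] unfolding Y_def by blast
  obtain r where r: "ideal_index I = p ^ \<mu> * r"
    using multiplicity_dvd[of p "ideal_index I"] unfolding \<mu>_def by (elim dvdE)
  have "Y / P ^ \<mu> = of_int (c * int r)" using P0 by (simp add: c r P_def)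
  hence "(Y / P ^ \<mu>) ^ b \<in> V" by (simp only: V_power V_of_int)
  moreover have "(A / P ^ f) ^ a \<in> V" unfolding A_def P_def f_def using tame_exponent by (rule V_power)
  ultimately have "of_int N / (Y ^ b * A ^ a) * ((Y / P ^ \<mu>) ^ b * (A / P ^ f) ^ a) \<in> V"
    using 1 by (intro V_mult)
  also have "of_int N / (Y ^ b * A ^ a) * ((Y / P ^ \<mu>) ^ b * (A / P ^ f) ^ a) = of_int N / P ^ (f * a + \<mu> * b)"
  proof -
    have "P ^ (f * a + \<mu> * b) = (P ^ f) ^ a * (P ^ \<mu>) ^ b" by (simp only: power_add power_mult)
    thus ?thesis using Y0 A0 P0 by (simp add: power_divide)
  qed
  finally show "of_int N / of_nat p ^ ((d - inertia_degree_sum TYPE('k) p) * ((d - 2) choose (m - 2)) +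
      multiplicity p (ideal_index I) * (2 * ((d - 1) choose (m - 1)))) \<in> V"
    by (simp only: P_def f_def a_def \<mu>_def b_def)
qed

end

section \<open>From the local bounds to divisibility in the integers\<close>

context nf
begin

text \<open>The extension theorem is applied to the ring of all algebraic integers: 1 / p is
  rational but not an integer, hence not in that ring.\<close>

lemma exists_local_nf:
  assumes p: "Factorial_Ring.prime (p :: nat)"
  obtains V where "local_nf TYPE('k) d V p"
proof -
  have "\<not> algebraic_int (inverse (of_nat p) :: rat alg_closure)"
  proof
    assume "algebraic_int (inverse (of_nat p) :: rat alg_closure)"
    moreover have "(inverse (of_nat p) :: rat alg_closure) \<in> \<rat>" by simp
    ultimately have "(inverse (of_nat p) :: rat alg_closure) \<in> \<int>" by (rule rational_algebraic_int_is_int)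
    then obtain n where "(inverse (of_nat p) :: rat alg_closure) = of_int n" by (auto elim: Ints_cases)
    hence "(of_int (n * int p) :: rat alg_closure) = of_int 1"
      using prime_gt_0_nat[OF p] by (simp add: field_simps)
    hence "n * int p = 1" by (simp only: of_int_eq_iff)
    hence "int p dvd 1" by (metis dvd_triv_right)
    thus False using prime_gt_1_nat[OF p] by simp
  qed
  hence inv: "inverse (of_nat p) \<notin> {x :: rat alg_closure. algebraic_int x}" by simp
  have "of_nat p \<in> {x :: rat alg_closure. algebraic_int x}" by simp
  from is_subring_algebraic_int this inv show thesis
  proof (rule exists_val_ring)
    fix V :: "rat alg_closure set" assume V: "val_ring V" "inverse (of_nat p) \<notin> V"
    have "local_nf TYPE('k) d V p"
      using V p by (intro local_nf.intro nf_axioms pval.intro alg_closure_rat_algebraic)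
    thus thesis by (rule that)
  qed
qed

lemma det_sq_prod_int:
  assumes T: "\<And>x. x \<in> T \<Longrightarrow> algebraic_int (x :: 'k)" "finite T" "card T = m" "m \<le> d"
  obtains N where "of_int N = (\<Prod>S | S \<subseteq> Emb \<and> card S = m. det_sq S T)"
proof -
  have "algebraic_int (det_sq S T)" if S: "S \<subseteq> Emb" "card S = m" for S
  proof -
    have "finite S" using S(1) fin_Emb by (rule finite_subset)
    then obtain ss where ss: "set ss = S" "distinct ss" using finite_distinct_list by blast
    obtain xs where xs: "set xs = T" "distinct xs" using finite_distinct_list[OF T(2)] by blast
    have len: "length ss = m" "length xs = m"
      using ss xs S(2) T(3) distinct_card[OF ss(2)] distinct_card[OF xs(2)] by simp_all
    have "algebraic_int ((ss ! i) (xs ! j))" if "i < m" "j < m" for i j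
    proof (rule field_hom_algebraic_int[of "ss ! i" "xs ! j"])
      have "ss ! i \<in> Emb" using nth_mem[of i ss] that len ss(1) S(1) by auto
      thus "field_hom (ss ! i)" by (simp add: embeddings_def)
      show "algebraic_int (xs ! j)" using nth_mem[of j xs] that len xs(1) T(1) by auto
    qed
    hence "algebraic_int (det (embedding_mat ss xs))"
      using len by (intro algebraic_int_det[of _ m]) (auto simp: embedding_mat_def)
    moreover have "det_sq S T = (det (embedding_mat ss xs))\<^sup>2"
      using det_sq_set[OF ss(2) xs(2)] ss(1) xs(1) len by simp
    ultimately show ?thesis by (simp add: algebraic_int_power)
  qed
  hence "algebraic_int (\<Prod>S | S \<subseteq> Emb \<and> card S = m. det_sq S T)"
    by (intro algebraic_int_prod) auto
  from rational_algebraic_int_is_int[OF this det_sq_prod_rational[OF T(2-4)]]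
  show thesis by (auto elim!: Ints_cases intro: that[OF sym])
qed

lemma tame_discriminant_pos: "tame_discriminant TYPE('k) > 0"
  unfolding tame_discriminant_def by (intro prod_pos) (auto simp: prime_gt_0_nat)

text \<open>Divisibility calls for an upper bound only. If the index set were infinite, the product
  would be 1 by convention and the multiplicity 0.\<close>

lemma multiplicity_tame_discriminant:
  assumes p: "Factorial_Ring.prime p"
  shows "multiplicity p (tame_discriminant TYPE('k)) \<le> d - inertia_degree_sum TYPE('k) p"
proof (cases "finite {p. Factorial_Ring.prime p \<and> inertia_degree_sum TYPE('k) p \<noteq> nf_degree TYPE('k)}")
  case True
  show ?thesis
    unfolding tame_discriminant_def using p
    by (subst multiplicity_prod_prime_powers[OF True]) (auto simp: d_def)
next
  case False
  thus ?thesis by (simp add: tame_discriminant_def)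
qed

theorem tame_discriminant_dvd:
  assumes I: "ideal (I :: 'k set) ring_of_integers" "I \<noteq> {0}"
    and T: "T \<subseteq> I" "finite T" "card T = m" "2 \<le> m"
    and N: "of_int N = (\<Prod>S | S \<subseteq> Emb \<and> card S = m. det_sq S T)"
  shows "int (tame_discriminant TYPE('k) ^ ((d - 2) choose (m - 2)) *
    ideal_index I ^ (2 * ((d - 1) choose (m - 1)))) dvd N"
proof (cases "N = 0")
  case False
  define D where "D = tame_discriminant TYPE('k)"
  define J where "J = ideal_index I"
  define a where "a = (d - 2) choose (m - 2)"
  define b where "b = 2 * ((d - 1) choose (m - 1))"
  have pos: "D > 0" "J > 0"
    using tame_discriminant_pos index_dvd_norm(1)[OF I] by (simp_all add: D_def J_def)
  have "D ^ a * J ^ b dvd nat \<bar>N\<bar>"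
  proof (rule multiplicity_le_imp_dvd)
    show "D ^ a * J ^ b \<noteq> 0" using pos by simp
    fix p :: nat assume p: "Factorial_Ring.prime p"
    \<comment> \<open>Each prime gets its own valuation ring; only the resulting integer
      divisibility leaves this context.\<close>
    obtain V where "local_nf TYPE('k) d V p" by (rule exists_local_nf[OF p])
    then interpret local_nf K d V p .
    have pe: "prime_elem p" using p by simp
    have "multiplicity p (D ^ a * J ^ b) = multiplicity p D * a + multiplicity p J * b"
      using pos by (simp add: prime_elem_multiplicity_mult_distrib[OF pe]
        prime_elem_multiplicity_power_distrib[OF pe] mult.commute)
    also have "\<dots> \<le> (d - inertia_degree_sum TYPE('k) p) * a + multiplicity p J * b"
      using multiplicity_tame_discriminant[OF p] by (intro add_right_mono mult_right_mono) (simp_all add: D_def)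
    also have "\<dots> \<le> multiplicity p (nat \<bar>N\<bar>)"
    proof (rule multiplicity_geI)
      have "int (p ^ ((d - inertia_degree_sum TYPE('k) p) * a + multiplicity p J * b)) dvd N"
        using prime_power_dvd[OF I T N] by (simp only: a_def b_def J_def of_nat_power)
      thus "p ^ ((d - inertia_degree_sum TYPE('k) p) * a + multiplicity p J * b) dvd nat \<bar>N\<bar>"
        by (simp only: dvd_nat_abs_iff)
    qed (use False p_gt_1 in auto)
    finally show "multiplicity p (D ^ a * J ^ b) \<le> multiplicity p (nat \<bar>N\<bar>)" .
  qed
  thus ?thesis unfolding dvd_nat_abs_iff D_def J_def a_def b_def .
qed simp

end

theorem theorem6:
  fixes \<nn> :: "'k::field_char_0 set"
    and T :: "'k set"
    and d m :: nat
  assumes "number_field TYPE('k)"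
    and "d = nf_degree TYPE('k)"
    and "d > 1"
    and "ideal \<nn> ring_of_integers"
    and "\<nn> \<noteq> {0}"
    and "m \<in> {2..d}"
    and "T \<subseteq> \<nn>"
    and "card T = m"
  shows "\<exists>N::int.
           of_int N = (\<Prod>S | S \<subseteq> embeddings \<and> card S = m. det_sq S T) \<and>
           int (tame_discriminant TYPE('k) ^ ((d - 2) choose (m - 2)) *
                ideal_index \<nn> ^ (2 * ((d - 1) choose (m - 1)))) dvd N"
proof -
  interpret nf "TYPE('k)" d using assms(1-3) by unfold_locales auto
  \<comment> \<open>An infinite set has \<open>card\<close> 0, so \<open>card T = m\<close> with m
    at least 2 forces \<open>T\<close> to be finite.\<close>
  have T: "finite T" "2 \<le> m" "m \<le> d" using assms(6,8) by (auto intro: card_ge_0_finite)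
  have "algebraic_int x" if "x \<in> T" for x
    using ideal_alg_int[OF assms(4)] that assms(7) by blast
  then obtain N where N: "of_int N = (\<Prod>S | S \<subseteq> embeddings \<and> card S = m. det_sq S T)"
    using det_sq_prod_int[OF _ T(1) assms(8) T(3)] by blast
  from tame_discriminant_dvd[OF assms(4,5,7) T(1) assms(8) T(2) N] N show ?thesis by blast
qed

end
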